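(* Let $\omega$ be a radial weight on the unit disk $\mathbb D$. Then either the Bergman projection $P_\omega$ is bounded on $L^p_\omega$, among exponents $p\in(1,\infty)$, only for $p=2$, or $P_\omega$ is bounded on $L^p_\omega$ for all $p\in(1,\infty)$.
   Context: $\mathbb D=\{z\in\mathbb C:|z|<1\}$ and $dA(z)=dx\,dy/\pi$ is normalized area measure on $\mathbb D$. A radial weight is a nonnegative (measurable) integrable function $\omega$ on $[0,1)$, extended to $\mathbb D$ by $\omega(z)=\omega(|z|)$, and it is assumed throughout that $\widehat\omega(r)=\int_r^1\omega(s)\,ds>0$ for all $0\le r<1$. For $1\le p<\infty$, $L^p_\omega$ is the space of measurable $f$ on $\mathbb D$ with $\|f\|_{L^p_\omega}^p=\int_{\mathbb D}|f|^p\omega\,dA<\infty$. Moments: $\omega_x=\int_0^1r^x\omega(r)\,dr$, $x\ge0$. The reproducing kernel of the weighted Bergman space $A^2_\omega$ (analytic functions in $L^2_\omega$) is $B_z^\omega(\zeta)=\sum_{n=0}^\infty\frac{(\overline z\zeta)^n}{2\omega_{2n+1}}$, $z,\zeta\in\mathbb D$, and the Bergman projection is $$P_\omega f(z)=\int_{\mathbb D}f(\zeta)\overline{B_z^\omega(\zeta)}\,\omega(\zeta)\,dA(\zeta).$$ For each fixed $z\in\mathbb D$ the kernel $B^\omega_z$ is bounded on $\mathbb D$, so $P_\omega f(z)$ is defined for every $f\in L^1_\omega$. Boundedness on $L^p_\omega$ means there is a constant $C$ with $\|P_\omega f\|_{L^p_\omega}\le C\|f\|_{L^p_\omega}$ for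 all $f\in L^p_\omega$. *)

theory Defs
  imports "HOL-Analysis.Analysis"
begin

text \<open>
  A weight is a function of the radius; only its values on \<open>[0,1)\<close> matter, and its radial
  extension to the disk is written out as \<open>\<omega> (norm z)\<close>.
  Measurability is Lebesgue measurability throughout.
\<close>

definition weight_hat :: "(real \<Rightarrow> real) \<Rightarrow> real \<Rightarrow> real" where
  "weight_hat \<omega> r = (LINT s:{r..<1}|lebesgue. \<omega> s)"

definition radial_weight :: "(real \<Rightarrow> real) \<Rightarrow> bool" where
  "radial_weight \<omega> \<longleftrightarrow>
     (\<forall>r\<in>{0..<1}. 0 \<le> \<omega> r) \<and>
     set_integrable lebesgue {0..<1} \<omega> \<and>
     (\<forall>r\<in>{0..<1}. 0 < weight_hat \<omega> r)"

definition disk_area :: "complex measure" where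
  "disk_area = density (restrict_space lebesgue (ball 0 1)) (\<lambda>_. ennreal (1 / pi))"

definition Lp_weighted :: "(real \<Rightarrow> real) \<Rightarrow> real \<Rightarrow> (complex \<Rightarrow> complex) set" where
  "Lp_weighted \<omega> p =
     {f \<in> borel_measurable disk_area.
        integrable disk_area (\<lambda>z. norm (f z) powr p * \<omega> (norm z))}"

definition Lp_weighted_norm :: "(real \<Rightarrow> real) \<Rightarrow> real \<Rightarrow> (complex \<Rightarrow> complex) \<Rightarrow> real" where
  "Lp_weighted_norm \<omega> p f =
     (LINT z|disk_area. norm (f z) powr p * \<omega> (norm z)) powr (1 / p)"

definition weight_moment :: "(real \<Rightarrow> real) \<Rightarrow> real \<Rightarrow> real" where
  "weight_moment \<omega> x = (LINT r:{0..<1}|lebesgue. r powr x * \<omega> r)"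

definition bergman_kernel :: "(real \<Rightarrow> real) \<Rightarrow> complex \<Rightarrow> complex \<Rightarrow> complex" where
  "bergman_kernel \<omega> z \<zeta> =
     (\<Sum>n. (cnj z * \<zeta>) ^ n / of_real (2 * weight_moment \<omega> (2 * real n + 1)))"

definition bergman_projection ::
    "(real \<Rightarrow> real) \<Rightarrow> (complex \<Rightarrow> complex) \<Rightarrow> complex \<Rightarrow> complex" where
  "bergman_projection \<omega> f z =
     (LINT \<zeta>|disk_area. f \<zeta> * cnj (bergman_kernel \<omega> z \<zeta>) * of_real (\<omega> (norm \<zeta>)))"

text \<open>
  Membership of the image in the space is required explicitly, since the real-valued norm above
  is only meaningful for elements of the space.
\<close>

definition bounded_on_Lp ::
    "((complex \<Rightarrow> complex) \<Rightarrow> complex \<Rightarrow> complex) \<Rightarrow> (real \<Rightarrow> real) \<Rightarrow> real \<Rightarrow> bool" where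
  "bounded_on_Lp T \<omega> p \<longleftrightarrow>
     (\<exists>C. \<forall>f\<in>Lp_weighted \<omega> p.
        T f \<in> Lp_weighted \<omega> p \<and> Lp_weighted_norm \<omega> p (T f) \<le> C * Lp_weighted_norm \<omega> p f)"

end

theory Submission
  imports Defs "HOL-Complex_Analysis.Complex_Analysis"
begin

text \<open>
  Write \<open>W\<^sub>j = 2 \<omega>\<^bsub>2j+1\<^esub>\<close>, so that \<open>P\<^sub>\<omega> f(z) = \<Sum>\<^sub>j z\<^sup>j \<langle>f, \<zeta>\<^sup>j\<rangle> / W\<^sub>j\<close>. For \<open>p = 2\<close> this is an orthogonal
  projection. If it is bounded for some \<open>p \<noteq> 2\<close>, testing on \<open>e\<^sup>i\<^sup>n\<^sup>\<theta> r\<^bsup>n(q-1)\<^esup>\<close> shows that the convex function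
  \<open>\<phi>(x) = ln \<omega>\<^bsub>x+1\<^esub>\<close> satisfies \<open>\<phi>(np)/p + \<phi>(nq)/q - \<phi>(2n) \<le> C\<close>; since \<open>\<phi>(x)/x \<rightarrow> 0\<close>, this second
  difference bound integrates to \<open>\<phi>(x) - \<phi>(2x) \<le> C\<close>, that is, the moments are doubling.

  Conversely, let the moments be doubling and cut the frequencies into blocks \<open>[M\<^sub>n, M\<^sub>n\<^sub>+\<^sub>1)\<close> on which \<open>W\<^sub>j\<close> is
  comparable with \<open>K\<^sup>-\<^sup>n\<close>. By Abel summation and the theorem of M. Riesz on the circle, a block of \<open>\<langle>P\<^sub>\<omega> f, g\<rangle>\<close> is at most
  \<open>C K\<^sup>n A\<^sub>n(f) A\<^sub>n(g)\<close>, where \<open>A\<^sub>n(f) = \<integral> r\<^bsup>M\<^sub>n\<^esup> \<parallel>f\<^sub>r\<parallel>\<^sub>p d\<mu>(r)\<close> and \<open>f\<^sub>r\<close> is the restriction of \<open>f\<close> to the circle of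
  radius \<open>r\<close>. Doubling gives \<open>\<integral> r\<^bsup>M\<^sub>n\<^esup> d\<mu> \<le> C K\<^sup>-\<^sup>n\<close>, and a discrete Hardy inequality then bounds
  \<open>\<Sum>\<^sub>n K\<^sup>n A\<^sub>n(f) A\<^sub>n(g)\<close> by \<open>\<parallel>f\<parallel>\<^sub>p \<parallel>g\<parallel>\<^sub>q\<close> for every \<open>p\<close>.
\<close>

section \<open>Hoelder's inequality\<close>

text \<open>For a general radial weight the kernel has no explicit form, so everything is done with
  coefficients. The necessity half rests on two facts about the moments: they are log-convex, and
  they decay more slowly than any geometric sequence because every annulus at the boundary has mass.
  Convexity alone does not suffice, since the test functions control only the gap between
  neighbouring chord slopes; the slow decay makes the slopes tend to 0 and so permits summation from
  infinity. In the other half the norm of the projection is not known to be finite beforehand. It is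
  therefore reached only through pairings with bounded functions supported in smaller disks, and the
  theorem of Riesz is proved as a bilinear estimate whose constant does not depend on the window of
  frequencies. Circles are null sets of the plane, so slices of a Lebesgue measurable function need
  not be measurable; the analysis is done for Borel functions and transferred at the end.\<close>

definition Lnorm :: "'a measure \<Rightarrow> real \<Rightarrow> ('a \<Rightarrow> 'b::real_normed_vector) \<Rightarrow> real" where
  "Lnorm M p f = (LINT x|M. norm (f x) powr p) powr (1 / p)"

lemma Lnorm_nonneg [simp]: "0 \<le> Lnorm M p f"
  by (simp add: Lnorm_def)

lemma Lnorm_powr:
  assumes "p > 0"
  shows "Lnorm M p f powr p = (LINT x|M. norm (f x) powr p)"
  using assms by (simp add: Lnorm_def powr_powr)

lemma conjugate_exponentD:
  fixes p q :: real
  assumes "p > 1" "1/p + 1/q = 1"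
  shows "q > 1" "q = p / (p - 1)" "(p - 1) * q = p" "(q - 1) * p = q" "p + q = p * q"
proof -
  have q0: "q \<noteq> 0" using assms by auto
  have 1: "p + q = p * q" using assms q0 by (simp add: field_simps)
  then show "p + q = p * q" .
  have "q * (p - 1) = p" using 1 by (simp add: algebra_simps)
  then show 2: "q = p / (p - 1)" "(p - 1) * q = p" using assms by (auto simp: field_simps)
  show "q > 1" using assms unfolding 2 by (simp add: field_simps)
  show "(q - 1) * p = q" using 1 by (simp add: algebra_simps)
qed

lemma integrable_Holder:
  fixes f :: "'a \<Rightarrow> 'b::{real_normed_vector,second_countable_topology}"
  fixes g :: "'a \<Rightarrow> 'c::{real_normed_vector,second_countable_topology}"
  assumes pq: "p > 1" "1/p + 1/q = 1"
    and [measurable]: "f \<in> borel_measurable M" "g \<in> borel_measurable M"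
    and f: "integrable M (\<lambda>x. norm (f x) powr p)"
    and g: "integrable M (\<lambda>x. norm (g x) powr q)"
  shows "integrable M (\<lambda>x. norm (f x) * norm (g x))"
proof (rule Bochner_Integration.integrable_bound)
  show "integrable M (\<lambda>x. norm (f x) powr p / p + norm (g x) powr q / q)"
    using f g by auto
  show "AE x in M. norm (norm (f x) * norm (g x)) \<le> norm (norm (f x) powr p / p + norm (g x) powr q / q)"
    using Youngs_inequality[OF pq(1) conjugate_exponentD(1)[OF pq] pq(2)]
    by (auto intro!: AE_I2 order_trans[OF _ abs_ge_self])
qed auto

lemma Holder_ineq:
  fixes f :: "'a \<Rightarrow> 'b::{real_normed_vector,second_countable_topology}"
  fixes g :: "'a \<Rightarrow> 'c::{real_normed_vector,second_countable_topology}"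
  assumes pq: "p > 1" "1/p + 1/q = 1"
    and m[measurable]: "f \<in> borel_measurable M" "g \<in> borel_measurable M"
    and f: "integrable M (\<lambda>x. norm (f x) powr p)"
    and g: "integrable M (\<lambda>x. norm (g x) powr q)"
  shows "(LINT x|M. norm (f x) * norm (g x)) \<le> Lnorm M p f * Lnorm M q g"
proof -
  have q1: "q > 1" using conjugate_exponentD[OF pq] by simp
  have int: "integrable M (\<lambda>x. norm (f x) * norm (g x))"
    by (rule integrable_Holder[OF pq m f g])
  consider "Lnorm M p f = 0" | "Lnorm M q g = 0" | "Lnorm M p f > 0" "Lnorm M q g > 0"
    using Lnorm_nonneg[of M p f] Lnorm_nonneg[of M q g] by linarith
  then show ?thesis
  proof cases
    case 1
    then have "(LINT x|M. norm (f x) powr p) = 0"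
      by (simp add: Lnorm_def)
    then have "AE x in M. norm (f x) powr p = 0"
      using integral_nonneg_eq_0_iff_AE[OF f] by auto
    then have "AE x in M. norm (f x) * norm (g x) = 0" by eventually_elim auto
    then have "(LINT x|M. norm (f x) * norm (g x)) = 0"
      by (rule integral_eq_zero_AE)
    then show ?thesis by simp
  next
    case 2
    then have "(LINT x|M. norm (g x) powr q) = 0"
      by (simp add: Lnorm_def)
    then have "AE x in M. norm (g x) powr q = 0"
      using integral_nonneg_eq_0_iff_AE[OF g] by auto
    then have "AE x in M. norm (f x) * norm (g x) = 0" by eventually_elim auto
    then have "(LINT x|M. norm (f x) * norm (g x)) = 0"
      by (rule integral_eq_zero_AE)
    then show ?thesis by simp
  next
    case 3
    define F G where "F = Lnorm M p f" and "G = Lnorm M q g"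
    have pos: "F > 0" "G > 0" using 3 by (auto simp: F_def G_def)
    have "(LINT x|M. (norm (f x) / F) * (norm (g x) / G)) \<le>
      (LINT x|M. norm (f x) powr p / F powr p / p + norm (g x) powr q / G powr q / q)"
    proof (rule integral_mono)
      show "integrable M (\<lambda>x. (norm (f x) / F) * (norm (g x) / G))"
        using int by simp
      show "integrable M (\<lambda>x. norm (f x) powr p / F powr p / p + norm (g x) powr q / G powr q / q)"
        using f g by simp
      show "(norm (f x) / F) * (norm (g x) / G) \<le> norm (f x) powr p / F powr p / p + norm (g x) powr q / G powr q / q" for x
        using Youngs_inequality[OF pq(1) q1 pq(2), of "norm (f x) / F" "norm (g x) / G"] pos
        by (simp add: powr_divide)
    qed
    also have "\<dots> = (LINT x|M. norm (f x) powr p) / F powr p / p + (LINT x|M. norm (g x) powr q) / G powr q / q"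
      using f g by simp
    also have "\<dots> = 1 / p + 1 / q"
      unfolding F_def G_def using pq q1 pos Lnorm_powr[of p M f] Lnorm_powr[of q M g]
      by (metis F_def G_def divide_self_if less_numeral_extra(3) not_one_less_zero order.strict_trans powr_eq_0_iff zero_less_one)
    finally have "(LINT x|M. (norm (f x) * norm (g x))) / (F * G) \<le> 1"
      using pq by simp
    then show ?thesis using pos by (simp add: F_def G_def)
  qed
qed

lemma integrable_of_powr_integrable:
  fixes f :: "'a \<Rightarrow> 'b::{banach,second_countable_topology}"
  assumes "finite_measure M" "p \<ge> 1"
    and [measurable]: "f \<in> borel_measurable M"
    and f: "integrable M (\<lambda>x. norm (f x) powr p)"
  shows "integrable M f"
proof (rule Bochner_Integration.integrable_bound)
  interpret finite_measure M by fact
  show "integrable M (\<lambda>x. 1 + norm (f x) powr p)" using f by simp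
  have "t \<le> 1 + t powr p" if "t \<ge> 0" for t :: real
  proof (cases "t \<le> 1")
    case True then show ?thesis by (smt (verit) powr_ge_zero)
  next
    case False then have "t powr 1 \<le> t powr p" using assms by (intro powr_mono) auto
    then show ?thesis using False by simp
  qed
  then show "AE x in M. norm (f x) \<le> norm (1 + norm (f x) powr p)"
    by (auto intro!: AE_I2)  
qed auto

text \<open>A crude constant is enough; the same \<open>2 powr p\<close> later decides how fast the
  blocks of frequencies must grow.\<close>

lemma norm_add_powr_le:
  fixes a b :: "'a::real_normed_vector"
  assumes "p > 0"
  shows "norm (a + b) powr p \<le> 2 powr p * (norm a powr p + norm b powr p)"
proof -
  have "norm (a + b) \<le> 2 * max (norm a) (norm b)"
    using norm_triangle_ineq[of a b] by linarith
  then have "norm (a + b) powr p \<le> (2 * max (norm a) (norm b)) powr p"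
    using assms by (intro powr_mono2) auto
  also have "\<dots> = 2 powr p * max (norm a) (norm b) powr p" by (simp add: powr_mult)
  also have "\<dots> \<le> 2 powr p * (norm a powr p + norm b powr p)"
    by (intro mult_left_mono) (auto simp: max_def)
  finally show ?thesis .
qed

section \<open>The theorem of M. Riesz on the circle\<close>

text \<open>Normalized arc length, kept as a measure on the whole line: functions of the angle are
  plain Borel functions on the reals, and shifting the angle never leaves the space.\<close>

definition circle_measure :: "real measure" where
  "circle_measure = density lborel (\<lambda>t. ennreal (indicator {0..2*pi} t / (2*pi)))"

lemma space_circle [simp]: "space circle_measure = UNIV"
  and sets_circle [measurable_cong, simp]: "sets circle_measure = sets borel"
  by (simp_all add: circle_measure_def)

lemma integral_circle:
  fixes f :: "real \<Rightarrow> 'a::{banach,second_countable_topology}"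
  assumes [measurable]: "f \<in> borel_measurable borel"
  shows "(LINT t|circle_measure. f t) = (LINT t|lborel. indicator {0..2*pi} t *\<^sub>R f t) /\<^sub>R (2*pi)"
proof -
  have "(LINT t|circle_measure. f t) = (LINT t|lborel. (indicator {0..2*pi} t / (2*pi)) *\<^sub>R f t)"
    unfolding circle_measure_def by (subst integral_density) auto
  also have "(\<lambda>t. (indicator {0..2*pi} t / (2*pi)) *\<^sub>R f t) =
      (\<lambda>t. inverse (2*pi) *\<^sub>R (indicator {0..2*pi} t *\<^sub>R f t))"
    by (rule ext) (simp only: scaleR_scaleR divide_inverse mult.commute[of "inverse (2*pi)"])
  finally show ?thesis by (simp only: integral_scaleR_right)
qed

lemma emeasure_circle: "emeasure circle_measure UNIV = 1"
proof -
  have "emeasure circle_measure UNIV = (\<integral>\<^sup>+t. ennreal (1/(2*pi)) * indicator {0..2*pi} t \<partial>lborel)"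
    unfolding circle_measure_def
    by (subst emeasure_density) (auto intro!: nn_integral_cong simp: indicator_def)
  also have "\<dots> = ennreal (1/(2*pi)) * ennreal (2*pi)"
    by (subst nn_integral_cmult_indicator) auto
  also have "\<dots> = 1" by (simp flip: ennreal_mult)
  finally show ?thesis .
qed

lemma measure_circle [simp]: "measure circle_measure UNIV = 1"
  by (simp add: measure_def emeasure_circle)

interpretation circle: finite_measure circle_measure
  by standard (simp add: emeasure_circle)

lemma integrable_circle_bounded:
  fixes f :: "real \<Rightarrow> 'a::{banach,second_countable_topology}"
  assumes "f \<in> borel_measurable borel" "\<And>t. norm (f t) \<le> B"
  shows "integrable circle_measure f"
  using assms by (intro circle.integrable_const_bound[of _ B]) auto

lemma measurable_cis [measurable]: "cis \<in> borel_measurable borel"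
  by (intro borel_measurable_continuous_onI continuous_intros)

lemma measurable_cnj [measurable]: "cnj \<in> borel_measurable borel"
  by (intro borel_measurable_continuous_onI continuous_intros)

lemma circle_character:
  "(LINT t|circle_measure. cis (of_int n * t)) = (if n = 0 then 1 else 0)"
proof (cases "n = 0")
  case False
  define F where "F = (\<lambda>t. cis (of_int n * t) / (\<i> * of_int n))"
  have "(LINT t|lborel. indicator {0..2*pi} t *\<^sub>R cis (of_int n * t)) = F (2*pi) - F 0"
  proof (rule integral_FTC_Icc)
    fix t :: real
    have "((\<lambda>t. exp (\<i> * (of_int n * of_real t)) / (\<i> * of_int n)) has_vector_derivative exp (\<i> * (of_int n * of_real t))) (at t within {0..2*pi})"
      using False
      by (auto intro!: derivative_eq_intros has_vector_derivative_real_field simp: field_simps)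
    then show "(F has_vector_derivative cis (of_int n * t)) (at t within {0..2*pi})"
      by (simp add: F_def cis_conv_exp)
  qed (auto intro!: continuous_intros)
  also have "\<dots> = 0"
    using cis_multiple_2pi[of "of_int n"] by (simp add: F_def mult.commute)
  finally have "(LINT t|lborel. indicator {0..2*pi} t *\<^sub>R cis (of_int n * t)) = 0" .
  moreover have "(\<lambda>t. cis (of_int n * t)) \<in> borel_measurable borel"
    by (intro borel_measurable_continuous_onI continuous_intros)
  ultimately show ?thesis using False by (subst integral_circle) auto
qed auto

lemma circle_character_minus:
  "(LINT t|circle_measure. cis (- (of_nat n * t))) = (if n = 0 then 1 else 0)"
  using circle_character[of "- int n"] by simp

text \<open>Termwise integration for any factor \<open>e\<close> bounded by 1. Below,
  \<open>e\<close> is a character of the circle, a rescaled coordinate cut off to a smaller disk, or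
  a conjugate coordinate cut off to the closed disk.\<close>

lemma power_series_integral:
  fixes g e :: "'a \<Rightarrow> complex"
  assumes [measurable]: "g \<in> borel_measurable M" "e \<in> borel_measurable M"
    and e: "\<And>t. norm (e t) \<le> 1" and g: "integrable M g" and a: "summable (\<lambda>n. norm (a n))"
  shows "integrable M (\<lambda>t. (\<Sum>n. a n * e t ^ n) * g t)"
    and "(\<lambda>n. a n * (LINT t|M. e t ^ n * g t)) sums (LINT t|M. (\<Sum>n. a n * e t ^ n) * g t)"
proof -
  have en: "norm (e t ^ n) \<le> 1" for n t using e[of t] by (simp add: norm_power power_le_one)
  have bd: "norm (a n * e t ^ n * g t) \<le> norm (a n) * norm (g t)" for n t
    using mult_right_mono[OF mult_left_mono[OF en[of t n], of "norm (a n)"], of "norm (g t)"] 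
    by (simp add: norm_mult)
  have int: "integrable M (\<lambda>t. a n * e t ^ n * g t)" for n
    by (rule Bochner_Integration.integrable_bound[where f = "\<lambda>t. norm (a n) * norm (g t)"])
       (use g bd in \<open>auto\<close>)
  have s1: "summable (\<lambda>n. norm (a n * e t ^ n * g t))" for t
    by (rule summable_comparison_test'[OF summable_mult2[OF a, of "norm (g t)"]])
       (use bd in auto)
  have s0: "summable (\<lambda>n. a n * e t ^ n)" for t
    by (rule summable_norm_cancel, rule summable_comparison_test'[OF a])
       (use mult_left_mono[OF en] in \<open>simp add: norm_mult\<close>)
  have s2: "summable (\<lambda>n. LINT t|M. norm (a n * e t ^ n * g t))"
  proof (rule summable_comparison_test'[OF summable_mult2[OF a, of "LINT t|M. norm (g t)"]])
    fix n :: nat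
    have "(LINT t|M. norm (a n * e t ^ n * g t)) \<le> (LINT t|M. norm (a n) * norm (g t))"
      by (rule integral_mono) (use int g bd in auto)
    then show "norm (LINT t|M. norm (a n * e t ^ n * g t)) \<le> norm (a n) * (LINT t|M. norm (g t))"
      by simp
  qed
  have eq: "(\<Sum>n. a n * e t ^ n * g t) = (\<Sum>n. a n * e t ^ n) * g t" for t
    using suminf_mult2[OF s0[of t], of "g t"] by simp
  show "integrable M (\<lambda>t. (\<Sum>n. a n * e t ^ n) * g t)"
    using integrable_suminf[OF int _ s2] s1 by (simp add: eq)
  show "(\<lambda>n. a n * (LINT t|M. e t ^ n * g t)) sums (LINT t|M. (\<Sum>n. a n * e t ^ n) * g t)"
    using sums_integral[OF int _ s2] s1 by (simp add: eq[symmetric] mult.assoc)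
qed

text \<open>In the Taylor series, integrated term by term, only the constant term survives.\<close>

lemma circle_mean_value:
  assumes "G holomorphic_on ball 0 1" "0 \<le> r" "r < 1"
  shows "integrable circle_measure (\<lambda>t. G (of_real r * cis t))"
    and "(LINT t|circle_measure. G (of_real r * cis t)) = G 0"
proof -
  define a where "a = (\<lambda>n. (deriv ^^ n) G 0 / fact n)"
  have s: "(\<lambda>n. a n * w ^ n) sums G w" if "norm w < 1" for w
    using holomorphic_power_series[OF assms(1), of w] that by (simp add: a_def)
  \<comment> \<open>\<open>(r+1)/2\<close> lies in the disk and beyond \<open>r\<close>, so the
    series converges absolutely at \<open>r\<close>.\<close>
  have sa: "summable (\<lambda>n. norm (a n * of_real r ^ n))"
    by (rule powser_insidea[OF sums_summable[OF s, of "of_real ((r+1)/2)"]]) (use assms in auto)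
  have eq: "G (of_real r * cis t) = (\<Sum>n. (a n * of_real r ^ n) * cis t ^ n) * 1" for t
    using s[of "of_real r * cis t"] assms
    by (simp add: norm_mult power_mult_distrib sums_iff mult.assoc)
  note ps = power_series_integral[where g = "\<lambda>_. 1" and e = cis and M = circle_measure, OF _ _ _ _ sa]
  show "integrable circle_measure (\<lambda>t. G (of_real r * cis t))"
    unfolding eq by (rule ps) (auto, measurable)
  have "(\<lambda>n. a n * of_real r ^ n * (LINT t|circle_measure. cis t ^ n * 1)) sums
      (LINT t|circle_measure. (\<Sum>n. (a n * of_real r ^ n) * cis t ^ n) * 1)"
    by (rule ps) (auto, measurable)
  then have "(\<lambda>n. a n * of_real r ^ n * (LINT t|circle_measure. cis t ^ n * 1)) sums
      (LINT t|circle_measure. G (of_real r * cis t))"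
    by (simp only: eq)
  moreover have "(LINT t|circle_measure. cis t ^ n * 1) = (if n = 0 then 1 else 0)" for n
    using circle_character[of "int n"] by (simp add: Complex.DeMoivre)
  then have "(\<lambda>n. a n * of_real r ^ n * (LINT t|circle_measure. cis t ^ n * 1)) = 
      (\<lambda>n. if n = 0 then a 0 else 0)"
    by auto
  ultimately have "(\<lambda>n. if n = 0 then a 0 else 0) sums (LINT t|circle_measure. G (of_real r * cis t))"
    by (simp only:)
  then have "(LINT t|circle_measure. G (of_real r * cis t)) = a 0"
    by (rule sums_unique2) (rule sums_single[of 0 "\<lambda>_. a 0"])
  then show "(LINT t|circle_measure. G (of_real r * cis t)) = G 0"
    using s[of 0] by (simp add: a_def)
qed

text \<open>With \<open>\<alpha> = arg w\<close> this says \<open>1 \<le> A cos\<^sup>p \<alpha> - B cos (p \<alpha>)\<close> for \<open>\<bar>\<alpha>\<bar> < \<pi>/2\<close>: near \<open>\<pi>/2\<close> the second term helps because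
  \<open>\<pi>/2 < p \<pi>/2 \<le> \<pi>\<close>. Integrated over a circle, the last term is harmonic and drops out.\<close>

lemma riesz_pointwise:
  fixes p :: real
  assumes "1 < p" "p \<le> 2"
  obtains A B where "A \<ge> 0" "B \<ge> 0"
    "\<And>w. Re w > 0 \<Longrightarrow> norm w powr p \<le> A * Re w powr p - B * Re (w powr of_real p)"
proof -
  \<comment> \<open>The midpoint of \<open>pi/(2p)\<close> and \<open>pi/2\<close>: then
    \<open>p * a0\<close> lies strictly between \<open>pi/2\<close> and \<open>pi\<close>, where the
    cosine is negative.\<close>
  define a0 where "a0 = (pi / (2*p) + pi/2) / 2"
  have a0: "pi / (2*p) < a0" "a0 < pi/2" "0 < a0"
  proof -
    have *: "pi / (2*p) < pi/2" using assms by (intro divide_strict_left_mono) auto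
    have "x < (x + y) / 2" "(x + y) / 2 < y" if "x < y" for x y :: real using that by auto
    from this[OF *] show "pi / (2*p) < a0" "a0 < pi/2" unfolding a0_def by blast+
    have "pi / (2*p) > 0" using assms by auto
    then show "a0 > 0" unfolding a0_def by (simp add: add_pos_pos)
  qed
  have pa: "pi/2 < p * a0" using a0(1) assms by (simp add: field_simps)
  have pa2: "p * a0 < pi"
  proof -
    have "p * a0 \<le> 2 * a0" using assms a0 by simp
    then show ?thesis using a0 by linarith
  qed
  define d where "d = - cos (p * a0)"
  have d: "d > 0" unfolding d_def using cos_monotone_0_pi[of "pi/2" "p * a0"] pa pa2 by simp
  define c where "c = cos a0 powr p"
  have c: "c > 0" unfolding c_def using cos_gt_zero_pi[of a0] a0 by simp
  \<comment> \<open>The constants serve two zones. Up to \<open>a0\<close> the first term is at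
    least \<open>1 + 1/d\<close>, which pays for the second, at most \<open>1/d\<close>; beyond
    \<open>a0\<close> the second term, with its sign, contributes at least 1.\<close>
  have key: "1 \<le> (1 + 1/d) / c * cos \<alpha> powr p - (1/d) * cos (p * \<alpha>)" if "\<bar>\<alpha>\<bar> < pi/2" for \<alpha>
  proof -
    have cosa: "cos \<alpha> = cos \<bar>\<alpha>\<bar>" "cos (p * \<alpha>) = cos (p * \<bar>\<alpha>\<bar>)"
      by (auto simp: abs_if)
    show ?thesis
    proof (cases "\<bar>\<alpha>\<bar> \<le> a0")
      case True
      have "cos a0 \<le> cos \<alpha>" unfolding cosa using True a0
        by (intro cos_monotone_0_pi_le) auto
      then have "c \<le> cos \<alpha> powr p" unfolding c_def
        using assms a0 cos_gt_zero_pi[of a0] by (intro powr_mono2) auto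
      then have "(1 + 1/d) / c * c \<le> (1 + 1/d) / c * cos \<alpha> powr p"
        using c d by (intro mult_left_mono) auto
      moreover have "(1/d) * cos (p * \<alpha>) \<le> (1/d) * 1" using d by (intro mult_left_mono) auto
      ultimately show ?thesis using c by simp
    next
      case False
      have "p * \<bar>\<alpha>\<bar> \<le> 2 * \<bar>\<alpha>\<bar>" using assms by (intro mult_right_mono) auto
      then have "p * \<bar>\<alpha>\<bar> \<le> pi" using that by linarith
      then have "cos (p * \<alpha>) \<le> cos (p * a0)" unfolding cosa
        using False assms a0 by (intro cos_monotone_0_pi_le) auto
      then have "(1/d) * cos (p * \<alpha>) \<le> (1/d) * (- d)" using d
        by (intro mult_left_mono) (auto simp: d_def)
      moreover have "0 \<le> (1 + 1/d) / c * cos \<alpha> powr p" using c d by simp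
      ultimately show ?thesis using d by simp
    qed
  qed
  show ?thesis
  proof (rule that[of "(1 + 1/d) / c" "1/d"])
    fix w :: complex assume w: "Re w > 0"
    define \<alpha> where "\<alpha> = Im (Ln w)"
    have w0: "w \<noteq> 0" using w by auto
    have \<alpha>: "\<bar>\<alpha>\<bar> < pi/2" unfolding \<alpha>_def using Re_Ln_pos_lt[OF w0] w by simp
    have "w = exp (Ln w)" using w0 by simp
    then have "Re w = exp (Re (Ln w)) * cos \<alpha>" unfolding \<alpha>_def by (metis Re_exp)
    then have 1: "Re w = norm w * cos \<alpha>" using w0 by simp
    have "Re (w powr of_real p) = exp (p * ln (norm w)) * cos (p * \<alpha>)"
      using w0 by (simp add: powr_def Re_exp \<alpha>_def)
    then have 2: "Re (w powr of_real p) = norm w powr p * cos (p * \<alpha>)"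
      using w0 by (simp add: powr_def)
    have "norm w powr p * 1 \<le> norm w powr p * ((1 + 1/d) / c * cos \<alpha> powr p - (1/d) * cos (p * \<alpha>))"
      by (intro mult_left_mono key \<alpha>) auto
    also have "\<dots> = (1 + 1/d) / c * Re w powr p - (1/d) * Re (w powr of_real p)"
      unfolding 2 unfolding 1 by (simp add: powr_mult algebra_simps)
    finally show "norm w powr p \<le> (1 + 1/d) / c * Re w powr p - 1 / d * Re (w powr of_real p)"
      by simp
  qed (use c d in auto)
qed

section \<open>Fourier coefficients, the Herglotz transform and the Poisson kernel\<close>

definition fourier_coeff :: "(real \<Rightarrow> complex) \<Rightarrow> nat \<Rightarrow> complex" where
  "fourier_coeff f n = (LINT t|circle_measure. cis (- (real n * t)) * f t)"

lemma norm_fourier_coeff_le: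
  assumes "integrable circle_measure f"
  shows "norm (fourier_coeff f n) \<le> (LINT t|circle_measure. norm (f t))"
proof -
  have "norm (fourier_coeff f n) \<le> (LINT t|circle_measure. norm (cis (- (real n * t)) * f t))"
    unfolding fourier_coeff_def by (rule integral_norm_bound)
  then show ?thesis by (simp add: norm_mult)
qed

lemma summable_geometric_norm:
  fixes c :: "nat \<Rightarrow> complex"
  assumes "\<And>n. norm (c n) \<le> B" "norm z < 1"
  shows "summable (\<lambda>n. norm (c n * z ^ n))"
proof (rule summable_comparison_test'[where N = 0])
  show "summable (\<lambda>n. B * norm z ^ n)" using assms by (intro summable_mult) auto
  show "norm (norm (c n * z ^ n)) \<le> B * norm z ^ n" for n
    using assms(1)[of n] by (auto simp: norm_mult norm_power intro: mult_right_mono)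
qed

text \<open>Twice the analytic part minus the mean. For real boundary data its real part is the
  Poisson integral and its value at 0 is real; the analytic part itself lacks this positivity
  structure.\<close>

definition herglotz :: "(real \<Rightarrow> complex) \<Rightarrow> complex \<Rightarrow> complex" where
  "herglotz f z = 2 * (\<Sum>n. fourier_coeff f n * z ^ n) - fourier_coeff f 0"

text \<open>The real part of the Herglotz kernel \<open>(1+x)/(1-x)\<close>, in the form in which
  the geometric series delivers it.\<close>

definition poisson :: "real \<Rightarrow> real \<Rightarrow> real" where
  "poisson r u = Re (2 / (1 - of_real r * cis u) - 1)"

lemma poisson_eq:
  assumes "0 \<le> r" "r < 1"
  shows "poisson r u = (1 - r\<^sup>2) / (norm (1 - of_real r * cis u))\<^sup>2"
proof -
  define x where "x = of_real r * cis u"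
  have nx: "norm x = r" using assms by (simp add: x_def norm_mult)
  then have x1: "1 - x \<noteq> 0" using assms by auto
  have "2 / (1 - x) - 1 = (1 + x) / (1 - x)" using x1 by (simp add: field_simps)
  also have "\<dots> = (1 + x) * cnj (1 - x) / ((1 - x) * cnj (1 - x))" using x1 by simp
  also have "\<dots> = (1 + x) * cnj (1 - x) / of_real ((norm (1 - x))\<^sup>2)"
    by (simp only: complex_norm_square)
  finally have "Re (2 / (1 - x) - 1) = Re ((1 + x) * cnj (1 - x)) / (norm (1 - x))\<^sup>2"
    by simp
  also have "Re ((1 + x) * cnj (1 - x)) = 1 - (norm x)\<^sup>2"
    by (simp add: cmod_power2) (simp add: algebra_simps power2_eq_square)
  finally show ?thesis by (simp add: poisson_def x_def[symmetric] nx)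
qed

lemma poisson_bounds:
  assumes "0 \<le> r" "r < 1"
  shows "poisson r u > 0" "poisson r u \<le> (1 - r\<^sup>2) / (1 - r)\<^sup>2"
proof -
  have "1 - r \<le> norm (1 - of_real r * cis u)"
    using norm_triangle_ineq2[of 1 "of_real r * cis u"] assms by (simp add: norm_mult)
  then have *: "(1 - r)\<^sup>2 \<le> (norm (1 - of_real r * cis u))\<^sup>2"
    using assms by (intro power_mono) auto
  have r2: "0 < 1 - r\<^sup>2" "0 < (1-r)\<^sup>2" using assms by (auto simp: power_less_one_iff abs_square_less_1)
  show "poisson r u > 0" unfolding poisson_eq[OF assms] using * r2 by (intro divide_pos_pos) linarith+
  show "poisson r u \<le> (1 - r\<^sup>2) / (1 - r)\<^sup>2"
    unfolding poisson_eq[OF assms] using * r2 by (intro divide_left_mono mult_pos_pos) linarith+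
qed

lemma measurable_poisson [measurable]: "poisson r \<in> borel_measurable borel"
  unfolding poisson_def by measurable

lemma poisson_minus: "0 \<le> r \<Longrightarrow> r < 1 \<Longrightarrow> poisson r (- u) = poisson r u"
proof -
  assume "0 \<le> r" "r < 1"
  moreover have "norm (1 - of_real r * cis (- u)) = norm (1 - of_real r * cis u)"
    using complex_mod_cnj[of "1 - of_real r * cis u"] by (simp add: cis_cnj)
  ultimately show ?thesis by (simp add: poisson_eq)
qed

text \<open>The geometric series is summed under the integral.\<close>

lemma riesz_kernel:
  assumes [measurable]: "f \<in> borel_measurable borel" and f: "integrable circle_measure f"
    and r: "0 \<le> r" "r < 1"
  shows "herglotz f (of_real r * cis \<theta>) =
      (LINT t|circle_measure. (2 / (1 - of_real r * cis (\<theta> - t)) - 1) * f t)"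
    and "integrable circle_measure (\<lambda>t. (2 / (1 - of_real r * cis (\<theta> - t)) - 1) * f t)"
proof -
  have sa: "summable (\<lambda>n. norm ((of_real r * cis \<theta>) ^ n))"
    using r by (simp add: norm_power norm_mult)
  have geo: "(\<Sum>n. (of_real r * cis \<theta>) ^ n * cis (- t) ^ n) = 1 / (1 - of_real r * cis (\<theta> - t))" for t
  proof -
    have "(\<Sum>n. (of_real r * cis \<theta>) ^ n * cis (- t) ^ n) = (\<Sum>n. (of_real r * cis (\<theta> - t)) ^ n)"
      by (simp add: power_mult_distrib[symmetric] cis_mult mult.assoc)
    also have "\<dots> = 1 / (1 - of_real r * cis (\<theta> - t))"
      using r by (intro suminf_geometric) (simp add: norm_mult)
    finally show ?thesis .
  qed
  note ps = power_series_integral[where g = f and e = "\<lambda>t. cis (- t)" and M = circle_measure, OF _ _ _ f sa]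
  have 1: "integrable circle_measure (\<lambda>t. 1 / (1 - of_real r * cis (\<theta> - t)) * f t)"
    using ps(1) by (simp add: geo)
  have "(\<lambda>n. (of_real r * cis \<theta>) ^ n * (LINT t|circle_measure. cis (- t) ^ n * f t)) sums
     (LINT t|circle_measure. 1 / (1 - of_real r * cis (\<theta> - t)) * f t)"
    using ps(2) by (simp add: geo)
  moreover have "(LINT t|circle_measure. cis (- t) ^ n * f t) = fourier_coeff f n" for n
    unfolding fourier_coeff_def Complex.DeMoivre by simp
  ultimately have 2: "(\<Sum>n. fourier_coeff f n * (of_real r * cis \<theta>) ^ n) =
      (LINT t|circle_measure. 1 / (1 - of_real r * cis (\<theta> - t)) * f t)"
    by (simp add: sums_iff mult.commute)
  define k where "k = (\<lambda>t. 1 / (1 - of_real r * cis (\<theta> - t)) * f t)"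
  have k: "integrable circle_measure k" unfolding k_def by (rule 1)
  have eq: "(2 / (1 - of_real r * cis (\<theta> - t)) - 1) * f t = 2 * k t - f t" for t
    by (simp add: algebra_simps k_def)
  show "integrable circle_measure (\<lambda>t. (2 / (1 - of_real r * cis (\<theta> - t)) - 1) * f t)"
    unfolding eq using k f by (intro Bochner_Integration.integrable_diff integrable_mult_right) auto
  show "herglotz f (of_real r * cis \<theta>) =
      (LINT t|circle_measure. (2 / (1 - of_real r * cis (\<theta> - t)) - 1) * f t)"
    unfolding eq herglotz_def 2 k_def[symmetric] using k f
    by (subst Bochner_Integration.integral_diff) (auto simp: fourier_coeff_def)
qed

text \<open>The Herglotz transform of the constant 1 is 1. The integral in the other variable
  follows because the kernel is even.\<close>

lemma integral_poisson:
  assumes "0 \<le> r" "r < 1"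
  shows "(LINT t|circle_measure. poisson r (\<theta> - t)) = 1"
    and "(LINT \<theta>|circle_measure. poisson r (\<theta> - t)) = 1"
proof -
  have fc: "fourier_coeff (\<lambda>_. 1) n = (if n = 0 then 1 else 0)" for n
    using circle_character_minus[of n] by (simp add: fourier_coeff_def)
  have s: "(\<Sum>n. fourier_coeff (\<lambda>_. 1) n * z ^ n) = 1" for z
  proof -
    have "(\<lambda>n. fourier_coeff (\<lambda>_. 1) n * z ^ n) = (\<lambda>n. if n = 0 then 1 else 0)"
      by (auto simp: fc)
    then show ?thesis using sums_single[of 0 "\<lambda>_. 1::complex"] by (simp add: sums_iff)
  qed
  have h: "herglotz (\<lambda>_. 1) z = 1" for z unfolding herglotz_def s by (simp add: fc)
  have 1: "(LINT t|circle_measure. poisson r (\<theta> - t)) = 1" for \<theta>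
  proof -
    note rk = riesz_kernel[of "\<lambda>_. 1" r \<theta>]
    have "1 = (LINT t|circle_measure. (2 / (1 - of_real r * cis (\<theta> - t)) - 1) * (1::complex))"
      using rk(1) assms unfolding h by simp
    then have "Re (LINT t|circle_measure. (2 / (1 - of_real r * cis (\<theta> - t)) - 1) * (1::complex)) = 1"
      by (metis one_complex.sel(1))
    moreover have "Re (LINT t|circle_measure. (2 / (1 - of_real r * cis (\<theta> - t)) - 1) * (1::complex))
        = (LINT t|circle_measure. Re ((2 / (1 - of_real r * cis (\<theta> - t)) - 1) * 1))"
      by (rule integral_Re[symmetric]) (rule rk(2), use assms in auto)
    ultimately show ?thesis by (simp add: poisson_def)
  qed
  show "(LINT t|circle_measure. poisson r (\<theta> - t)) = 1" by (rule 1)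
  have "poisson r (\<theta> - t) = poisson r (t - \<theta>)" for \<theta>
    using poisson_minus[OF assms, of "t - \<theta>"] by simp
  then show "(LINT \<theta>|circle_measure. poisson r (\<theta> - t)) = 1" using 1[of t] by simp
qed

lemma integrable_poisson_mult:
  fixes f :: "real \<Rightarrow> real"
  assumes r: "0 \<le> r" "r < 1" and f: "integrable circle_measure f"
  shows "integrable circle_measure (\<lambda>t. f t * poisson r (\<theta> - t))"
proof (rule Bochner_Integration.integrable_bound)
  show "integrable circle_measure (\<lambda>t. f t * ((1 - r\<^sup>2) / (1 - r)\<^sup>2))" using f by simp
  have [measurable]: "f \<in> borel_measurable borel" using borel_measurable_integrable[OF f] by simp
  show "(\<lambda>t. f t * poisson r (\<theta> - t)) \<in> borel_measurable circle_measure" by measurable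
  have "norm (f t * poisson r (\<theta> - t)) \<le> norm (f t * ((1 - r\<^sup>2) / (1 - r)\<^sup>2))" for t
    unfolding norm_mult using poisson_bounds[OF r, of "\<theta> - t"]
    by (intro mult_left_mono) (auto intro: order_trans[OF _ abs_ge_self] simp del: abs_divide)
  then show "AE t in circle_measure. norm (f t * poisson r (\<theta> - t)) \<le> norm (f t * ((1 - r\<^sup>2) / (1 - r)\<^sup>2))"
    by simp
qed

text \<open>The kernel has mass 1 in \<open>\<theta>\<close> for each fixed \<open>t\<close>. Below
  this is applied to the \<open>p\<close>-th power of the data, after Jensen's inequality.\<close>

lemma poisson_fubini:
  fixes f :: "real \<Rightarrow> real"
  assumes r: "0 \<le> r" "r < 1" and f: "integrable circle_measure f" and nn: "\<And>t. f t \<ge> 0"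
  shows "integrable circle_measure (\<lambda>\<theta>. LINT t|circle_measure. f t * poisson r (\<theta> - t))"
    and "(LINT \<theta>|circle_measure. LINT t|circle_measure. f t * poisson r (\<theta> - t)) = (LINT t|circle_measure. f t)"
proof -
  have [measurable]: "f \<in> borel_measurable borel" using borel_measurable_integrable[OF f] by simp
  interpret pair_sigma_finite circle_measure circle_measure ..
  have inner: "(LINT \<theta>|circle_measure. norm (f t * poisson r (\<theta> - t))) = f t" for t
    using integral_poisson(2)[OF r, of t] poisson_bounds(1)[OF r] nn 
    by (simp add: abs_mult less_imp_le)
  have int: "integrable circle_measure (\<lambda>\<theta>. f t * poisson r (\<theta> - t))" for t
    using integrable_poisson_mult[OF r, of "\<lambda>_. f t" t] poisson_minus[OF r]
    by (metis (no_types, lifting) ext integrable_circle_bounded minus_diff_eq circle.integrable_const)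
  have "integrable (circle_measure \<Otimes>\<^sub>M circle_measure) (\<lambda>(t, \<theta>). f t * poisson r (\<theta> - t))"
    by (rule Fubini_integrable) (use f int inner in \<open>auto\<close>)
  then show "integrable circle_measure (\<lambda>\<theta>. LINT t|circle_measure. f t * poisson r (\<theta> - t))"
    and "(LINT \<theta>|circle_measure. LINT t|circle_measure. f t * poisson r (\<theta> - t)) = (LINT t|circle_measure. f t)"
    using integrable_snd[of "\<lambda>t \<theta>. f t * poisson r (\<theta> - t)"]
      Fubini_integral[of "\<lambda>t \<theta>. f t * poisson r (\<theta> - t)"] integral_poisson(2)[OF r]
    by auto
qed


lemma holomorphic_herglotz:
  assumes "integrable circle_measure f"
  shows "herglotz f holomorphic_on ball 0 1"
proof -
  have "(\<lambda>z. \<Sum>n. fourier_coeff f n * z ^ n) holomorphic_on ball 0 1"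
  proof (rule power_series_holomorphic)
    fix w :: complex assume "w \<in> ball 0 1"
    then have "summable (\<lambda>n. fourier_coeff f n * w ^ n)"
      by (intro summable_norm_cancel[OF summable_geometric_norm[OF norm_fourier_coeff_le[OF assms]]]) simp
    then show "(\<lambda>n. fourier_coeff f n * (w - 0) ^ n) sums (\<Sum>n. fourier_coeff f n * w ^ n)"
      by (simp add: summable_sums)
  qed
  then show ?thesis unfolding herglotz_def by (intro holomorphic_intros)
qed

lemma Re_herglotz:
  fixes f :: "real \<Rightarrow> real"
  assumes [measurable]: "f \<in> borel_measurable borel" and f: "integrable circle_measure f"
    and r: "0 \<le> r" "r < 1"
  shows "Re (herglotz (\<lambda>t. of_real (f t)) (of_real r * cis \<theta>)) = 
    (LINT t|circle_measure. f t * poisson r (\<theta> - t))"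
proof -
  have f': "integrable circle_measure (\<lambda>t. complex_of_real (f t))" using f by simp
  have m: "(\<lambda>t. complex_of_real (f t)) \<in> borel_measurable borel" by measurable
  have "Re (herglotz (\<lambda>t. of_real (f t)) (of_real r * cis \<theta>)) = 
    (LINT t|circle_measure. Re ((2 / (1 - of_real r * cis (\<theta> - t)) - 1) * of_real (f t)))"
    unfolding riesz_kernel(1)[OF m f' r] by (rule integral_Re[symmetric, OF riesz_kernel(2)[OF m f' r]])
  then show ?thesis by (simp add: poisson_def mult.commute)
qed

text \<open>Hoelder's inequality, with the kernel of integral 1 split as \<open>P powr (1/p)\<close>
  times \<open>P powr (1/q)\<close>.\<close>

lemma poisson_Jensen:
  fixes f :: "real \<Rightarrow> real"
  assumes p: "p > 1" and [measurable]: "f \<in> borel_measurable borel" and nn: "\<And>t. 0 \<le> f t"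
    and fp: "integrable circle_measure (\<lambda>t. f t powr p)" and r: "0 \<le> r" "r < 1"
  shows "(LINT t|circle_measure. f t * poisson r (\<theta> - t)) powr p \<le>
    (LINT t|circle_measure. f t powr p * poisson r (\<theta> - t))"
proof -
  define q where "q = p / (p - 1)"
  have pq: "1/p + 1/q = 1" using p by (simp add: q_def field_simps)
  have q: "q > 1" using conjugate_exponentD[OF p pq] by simp
  define P where "P = (\<lambda>t. poisson r (\<theta> - t))"
  have P: "P t > 0" for t using poisson_bounds(1)[OF r] by (simp add: P_def)
  have [measurable]: "P \<in> borel_measurable borel" unfolding P_def by measurable
  have P1: "(LINT t|circle_measure. P t) = 1" using integral_poisson(1)[OF r] by (simp add: P_def)
  have iP: "integrable circle_measure P" 
    using integrable_poisson_mult[OF r, of "\<lambda>_. 1" \<theta>] by (simp add: P_def)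
  have e1: "norm (f t * P t powr (1/p)) powr p = f t powr p * P t" for t
    using P[of t] nn[of t] p by (simp add: abs_mult powr_mult powr_powr)
  have e2: "norm (P t powr (1/q)) powr q = P t" for t
    using P[of t] q by (simp add: powr_powr)
  have e3: "norm (f t * P t powr (1/p)) * norm (P t powr (1/q)) = f t * P t" for t
    using P[of t] nn[of t] pq by (simp add: abs_mult mult.assoc flip: powr_add)
  have "(LINT t|circle_measure. norm (f t * P t powr (1/p)) * norm (P t powr (1/q))) \<le>
      Lnorm circle_measure p (\<lambda>t. f t * P t powr (1/p)) * Lnorm circle_measure q (\<lambda>t. P t powr (1/q))"
  proof (rule Holder_ineq[OF p pq])
    show "integrable circle_measure (\<lambda>t. norm (f t * P t powr (1/p)) powr p)"
      unfolding e1 unfolding P_def by (rule integrable_poisson_mult[OF r fp])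
    show "integrable circle_measure (\<lambda>x. norm (P x powr (1 / q)) powr q)" using iP by (simp only: e2)
  qed (simp_all, measurable)
  then have "(LINT t|circle_measure. f t * P t) \<le> (LINT t|circle_measure. f t powr p * P t) powr (1/p)"
    unfolding e3 Lnorm_def e1 e2 P1 by simp
  moreover have "0 \<le> (LINT t|circle_measure. f t * P t)"
    using nn P by (intro integral_nonneg_AE) (auto simp: less_imp_le)
  ultimately have "(LINT t|circle_measure. f t * P t) powr p \<le> ((LINT t|circle_measure. f t powr p * P t) powr (1/p)) powr p"
    using p by (intro powr_mono2) auto
  also have "\<dots> = (LINT t|circle_measure. f t powr p * P t)"
    using nn P p by (simp add: powr_powr integral_nonneg_AE less_imp_le)
  finally show ?thesis by (simp add: P_def)
qed

text \<open>Nonnegative data that do not vanish almost everywhere make the Herglotz transform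
  \<open>H\<close> map the disk into the right half-plane. So \<open>H powr p\<close> is holomorphic
  there, and its mean over a circle is its value \<open>J powr p\<close> at 0. When the pointwise
  inequality is integrated, the term with \<open>B\<close> becomes \<open>- B * J powr p\<close> and
  is discarded, and Jensen's inequality bounds the term with \<open>A\<close>.\<close>

lemma riesz_nonneg:
  fixes p :: real
  assumes p: "1 < p" "p \<le> 2"
  obtains A where "A \<ge> 0"
    "\<And>f r. \<lbrakk>f \<in> borel_measurable borel; \<And>t. 0 \<le> f t; integrable circle_measure (\<lambda>t. f t powr p); 
       0 \<le> r; r < 1\<rbrakk> \<Longrightarrow>
       integrable circle_measure (\<lambda>\<theta>. norm (herglotz (\<lambda>t. of_real (f t)) (of_real r * cis \<theta>)) powr p) \<and>
       (LINT \<theta>|circle_measure. norm (herglotz (\<lambda>t. of_real (f t)) (of_real r * cis \<theta>)) powr p) \<le>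
         A * (LINT t|circle_measure. f t powr p)"
proof -
  obtain A B where AB: "A \<ge> 0" "B \<ge> 0"
    "\<And>w. Re w > 0 \<Longrightarrow> norm w powr p \<le> A * Re w powr p - B * Re (w powr of_real p)"
    using riesz_pointwise[OF p] by blast
  show ?thesis
  proof (rule that[OF AB(1)], goal_cases)
    case (1 f r)
    note [measurable] = 1(1) and nn = 1(2) and fp = 1(3) and r = 1(4,5)
    have f: "integrable circle_measure f"
      using integrable_of_powr_integrable[OF circle.finite_measure_axioms, of p f] p fp nn by simp
    have f': "integrable circle_measure (\<lambda>t. complex_of_real (f t))" using f by simp
    define H where "H = herglotz (\<lambda>t. of_real (f t))"
    define J where "J = (LINT t|circle_measure. f t)"
    have J0: "J \<ge> 0" unfolding J_def using nn by (intro integral_nonneg_AE) auto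
    show ?case
    proof (cases "J = 0")
      \<comment> \<open>Data vanishing almost everywhere are treated apart: their transform is 0 and
        does not have positive real part.\<close>
      case True
      then have "AE t in circle_measure. f t = 0"
        using integral_nonneg_eq_0_iff_AE[OF f] nn by (auto simp: J_def)
      then have "fourier_coeff (\<lambda>t. of_real (f t)) n = 0" for n
        unfolding fourier_coeff_def by (intro integral_eq_zero_AE) auto
      then have "herglotz (\<lambda>t. of_real (f t)) z = 0" for z by (simp add: herglotz_def)
      then show ?thesis using AB(1) by (simp add: integral_nonneg_AE)
    next
      case False
      have ReH: "Re (H (of_real s * cis \<theta>)) > 0" if "0 \<le> s" "s < 1" for s \<theta>
      proof -
        have nn': "AE t in circle_measure. 0 \<le> f t * poisson s (\<theta> - t)"
          using nn poisson_bounds(1)[OF that] by (auto simp: less_imp_le)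
        have "(LINT t|circle_measure. f t * poisson s (\<theta> - t)) \<noteq> 0"
        proof
          assume "(LINT t|circle_measure. f t * poisson s (\<theta> - t)) = 0"
          then have "AE t in circle_measure. f t * poisson s (\<theta> - t) = 0"
            using integral_nonneg_eq_0_iff_AE[OF integrable_poisson_mult[OF that f] nn'] by simp
          then have "AE t in circle_measure. f t = 0"
          proof eventually_elim
            case (elim t)
            then show ?case using poisson_bounds(1)[OF that, of "\<theta> - t"] by simp
          qed
          then have "J = 0" unfolding J_def by (rule integral_eq_zero_AE)
          then show False using False by simp
        qed
        then show ?thesis using integral_nonneg_AE[OF nn'] 
          unfolding H_def Re_herglotz[OF 1(1) f that] by simp
      qed
      have ReH': "Re (H z) > 0" if "z \<in> ball 0 1" for z
        using ReH[of "norm z" "Arg z"] that by (metis mem_ball_0 norm_ge_zero rcis_def rcis_cmod_Arg)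
      have holH: "H holomorphic_on ball 0 1" unfolding H_def by (rule holomorphic_herglotz[OF f'])
      have "(\<lambda>z. exp (of_real p * Ln (H z))) holomorphic_on ball 0 1"
        using ReH' by (intro holomorphic_intros holH) (force simp: complex_nonpos_Reals_iff)
      then have holG: "(\<lambda>z. H z powr of_real p) holomorphic_on ball 0 1"
        by (rule holomorphic_transform) (use ReH' in \<open>force simp: powr_def\<close>)
      define h where "h = (\<lambda>\<theta>. H (of_real r * cis \<theta>))"
      note mv = circle_mean_value[OF holG r]
      have norm_h: "norm (h \<theta> powr of_real p) = norm (h \<theta>) powr p" for \<theta>
        by (simp add: norm_powr_real_powr')
      have i1: "integrable circle_measure (\<lambda>\<theta>. norm (h \<theta>) powr p)"
        using integrable_norm[OF mv(1)] by (simp only: norm_h[unfolded h_def] h_def)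
      have "herglotz (\<lambda>t. of_real (f t)) 0 = of_real J"
        by (simp add: herglotz_def fourier_coeff_def J_def)
      then have "Re (H 0 powr of_real p) = J powr p"
        using J0 by (simp add: H_def powr_of_real)
      then have ReG: "(LINT \<theta>|circle_measure. Re (h \<theta> powr of_real p)) = J powr p"
        using mv unfolding h_def by (subst integral_Re) auto
      have Reh: "Re (h \<theta>) = (LINT t|circle_measure. f t * poisson r (\<theta> - t))" for \<theta>
        unfolding h_def H_def by (rule Re_herglotz[OF 1(1) f r])
      have le: "Re (h \<theta>) powr p \<le> (LINT t|circle_measure. f t powr p * poisson r (\<theta> - t))" for \<theta>
        unfolding Reh by (rule poisson_Jensen[OF p(1) 1(1) nn fp r])
      note fub = poisson_fubini[OF r fp]
      have i2: "integrable circle_measure (\<lambda>\<theta>. Re (h \<theta> powr of_real p))"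
        using mv(1) unfolding h_def by (rule integrable_Re)
      have "(LINT \<theta>|circle_measure. norm (h \<theta>) powr p) \<le>
         (LINT \<theta>|circle_measure. A * (LINT t|circle_measure. f t powr p * poisson r (\<theta> - t)) - B * Re (h \<theta> powr of_real p))"
      proof (rule integral_mono)
        show "norm (h \<theta>) powr p \<le> A * (LINT t|circle_measure. f t powr p * poisson r (\<theta> - t)) - B * Re (h \<theta> powr of_real p)" for \<theta>
        proof -
          have "Re (h \<theta>) > 0" unfolding h_def by (rule ReH[OF r])
          from AB(3)[OF this] mult_left_mono[OF le[of \<theta>] AB(1)] show ?thesis by linarith
        qed
      qed (use i1 i2 fub in auto)
      also have "\<dots> = A * (LINT t|circle_measure. f t powr p) - B * J powr p"
        using i2 fub by (simp add: ReG)
      also have "\<dots> \<le> A * (LINT t|circle_measure. f t powr p)" using AB(2) by simp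
      finally show ?thesis using i1 by (simp add: h_def H_def)
    qed
  qed
qed


lemma Lnorm_mono:
  fixes f :: "'a \<Rightarrow> 'b::real_normed_vector" and g :: "'a \<Rightarrow> 'c::real_normed_vector"
  assumes "p > 0" "integrable M (\<lambda>x. norm (f x) powr p)" "integrable M (\<lambda>x. norm (g x) powr p)"
    and "\<And>x. norm (f x) \<le> norm (g x)"
  shows "Lnorm M p f \<le> Lnorm M p g"
  unfolding Lnorm_def using assms
  by (intro powr_mono2 integral_mono integral_nonneg_AE) (auto intro!: powr_mono2)

lemma integral_circle_le_Lnorm:
  fixes f :: "real \<Rightarrow> complex"
  assumes p: "p > 1" and m: "f \<in> borel_measurable borel"
    and f: "integrable circle_measure (\<lambda>t. norm (f t) powr p)"
  shows "(LINT t|circle_measure. norm (f t)) \<le> Lnorm circle_measure p f"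
proof -
  define q where "q = p / (p - 1)"
  have pq: "1/p + 1/q = 1" using p by (simp add: q_def field_simps)
  show ?thesis
    using Holder_ineq[OF p pq, of f circle_measure "\<lambda>_. 1 :: real"] m f by (simp add: Lnorm_def)
qed

lemma fourier_pairing:
  assumes [measurable]: "f \<in> borel_measurable borel" "g \<in> borel_measurable borel"
    and f: "integrable circle_measure f" and g: "integrable circle_measure g"
    and r: "0 \<le> r" "r < 1"
  shows "(\<lambda>n. of_real r ^ n * fourier_coeff f n * cnj (fourier_coeff g n)) sums
      (LINT \<theta>|circle_measure. (herglotz f (of_real r * cis \<theta>) + fourier_coeff f 0) / 2 * cnj (g \<theta>))"
proof -
  have sa: "summable (\<lambda>n. norm (fourier_coeff f n * of_real r ^ n))"
    by (rule summable_geometric_norm[OF norm_fourier_coeff_le[OF f]]) (use r in simp)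
  have g': "integrable circle_measure (\<lambda>t. cnj (g t))" using g by simp
  have e: "cnj (fourier_coeff g n) = (LINT t|circle_measure. cis t ^ n * cnj (g t))" for n
  proof -
    have "cnj (fourier_coeff g n) = (LINT t|circle_measure. cnj (cis (- (real n * t)) * g t))"
      unfolding fourier_coeff_def by (rule Bochner_Integration.integral_cnj[symmetric])
    then show ?thesis by (simp add: Complex.DeMoivre cis_cnj)
  qed
  have F: "(\<Sum>n. fourier_coeff f n * of_real r ^ n * cis \<theta> ^ n) = (herglotz f (of_real r * cis \<theta>) + fourier_coeff f 0) / 2" for \<theta>
    by (simp add: herglotz_def power_mult_distrib mult.assoc)
  have "(\<lambda>n. fourier_coeff f n * of_real r ^ n * (LINT t|circle_measure. cis t ^ n * cnj (g t))) sums
      (LINT t|circle_measure. (\<Sum>n. fourier_coeff f n * of_real r ^ n * cis t ^ n) * cnj (g t))"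
    by (rule power_series_integral[OF _ _ _ g' sa]) (auto, measurable)
  then show ?thesis unfolding e[symmetric] F by (simp add: mult_ac)
qed

text \<open>The bilinear form is preferred to a norm bound because it can be dualized, shifted in
  frequency and truncated. The damping by \<open>r\<close> makes the series converge and does not
  enter the constant.\<close>

lemma riesz_pairing_nonneg:
  fixes p q :: real
  assumes p: "1 < p" "p \<le> 2" and pq: "1/p + 1/q = 1"
  obtains C where "C \<ge> 0"
    "\<And>f g r. \<lbrakk>f \<in> borel_measurable borel; \<And>t. 0 \<le> f t; integrable circle_measure (\<lambda>t. f t powr p);
       g \<in> borel_measurable borel; integrable circle_measure (\<lambda>t. norm (g t) powr q); 0 \<le> r; r < 1\<rbrakk> \<Longrightarrow>
       norm (\<Sum>n. of_real r ^ n * fourier_coeff (\<lambda>t. of_real (f t)) n * cnj (fourier_coeff g n)) \<le>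
         C * Lnorm circle_measure p f * Lnorm circle_measure q g"
proof -
  obtain A where A: "A \<ge> 0"
    "\<And>f r. \<lbrakk>f \<in> borel_measurable borel; \<And>t. 0 \<le> f t; integrable circle_measure (\<lambda>t. f t powr p); 
       0 \<le> r; r < 1\<rbrakk> \<Longrightarrow>
       integrable circle_measure (\<lambda>\<theta>. norm (herglotz (\<lambda>t. of_real (f t)) (of_real r * cis \<theta>)) powr p) \<and>
       (LINT \<theta>|circle_measure. norm (herglotz (\<lambda>t. of_real (f t)) (of_real r * cis \<theta>)) powr p) \<le>
         A * (LINT t|circle_measure. f t powr p)"
    using riesz_nonneg[OF p] by blast
  note q = conjugate_exponentD[OF p(1) pq]
  \<comment> \<open>\<open>A\<close> accounts for the Herglotz transform, 1 for the mean, and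
    \<open>2 powr p\<close> for adding the two.\<close>
  define C where "C = (2 powr p * (A + 1)) powr (1/p)"
  show ?thesis
  proof (rule that[of C], simp add: C_def, goal_cases)
    case (1 f g r)
    note [measurable] = 1(1,4) and nn = 1(2) and fp = 1(3) and gq = 1(5) and r = 1(6,7)
    have f: "integrable circle_measure f"
      using integrable_of_powr_integrable[OF circle.finite_measure_axioms, of p f] p fp nn by simp
    have f': "integrable circle_measure (\<lambda>t. complex_of_real (f t))" using f by simp
    have g: "integrable circle_measure g"
      using integrable_of_powr_integrable[OF circle.finite_measure_axioms, of q g] q(1) gq by simp
    define h where "h = (\<lambda>\<theta>. herglotz (\<lambda>t. of_real (f t)) (of_real r * cis \<theta>))"
    define c where "c = fourier_coeff (\<lambda>t. of_real (f t)) 0"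
    \<comment> \<open>Inverts the definition of the Herglotz transform: \<open>F\<close> is the
      analytic part.\<close>
    define F where "F = (\<lambda>\<theta>. (h \<theta> + c) / 2)"
    have h: "integrable circle_measure (\<lambda>\<theta>. norm (h \<theta>) powr p)"
      "(LINT \<theta>|circle_measure. norm (h \<theta>) powr p) \<le> A * (LINT t|circle_measure. f t powr p)"
      using A(2)[OF 1(1) nn fp r] unfolding h_def by blast+
    have hm [measurable]: "h \<in> borel_measurable borel"
      using borel_measurable_integrable[OF circle_mean_value(1)[OF holomorphic_herglotz[OF f'] r]]
      by (simp add: h_def)
    have Fm [measurable]: "F \<in> borel_measurable borel" unfolding F_def by measurable
    have N: "Lnorm circle_measure p f powr p = (LINT t|circle_measure. f t powr p)"
      using Lnorm_powr[of p circle_measure f] p nn by simp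
    have "norm c \<le> (LINT t|circle_measure. norm (complex_of_real (f t)))"
      unfolding c_def by (rule norm_fourier_coeff_le[OF f'])
    also have "\<dots> \<le> Lnorm circle_measure p (\<lambda>t. complex_of_real (f t))"
      by (rule integral_circle_le_Lnorm[OF p(1)]) (use fp nn in auto)
    also have "\<dots> = Lnorm circle_measure p f" by (simp add: Lnorm_def)
    finally have "norm c powr p \<le> Lnorm circle_measure p f powr p" using p by (intro powr_mono2) auto
    then have c: "norm c powr p \<le> (LINT t|circle_measure. f t powr p)" by (simp only: N)
    have Fle: "norm (F \<theta>) powr p \<le> 2 powr p * (norm (h \<theta>) powr p + norm c powr p)" for \<theta>
    proof -
      have "norm (F \<theta>) powr p \<le> norm (h \<theta> + c) powr p"
        using p by (intro powr_mono2) (auto simp: F_def norm_divide)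
      then show ?thesis using norm_add_powr_le[of p "h \<theta>" c] p by linarith
    qed
    have Fp: "integrable circle_measure (\<lambda>\<theta>. norm (F \<theta>) powr p)"
    proof (rule Bochner_Integration.integrable_bound)
      show "integrable circle_measure (\<lambda>\<theta>. 2 powr p * (norm (h \<theta>) powr p + norm c powr p))"
        using h(1) by auto
      show "AE \<theta> in circle_measure. norm (norm (F \<theta>) powr p) \<le> norm (2 powr p * (norm (h \<theta>) powr p + norm c powr p))"
        using Fle by (auto intro!: AE_I2 order_trans[OF _ abs_ge_self])
    qed auto
    have "(LINT \<theta>|circle_measure. norm (F \<theta>) powr p) \<le> (LINT \<theta>|circle_measure. 2 powr p * (norm (h \<theta>) powr p + norm c powr p))"
      by (rule integral_mono[OF Fp _ Fle]) (use h(1) in auto)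
    also have "\<dots> = 2 powr p * ((LINT \<theta>|circle_measure. norm (h \<theta>) powr p) + norm c powr p)"
      using h(1) by simp
    also have "\<dots> \<le> 2 powr p * (A * (LINT t|circle_measure. f t powr p) + (LINT t|circle_measure. f t powr p))"
      using h(2) c by (intro mult_left_mono add_mono) auto
    also have "\<dots> = (2 powr p * (A + 1)) * Lnorm circle_measure p f powr p"
      by (simp add: N algebra_simps)
    finally have "Lnorm circle_measure p F \<le> ((2 powr p * (A + 1)) * Lnorm circle_measure p f powr p) powr (1/p)"
      unfolding Lnorm_def[of _ _ F] using p by (intro powr_mono2) (auto intro: integral_nonneg_AE)
    also have "\<dots> = C * Lnorm circle_measure p f"
      using p A(1) by (simp add: C_def powr_mult powr_powr)
    finally have FN: "Lnorm circle_measure p F \<le> C * Lnorm circle_measure p f" .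
    have "(\<Sum>n. of_real r ^ n * fourier_coeff (\<lambda>t. of_real (f t)) n * cnj (fourier_coeff g n)) =
        (LINT \<theta>|circle_measure. F \<theta> * cnj (g \<theta>))"
      using fourier_pairing[OF _ _ f' g r] by (simp add: sums_iff F_def h_def c_def)
    also have "norm \<dots> \<le> (LINT \<theta>|circle_measure. norm (F \<theta> * cnj (g \<theta>)))"
      by (rule integral_norm_bound)
    also have "\<dots> = (LINT \<theta>|circle_measure. norm (F \<theta>) * norm (g \<theta>))" by (simp add: norm_mult)
    also have "\<dots> \<le> Lnorm circle_measure p F * Lnorm circle_measure q g"
      by (rule Holder_ineq[OF p(1) pq _ _ Fp gq]) auto
    also have "\<dots> \<le> C * Lnorm circle_measure p f * Lnorm circle_measure q g"
      by (intro mult_right_mono FN) auto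
    finally show ?case .
  qed
qed

lemma integrable_cis_mult:
  assumes "integrable circle_measure f"
  shows "integrable circle_measure (\<lambda>t. cis (a * t) * f t)"
proof (rule Bochner_Integration.integrable_bound[OF assms])
  have [measurable]: "f \<in> borel_measurable borel" using borel_measurable_integrable[OF assms] by simp
  show "(\<lambda>t. cis (a * t) * f t) \<in> borel_measurable circle_measure" by measurable
qed (simp add: norm_mult)

lemma fourier_coeff_add:
  assumes "integrable circle_measure f" "integrable circle_measure g"
  shows "fourier_coeff (\<lambda>t. f t + g t) n = fourier_coeff f n + fourier_coeff g n"
  using integrable_cis_mult[OF assms(1), of "- real n"] integrable_cis_mult[OF assms(2), of "- real n"]
  by (simp add: fourier_coeff_def ring_distribs)

lemma fourier_coeff_cmult: "fourier_coeff (\<lambda>t. c * f t) n = c * fourier_coeff f n"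
  unfolding fourier_coeff_def by (simp add: mult.left_commute)


text \<open>Linearity in \<open>f\<close>: the positive and negative parts of its real and imaginary
  parts are each dominated by \<open>norm (f t)\<close>, whence the factor 4.\<close>

lemma riesz_pairing_le2:
  fixes p q :: real
  assumes p: "1 < p" "p \<le> 2" and pq: "1/p + 1/q = 1"
  obtains C where "C \<ge> 0"
    "\<And>f g r. \<lbrakk>f \<in> borel_measurable borel; integrable circle_measure (\<lambda>t. norm (f t) powr p);
       g \<in> borel_measurable borel; integrable circle_measure (\<lambda>t. norm (g t) powr q); 0 \<le> r; r < 1\<rbrakk> \<Longrightarrow>
       norm (\<Sum>n. of_real r ^ n * fourier_coeff f n * cnj (fourier_coeff g n)) \<le>
         C * Lnorm circle_measure p f * Lnorm circle_measure q g"
proof -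
  obtain C where C: "C \<ge> 0"
    "\<And>f g r. \<lbrakk>f \<in> borel_measurable borel; \<And>t. 0 \<le> f t; integrable circle_measure (\<lambda>t. f t powr p);
       g \<in> borel_measurable borel; integrable circle_measure (\<lambda>t. norm (g t) powr q); 0 \<le> r; r < 1\<rbrakk> \<Longrightarrow>
       norm (\<Sum>n. of_real r ^ n * fourier_coeff (\<lambda>t. of_real (f t)) n * cnj (fourier_coeff g n)) \<le>
         C * Lnorm circle_measure p f * Lnorm circle_measure q g"
    using riesz_pairing_nonneg[OF p pq] by blast
  note q = conjugate_exponentD[OF p(1) pq]
  show ?thesis
  proof (rule that[of "4 * C"], goal_cases)
    case 1
    show ?case using C by simp
  next
    case (2 f g r)
    note [measurable] = 2(1,3) and fp = 2(2) and gq = 2(4) and r = 2(5,6)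
    have g: "integrable circle_measure g"
      using integrable_of_powr_integrable[OF circle.finite_measure_axioms, of q g] q(1) gq by simp
    define P where "P = (\<lambda>(k::nat) t. if k = 0 then max 0 (Re (f t)) else if k = 1 then max 0 (- Re (f t))
        else if k = 2 then max 0 (Im (f t)) else max 0 (- Im (f t)))"
    define S where "S = (\<lambda>f. \<Sum>n. of_real r ^ n * fourier_coeff f n * cnj (fourier_coeff g n))"
    have Pm [measurable]: "P k \<in> borel_measurable borel" for k unfolding P_def by measurable
    have Pn: "P k t \<ge> 0" for k t by (simp add: P_def)
    have Ple: "norm (P k t) \<le> norm (f t)" for k t
      using abs_Re_le_cmod[of "f t"] abs_Im_le_cmod[of "f t"] by (auto simp: P_def max_def)
    have PLp: "integrable circle_measure (\<lambda>t. norm (P k t) powr p)" for k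
      by (rule Bochner_Integration.integrable_bound[OF fp])
         (use Ple p in \<open>auto intro!: AE_I2 powr_mono2\<close>)
    have PN: "Lnorm circle_measure p (P k) \<le> Lnorm circle_measure p f" for k
      by (rule Lnorm_mono[OF _ PLp fp Ple]) (use p in simp)
    have bound: "norm (S (\<lambda>t. of_real (P k t))) \<le> C * Lnorm circle_measure p f * Lnorm circle_measure q g" for k
    proof -
      have "norm (S (\<lambda>t. of_real (P k t))) \<le> C * Lnorm circle_measure p (P k) * Lnorm circle_measure q g"
        unfolding S_def using PLp[of k] Pn by (intro C(2) Pm Pn 2(3) gq r) auto
      also have "\<dots> \<le> C * Lnorm circle_measure p f * Lnorm circle_measure q g"
        using PN[of k] C(1) by (intro mult_right_mono mult_left_mono) auto
      finally show ?thesis .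
    qed
    have PL1: "integrable circle_measure (\<lambda>t. complex_of_real (P k t))" for k
      using integrable_of_powr_integrable[OF circle.finite_measure_axioms, of p "P k"] p PLp by simp
    have sums: "summable (\<lambda>n. of_real r ^ n * fourier_coeff (\<lambda>t. of_real (P k t)) n * cnj (fourier_coeff g n))" for k
      by (rule sums_summable[OF fourier_pairing[OF _ _ PL1 g r]]) auto
    have f_eq: "f = (\<lambda>t. ((of_real (P 0 t) + (-1) * of_real (P 1 t)) + \<i> * of_real (P 2 t)) + (- \<i>) * of_real (P 3 t))"
      by (auto simp: P_def max_def complex_eq_iff)
    have "fourier_coeff f n = fourier_coeff (\<lambda>t. of_real (P 0 t)) n + (-1) * fourier_coeff (\<lambda>t. of_real (P 1 t)) n
        + \<i> * fourier_coeff (\<lambda>t. of_real (P 2 t)) n + (- \<i>) * fourier_coeff (\<lambda>t. of_real (P 3 t)) n" for n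
      by (subst f_eq) (simp only: fourier_coeff_add fourier_coeff_cmult PL1 integrable_mult_right 
          Bochner_Integration.integrable_add integrable_mult_right_iff simp_thms)
    note fcf = this
    have "S f = (\<Sum>n. of_real r ^ n * fourier_coeff (\<lambda>t. of_real (P 0 t)) n * cnj (fourier_coeff g n)
        + (-1) * (of_real r ^ n * fourier_coeff (\<lambda>t. of_real (P 1 t)) n * cnj (fourier_coeff g n))
        + \<i> * (of_real r ^ n * fourier_coeff (\<lambda>t. of_real (P 2 t)) n * cnj (fourier_coeff g n))
        + (- \<i>) * (of_real r ^ n * fourier_coeff (\<lambda>t. of_real (P 3 t)) n * cnj (fourier_coeff g n)))"
      unfolding S_def by (intro suminf_cong, subst fcf) (simp only: ring_distribs mult_ac)
    also have "\<dots> = S (\<lambda>t. of_real (P 0 t)) + (-1) * S (\<lambda>t. of_real (P 1 t)) + \<i> * S (\<lambda>t. of_real (P 2 t)) + (- \<i>) * S (\<lambda>t. of_real (P 3 t))"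
      unfolding S_def by (intro sums_unique[symmetric] sums_add sums_mult summable_sums sums)
    finally have "norm (S f) \<le> norm (S (\<lambda>t. of_real (P 0 t))) + norm ((-1) * S (\<lambda>t. of_real (P 1 t)))
        + norm (\<i> * S (\<lambda>t. of_real (P 2 t))) + norm ((- \<i>) * S (\<lambda>t. of_real (P 3 t)))"
      by (simp only:) (intro order_trans[OF norm_triangle_ineq] add_mono order_refl)
    also have "\<dots> \<le> 4 * C * Lnorm circle_measure p f * Lnorm circle_measure q g"
      using bound[of 0] bound[of 1] bound[of 2] bound[of 3] by (simp add: norm_mult)
    finally show ?case by (simp add: S_def)
  qed
qed

text \<open>For \<open>p > 2\<close> the conjugate exponent is below 2, and exchanging the two
  functions merely conjugates the form.\<close>

lemma riesz_pairing:
  fixes p q :: real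
  assumes p: "1 < p" and pq: "1/p + 1/q = 1"
  obtains C where "C \<ge> 0"
    "\<And>f g r. \<lbrakk>f \<in> borel_measurable borel; integrable circle_measure (\<lambda>t. norm (f t) powr p);
       g \<in> borel_measurable borel; integrable circle_measure (\<lambda>t. norm (g t) powr q); 0 \<le> r; r < 1\<rbrakk> \<Longrightarrow>
       norm (\<Sum>n. of_real r ^ n * fourier_coeff f n * cnj (fourier_coeff g n)) \<le>
         C * Lnorm circle_measure p f * Lnorm circle_measure q g"
proof (cases "p \<le> 2")
  case True
  show ?thesis by (rule riesz_pairing_le2[OF p True pq]) (rule that)
next
  case False
  note q = conjugate_exponentD[OF p pq]
  have q2: "q \<le> 2" unfolding q(2) using False by (simp add: divide_le_eq)
  have qp: "1/q + 1/p = 1" using pq by simp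
  obtain C where C: "C \<ge> 0"
    "\<And>f g r. \<lbrakk>f \<in> borel_measurable borel; integrable circle_measure (\<lambda>t. norm (f t) powr q);
       g \<in> borel_measurable borel; integrable circle_measure (\<lambda>t. norm (g t) powr p); 0 \<le> r; r < 1\<rbrakk> \<Longrightarrow>
       norm (\<Sum>n. of_real r ^ n * fourier_coeff f n * cnj (fourier_coeff g n)) \<le>
         C * Lnorm circle_measure q f * Lnorm circle_measure p g"
    using riesz_pairing_le2[OF q(1) q2 qp] by blast
  show ?thesis
  proof (rule that[OF C(1)], goal_cases)
    case (1 f g r)
    have f: "integrable circle_measure f"
      using integrable_of_powr_integrable[OF circle.finite_measure_axioms, of p f] p 1 by simp
    have g: "integrable circle_measure g"
      using integrable_of_powr_integrable[OF circle.finite_measure_axioms, of q g] q(1) 1 by simp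
    have s: "(\<lambda>n. of_real r ^ n * fourier_coeff g n * cnj (fourier_coeff f n)) sums
       (\<Sum>n. of_real r ^ n * fourier_coeff g n * cnj (fourier_coeff f n))"
      by (rule summable_sums[OF sums_summable[OF fourier_pairing[OF 1(3,1) g f 1(5,6)]]])
    have "(\<lambda>n. cnj (of_real r ^ n * fourier_coeff g n * cnj (fourier_coeff f n))) sums
       cnj (\<Sum>n. of_real r ^ n * fourier_coeff g n * cnj (fourier_coeff f n))"
      using s by (simp only: sums_cnj)
    then have "(\<Sum>n. of_real r ^ n * fourier_coeff f n * cnj (fourier_coeff g n)) =
      cnj (\<Sum>n. of_real r ^ n * fourier_coeff g n * cnj (fourier_coeff f n))"
      by (simp add: sums_iff mult_ac)
    then show ?case using C(2)[OF 1(3,4,1,2,5,6)] by (simp add: mult_ac)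
  qed
qed

lemma fourier_coeff_shift:
  "fourier_coeff (\<lambda>t. cis (- (real a * t)) * f t) n = fourier_coeff f (n + a)"
proof -
  have "cis (- (real n * t)) * (cis (- (real a * t)) * f t) = cis (- (real (n + a) * t)) * f t" for t
    by (simp only: mult.assoc[symmetric] cis_mult) (simp add: algebra_simps)
  then show ?thesis by (simp only: fourier_coeff_def)
qed

text \<open>A window of frequencies is a difference of two half-lines. Multiplying both functions by
  the same character moves the start of a half-line to 0 without changing a norm, so
  \<open>2 * C\<close> serves all windows.\<close>

lemma riesz_partial_sums:
  fixes p q :: real
  assumes p: "1 < p" and pq: "1/p + 1/q = 1"
  obtains C where "C \<ge> 0"
    "\<And>f g a b. \<lbrakk>f \<in> borel_measurable borel; integrable circle_measure (\<lambda>t. norm (f t) powr p);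
       g \<in> borel_measurable borel; integrable circle_measure (\<lambda>t. norm (g t) powr q)\<rbrakk> \<Longrightarrow>
       norm (\<Sum>n\<in>{a..<b}. fourier_coeff f n * cnj (fourier_coeff g n)) \<le>
         C * Lnorm circle_measure p f * Lnorm circle_measure q g"
proof -
  obtain C where C: "C \<ge> 0"
    "\<And>f g r. \<lbrakk>f \<in> borel_measurable borel; integrable circle_measure (\<lambda>t. norm (f t) powr p);
       g \<in> borel_measurable borel; integrable circle_measure (\<lambda>t. norm (g t) powr q); 0 \<le> r; r < 1\<rbrakk> \<Longrightarrow>
       norm (\<Sum>n. of_real r ^ n * fourier_coeff f n * cnj (fourier_coeff g n)) \<le>
         C * Lnorm circle_measure p f * Lnorm circle_measure q g"
    using riesz_pairing[OF p pq] by blast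
  note q = conjugate_exponentD[OF p pq]
  show ?thesis
  proof (rule that[of "2 * C"], goal_cases)
    case 1
    show ?case using C by simp
  next
    case (2 f g a b)
    note [measurable] = 2(1,3)
    define K where "K = C * Lnorm circle_measure p f * Lnorm circle_measure q g"
    have K: "K \<ge> 0" using C by (simp add: K_def)
    have f: "integrable circle_measure f"
      using integrable_of_powr_integrable[OF circle.finite_measure_axioms, of p f] p 2 by simp
    have g: "integrable circle_measure g"
      using integrable_of_powr_integrable[OF circle.finite_measure_axioms, of q g] q(1) 2 by simp
    define x where "x = (\<lambda>n. fourier_coeff f n * cnj (fourier_coeff g n))"
    show ?case
    proof (cases "a \<le> b")
      case True
      \<comment> \<open>\<open>T r a - r\<^bsup>b-a\<^esup> T r b\<close> is a finite sum, in which \<open>r\<close> can tend to 1.\<close>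
      define T where "T = (\<lambda>r m. \<Sum>n. of_real r ^ n * x (n + m))"
      have summ: "summable (\<lambda>n. of_real r ^ n * x (n + m))" and T: "norm (T r m) \<le> K" if "0 \<le> r" "r < 1" for r m
      proof -
        define f' g' where "f' = (\<lambda>t. cis (- (real m * t)) * f t)" and "g' = (\<lambda>t. cis (- (real m * t)) * g t)"
        have m [measurable]: "f' \<in> borel_measurable borel" "g' \<in> borel_measurable borel"
          unfolding f'_def g'_def by measurable
        have i: "integrable circle_measure f'" "integrable circle_measure g'"
          using integrable_cis_mult[OF f, of "- real m"] integrable_cis_mult[OF g, of "- real m"]
          by (simp_all add: f'_def g'_def)
        have n: "norm (f' t) = norm (f t)" "norm (g' t) = norm (g t)" for t
          by (simp_all add: f'_def g'_def norm_mult)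
        have eq: "of_real r ^ n * fourier_coeff f' n * cnj (fourier_coeff g' n) = of_real r ^ n * x (n + m)" for n
          by (simp add: f'_def g'_def x_def fourier_coeff_shift)
        show "summable (\<lambda>n. of_real r ^ n * x (n + m))"
          using sums_summable[OF fourier_pairing[OF m i that]] by (simp only: eq)
        show "norm (T r m) \<le> K"
          using C(2)[OF m(1) _ m(2) _ that] 2(2,4) by (simp add: eq n T_def K_def Lnorm_def)
      qed
      have part: "norm (\<Sum>n\<in>{a..<b}. of_real r ^ (n - a) * x n) \<le> 2 * K" if r: "0 \<le> r" "r < 1" for r
      proof -
        have "T r a = (\<Sum>n. of_real r ^ (n + (b - a)) * x (n + (b - a) + a)) + (\<Sum>n<b - a. of_real r ^ n * x (n + a))"
          unfolding T_def by (rule suminf_split_initial_segment[OF summ[OF r]])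
        also have "(\<Sum>n. of_real r ^ (n + (b - a)) * x (n + (b - a) + a)) = (\<Sum>n. of_real r ^ (b - a) * (of_real r ^ n * x (n + b)))"
        proof (intro suminf_cong)
          fix n
          have "n + (b - a) + a = n + b" using True by simp
          then show "of_real r ^ (n + (b - a)) * x (n + (b - a) + a) = of_real r ^ (b - a) * (of_real r ^ n * x (n + b))"
            by (simp only: power_add mult_ac)
        qed
        also have "\<dots> = of_real r ^ (b - a) * T r b" 
          unfolding T_def by (rule suminf_mult[OF summ[OF r]])
        also have "(\<Sum>n<b - a. of_real r ^ n * x (n + a)) = (\<Sum>n\<in>{a..<b}. of_real r ^ (n - a) * x n)"
          by (rule sum.reindex_bij_witness[of _ "\<lambda>n. n - a" "\<lambda>n. n + a"]) (use True in auto)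
        finally have "(\<Sum>n\<in>{a..<b}. of_real r ^ (n - a) * x n) = T r a - of_real r ^ (b - a) * T r b" by simp
        also have "norm \<dots> \<le> norm (T r a) + norm (of_real r ^ (b - a) * T r b)" by (rule norm_triangle_ineq4)
        also have "norm (of_real r ^ (b - a) * T r b) \<le> 1 * norm (T r b)"
          unfolding norm_mult using r by (intro mult_right_mono) (auto simp: norm_power power_le_one)
        finally show ?thesis using T[OF r, of a] T[OF r, of b] by linarith
      qed
      have "((\<lambda>r. norm (\<Sum>n\<in>{a..<b}. of_real r ^ (n - a) * x n)) \<longlongrightarrow> 
          norm (\<Sum>n\<in>{a..<b}. of_real 1 ^ (n - a) * x n)) (at_left (1::real))"
        by (intro tendsto_intros)
      moreover have "eventually (\<lambda>r. norm (\<Sum>n\<in>{a..<b}. of_real r ^ (n - a) * x n) \<le> 2 * K) (at_left (1::real))"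
        by (rule eventually_mono[OF eventually_at_left_real[of 0 1]]) (use part in auto)
      ultimately have "norm (\<Sum>n\<in>{a..<b}. of_real 1 ^ (n - a) * x n) \<le> 2 * K"
        by (intro tendsto_upperbound) auto
      then show ?thesis by (simp add: x_def K_def mult_ac)
    qed (use C in auto)
  qed
qed

section \<open>Polar coordinates\<close>

lemma measurable_Complex [measurable (raw)]:
  assumes "f \<in> borel_measurable M" "g \<in> borel_measurable M"
  shows "(\<lambda>x. Complex (f x) (g x)) \<in> borel_measurable M"
proof -
  have "(\<lambda>x. complex_of_real (f x) + \<i> * of_real (g x)) \<in> borel_measurable M"
    using assms by measurable
  then show ?thesis by (simp add: Complex_eq)
qed

lemma lborel_complex_eq_distr:
  "(lborel :: complex measure) = distr (lborel \<Otimes>\<^sub>M lborel) borel (\<lambda>(x, y). Complex x y)"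
proof (rule lborel_eqI)
  have m: "(\<lambda>(x, y). Complex x y) \<in> borel_measurable (lborel \<Otimes>\<^sub>M lborel)"
    unfolding case_prod_beta by measurable
  fix l u :: complex assume le: "\<And>b. b \<in> Basis \<Longrightarrow> l \<bullet> b \<le> u \<bullet> b"
  have le': "Re l \<le> Re u" "Im l \<le> Im u" using le[of 1] le[of \<i>] by (auto simp: Basis_complex_def)
  have "(\<lambda>(x, y). Complex x y) -` box l u \<inter> space (lborel \<Otimes>\<^sub>M lborel) = {Re l<..<Re u} \<times> {Im l<..<Im u}"
    by (auto simp: box_def Basis_complex_def space_pair_measure)
  then have "emeasure (distr (lborel \<Otimes>\<^sub>M lborel) borel (\<lambda>(x, y). Complex x y)) (box l u) =
      emeasure (lborel \<Otimes>\<^sub>M lborel) ({Re l<..<Re u} \<times> {Im l<..<Im u})"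
    by (subst emeasure_distr[OF m]) auto
  also have "\<dots> = ennreal (Re u - Re l) * ennreal (Im u - Im l)"
    by (subst lborel.emeasure_pair_measure_Times) (use le' in auto)
  also have "\<dots> = (\<Prod>b\<in>Basis. (u - l) \<bullet> b)"
    using le' by (simp add: Basis_complex_def prod.insert ennreal_mult)
  finally show "emeasure (distr (lborel \<Otimes>\<^sub>M lborel) borel (\<lambda>(x, y). Complex x y)) (box l u) = (\<Prod>b\<in>Basis. (u - l) \<bullet> b)" .
qed simp

lemma nn_integral_complex:
  fixes f :: "complex \<Rightarrow> ennreal"
  assumes [measurable]: "f \<in> borel_measurable borel"
  shows "(\<integral>\<^sup>+z. f z \<partial>lborel) = (\<integral>\<^sup>+x. \<integral>\<^sup>+y. f (Complex x y) \<partial>lborel \<partial>lborel)"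
    and "(\<integral>\<^sup>+z. f z \<partial>lborel) = (\<integral>\<^sup>+y. \<integral>\<^sup>+x. f (Complex x y) \<partial>lborel \<partial>lborel)"
proof -
  have "(\<integral>\<^sup>+z. f z \<partial>lborel) = (\<integral>\<^sup>+p. f (case p of (x, y) \<Rightarrow> Complex x y) \<partial>(lborel \<Otimes>\<^sub>M lborel))"
    unfolding lborel_complex_eq_distr
    by (rule nn_integral_distr) (simp_all add: case_prod_beta)
  also have "\<dots> = (\<integral>\<^sup>+x. \<integral>\<^sup>+y. f (Complex x y) \<partial>lborel \<partial>lborel)"
    by (subst lborel.nn_integral_fst[symmetric]) (auto simp: case_prod_beta)
  finally show 1: "(\<integral>\<^sup>+z. f z \<partial>lborel) = (\<integral>\<^sup>+x. \<integral>\<^sup>+y. f (Complex x y) \<partial>lborel \<partial>lborel)" .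
  show "(\<integral>\<^sup>+z. f z \<partial>lborel) = (\<integral>\<^sup>+y. \<integral>\<^sup>+x. f (Complex x y) \<partial>lborel \<partial>lborel)"
    unfolding 1 by (rule lborel_pair.Fubini') (simp add: case_prod_beta)
qed

lemma nn_integral_shear:
  fixes f :: "complex \<Rightarrow> ennreal"
  assumes [measurable]: "f \<in> borel_measurable borel"
  shows "(\<integral>\<^sup>+z. f (Complex (Re z + a * Im z) (Im z)) \<partial>lborel) = (\<integral>\<^sup>+z. f z \<partial>lborel)"
    and "(\<integral>\<^sup>+z. f (Complex (Re z) (Im z + a * Re z)) \<partial>lborel) = (\<integral>\<^sup>+z. f z \<partial>lborel)"
proof -
  have "(\<integral>\<^sup>+z. f (Complex (Re z + a * Im z) (Im z)) \<partial>lborel) =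
      (\<integral>\<^sup>+y. \<integral>\<^sup>+x. f (Complex (a * y + 1 * x) y) \<partial>lborel \<partial>lborel)"
    by (subst nn_integral_complex(2)) (auto simp: add.commute)
  also have "\<dots> = (\<integral>\<^sup>+y. \<integral>\<^sup>+x. f (Complex x y) \<partial>lborel \<partial>lborel)"
  proof (rule nn_integral_cong)
    fix y
    show "(\<integral>\<^sup>+x. f (Complex (a * y + 1 * x) y) \<partial>lborel) = (\<integral>\<^sup>+x. f (Complex x y) \<partial>lborel)"
      using nn_integral_real_affine[of "\<lambda>x. f (Complex x y)" 1 "a * y"] by simp
  qed
  finally show "(\<integral>\<^sup>+z. f (Complex (Re z + a * Im z) (Im z)) \<partial>lborel) = (\<integral>\<^sup>+z. f z \<partial>lborel)"
    by (simp add: nn_integral_complex(2)[of f])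
  have "(\<integral>\<^sup>+z. f (Complex (Re z) (Im z + a * Re z)) \<partial>lborel) =
      (\<integral>\<^sup>+x. \<integral>\<^sup>+y. f (Complex x (a * x + 1 * y)) \<partial>lborel \<partial>lborel)"
    by (subst nn_integral_complex(1)) (auto simp: add.commute)
  also have "\<dots> = (\<integral>\<^sup>+x. \<integral>\<^sup>+y. f (Complex x y) \<partial>lborel \<partial>lborel)"
  proof (rule nn_integral_cong)
    fix x
    show "(\<integral>\<^sup>+y. f (Complex x (a * x + 1 * y)) \<partial>lborel) = (\<integral>\<^sup>+y. f (Complex x y) \<partial>lborel)"
      using nn_integral_real_affine[of "\<lambda>y. f (Complex x y)" 1 "a * x"] by simp
  qed
  finally show "(\<integral>\<^sup>+z. f (Complex (Re z) (Im z + a * Re z)) \<partial>lborel) = (\<integral>\<^sup>+z. f z \<partial>lborel)"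
    by (simp add: nn_integral_complex(1)[of f])
qed

text \<open>A rotation by an angle different from \<open>\<pi>\<close> is a product of three shears.\<close>

lemma nn_integral_rotate_small:
  fixes f :: "complex \<Rightarrow> ennreal"
  assumes [measurable]: "f \<in> borel_measurable borel" and t: "\<bar>t\<bar> < pi"
  shows "(\<integral>\<^sup>+z. f (cis t * z) \<partial>lborel) = (\<integral>\<^sup>+z. f z \<partial>lborel)"
proof -
  have c: "cos (t/2) > 0" using t by (intro cos_gt_zero_pi) auto
  \<comment> \<open>\<open>k\<close> solves \<open>1 + k * sin t = cos t\<close>, the diagonal entry
    of the product of the shears; \<open>k2\<close> checks the off-diagonal one.\<close>
  define k where "k = - tan (t/2)"
  have s: "sin t = 2 * sin (t/2) * cos (t/2)" using sin_double[of "t/2"] by simp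
  have ct: "cos t = 1 - 2 * (sin (t/2))\<^sup>2" using cos_double_sin[of "t/2"] by simp
  have kc: "k * cos (t/2) = - sin (t/2)" using c by (simp add: k_def tan_def)
  have k1: "1 + k * sin t = cos t"
  proof -
    have "k * sin t = 2 * (k * cos (t/2)) * sin (t/2)" unfolding s by simp
    then show ?thesis unfolding kc ct by (simp add: power2_eq_square)
  qed
  have k2: "k * (1 + cos t) = - sin t"
  proof -
    have "1 + cos t = 2 * (cos (t/2))\<^sup>2" using cos_double_cos[of "t/2"] by simp
    then have "k * (1 + cos t) = 2 * (k * cos (t/2)) * cos (t/2)" by (simp add: power2_eq_square)
    then show ?thesis unfolding kc s by simp
  qed
  define S1 S2 where "S1 = (\<lambda>z. Complex (Re z + k * Im z) (Im z))"
    and "S2 = (\<lambda>z. Complex (Re z) (Im z + sin t * Re z))"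
  have "cis t * z = S1 (S2 (S1 z))" for z
  proof -
    have "Re (S1 (S2 (S1 z))) = (1 + k * sin t) * Re z + k * (1 + (1 + k * sin t)) * Im z"
      by (simp add: S1_def S2_def algebra_simps)
    also have "\<dots> = cos t * Re z - sin t * Im z" unfolding k1 k2 by simp
    finally have "Re (S1 (S2 (S1 z))) = cos t * Re z - sin t * Im z" .
    moreover have "Im (S1 (S2 (S1 z))) = (1 + k * sin t) * Im z + sin t * Re z"
      by (simp add: S1_def S2_def algebra_simps)
    ultimately show ?thesis unfolding k1 by (auto simp: complex_eq_iff)
  qed
  moreover have "S1 \<in> borel_measurable borel" "S2 \<in> borel_measurable borel"
    unfolding S1_def S2_def by measurable
  note [measurable] = this
  have "(\<integral>\<^sup>+z. f (S1 (S2 (S1 z))) \<partial>lborel) = (\<integral>\<^sup>+z. f z \<partial>lborel)"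
  proof -
    have S: "(\<integral>\<^sup>+z. h (S1 z) \<partial>lborel) = (\<integral>\<^sup>+z. h z \<partial>lborel)" "(\<integral>\<^sup>+z. h (S2 z) \<partial>lborel) = (\<integral>\<^sup>+z. h z \<partial>lborel)"
      if "h \<in> borel_measurable borel" for h :: "complex \<Rightarrow> ennreal"
      unfolding S1_def S2_def using that by (rule nn_integral_shear)+
    show ?thesis
      using S(1)[of "\<lambda>z. f (S1 (S2 z))"] S(2)[of "\<lambda>z. f (S1 z)"] S(1)[of f] by simp
  qed
  ultimately show ?thesis by simp
qed

text \<open>Rotating twice by half the argument avoids the excluded angle.\<close>

lemma nn_integral_rotate:
  fixes f :: "complex \<Rightarrow> ennreal"
  assumes [measurable]: "f \<in> borel_measurable borel"
  shows "(\<integral>\<^sup>+z. f (cis t * z) \<partial>lborel) = (\<integral>\<^sup>+z. f z \<partial>lborel)"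
proof -
  define s where "s = Arg (cis t) / 2"
  have s: "\<bar>s\<bar> < pi" using Arg_bounded[of "cis t"] by (auto simp: s_def)
  have "cis t = cis s * cis s"
    using cis_Arg[of "cis t"] by (simp add: s_def cis_mult sgn_div_norm)
  then have "(\<integral>\<^sup>+z. f (cis t * z) \<partial>lborel) = (\<integral>\<^sup>+z. f (cis s * (cis s * z)) \<partial>lborel)"
    by (simp add: mult.assoc)
  also have "\<dots> = (\<integral>\<^sup>+z. f z \<partial>lborel)"
    using nn_integral_rotate_small[of "\<lambda>z. f (cis s * z)" s] nn_integral_rotate_small[of f s] s by simp
  finally show ?thesis .
qed

lemma nn_integral_circle:
  assumes [measurable]: "f \<in> borel_measurable borel"
  shows "(\<integral>\<^sup>+t. f t \<partial>circle_measure) = ennreal (1 / (2*pi)) * (\<integral>\<^sup>+t. indicator {0..2*pi} t * f t \<partial>lborel)"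
proof -
  have "(\<integral>\<^sup>+t. f t \<partial>circle_measure) = (\<integral>\<^sup>+t. ennreal (indicator {0..2*pi} t / (2*pi)) * f t \<partial>lborel)"
    unfolding circle_measure_def by (rule nn_integral_density) auto
  also have "\<dots> = (\<integral>\<^sup>+t. ennreal (1 / (2*pi)) * (indicator {0..2*pi} t * f t) \<partial>lborel)"
    by (intro nn_integral_cong) (auto simp: indicator_def)
  also have "\<dots> = ennreal (1 / (2*pi)) * (\<integral>\<^sup>+t. indicator {0..2*pi} t * f t \<partial>lborel)"
    by (rule nn_integral_cmult) auto
  finally show ?thesis .
qed

text \<open>The part of the shifted period beyond \<open>2*pi\<close> is moved back by periodicity;
  the pieces fit together up to the two points 0 and \<open>a\<close>.\<close>

lemma nn_integral_circle_translate:
  assumes [measurable]: "f \<in> borel_measurable borel" and per: "\<And>t. f (t + 2*pi) = f t"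
    and a: "0 \<le> a" "a \<le> 2*pi"
  shows "(\<integral>\<^sup>+t. f (a + t) \<partial>circle_measure) = (\<integral>\<^sup>+t. f t \<partial>circle_measure)"
proof -
  have "(\<integral>\<^sup>+t. indicator {0..2*pi} t * f (a + t) \<partial>lborel) = (\<integral>\<^sup>+t. indicator {a..a + 2*pi} t * f t \<partial>lborel)"
    using nn_integral_real_affine[of "\<lambda>t. indicator {a..a + 2*pi} t * f t" 1 a]
    by (simp add: indicator_def if_distrib cong: if_cong)
  also have "\<dots> = (\<integral>\<^sup>+t. indicator {a..2*pi} t * f t + indicator {2*pi<..a + 2*pi} t * f t \<partial>lborel)"
    using a by (intro nn_integral_cong) (auto simp: indicator_def)
  also have "\<dots> = (\<integral>\<^sup>+t. indicator {a..2*pi} t * f t \<partial>lborel) + (\<integral>\<^sup>+t. indicator {2*pi<..a + 2*pi} t * f t \<partial>lborel)"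
    by (rule nn_integral_add) auto
  also have "(\<integral>\<^sup>+t. indicator {2*pi<..a + 2*pi} t * f t \<partial>lborel) = (\<integral>\<^sup>+t. indicator {0<..a} t * f t \<partial>lborel)"
    using nn_integral_real_affine[of "\<lambda>t. indicator {2*pi<..a + 2*pi} t * f t" 1 "2*pi"] per
    by (simp add: indicator_def add.commute if_distrib cong: if_cong)
  also have "(\<integral>\<^sup>+t. indicator {a..2*pi} t * f t \<partial>lborel) + (\<integral>\<^sup>+t. indicator {0<..a} t * f t \<partial>lborel) =
      (\<integral>\<^sup>+t. indicator {a..2*pi} t * f t + indicator {0<..a} t * f t \<partial>lborel)"
    by (rule nn_integral_add[symmetric]) auto
  also have "\<dots> = (\<integral>\<^sup>+t. indicator {0..2*pi} t * f t \<partial>lborel)"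
  proof (rule nn_integral_cong_AE)
    show "AE t in lborel. indicator {a..2*pi} t * f t + indicator {0<..a} t * f t = indicator {0..2*pi} t * f t"
      using AE_lborel_singleton[of 0] AE_lborel_singleton[of a]
      by eventually_elim (use a in \<open>auto simp: indicator_def\<close>)
  qed
  finally show ?thesis by (simp add: nn_integral_circle)
qed

text \<open>Measures on the line may be compared on half-lines. The mass of \<open>{x<..}\<close> is
  the area \<open>pi - pi * x^2\<close> of an annulus, and its derivative yields the
  density.\<close>

lemma distr_norm_disk:
  "distr (density lborel (indicator (ball (0::complex) 1))) borel norm =
    density lborel (\<lambda>r. ennreal (indicator {0..<1} r * (2 * pi * r)))"
proof (rule measure_eqI_lessThan)
  have e: "emeasure (distr (density lborel (indicator (ball (0::complex) 1))) borel norm) {x<..} =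
     emeasure lborel (ball (0::complex) 1 - cball 0 x)" for x
  proof -
    have "emeasure (distr (density lborel (indicator (ball (0::complex) 1))) borel norm) {x<..} =
        emeasure (density lborel (indicator (ball (0::complex) 1))) (norm -` {x<..})"
      by (subst emeasure_distr) auto
    also have "\<dots> = (\<integral>\<^sup>+z. indicator (ball (0::complex) 1) z * indicator (norm -` {x<..}) z \<partial>lborel)"
      by (rule emeasure_density) (auto intro!: borel_open open_vimage continuous_intros borel_measurable_indicator)
    also have "\<dots> = (\<integral>\<^sup>+z. indicator (ball (0::complex) 1 - cball 0 x) z \<partial>lborel)"
      by (intro nn_integral_cong) (auto simp: indicator_def)
    finally show ?thesis by simp
  qed
  have ball: "emeasure lborel (ball (0::complex) r) = ennreal (pi * r\<^sup>2)" if "r \<ge> 0" for r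
    using emeasure_ball[OF that, of "0::complex"] by (simp add: unit_ball_vol_2)
  have cball: "emeasure lborel (cball (0::complex) r) = ennreal (pi * r\<^sup>2)" if "r \<ge> 0" for r
    using emeasure_cball[OF that, of "0::complex"] by (simp add: unit_ball_vol_2)
  have pos: "emeasure lborel (ball (0::complex) 1 - cball 0 x) = ennreal (pi - pi * x\<^sup>2)" if "0 \<le> x" "x < 1" for x
  proof -
    have "emeasure lborel (ball (0::complex) 1 - cball 0 x) = emeasure lborel (ball (0::complex) 1) - emeasure lborel (cball (0::complex) x)"
      by (rule emeasure_Diff) (use that in \<open>auto simp: cball\<close>)
    then show ?thesis using that by (simp add: ball cball ennreal_minus)
  qed
  have FTC: "(\<integral>\<^sup>+r. ennreal (2 * pi * r) * indicator {x..1} r \<partial>lborel) = ennreal (pi - pi * x\<^sup>2)" if "0 \<le> x" "x \<le> 1" for x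
  proof -
    have "((\<lambda>r. pi * r\<^sup>2) has_real_derivative 2 * pi * y) (at y)" for y :: real
      by (auto intro!: derivative_eq_intros)
    then show ?thesis
      using nn_integral_FTC_Icc[of "\<lambda>r. 2 * pi * r" x 1 "\<lambda>r. pi * r\<^sup>2"] that by simp
  qed
  show "emeasure (distr (density lborel (indicator (ball (0::complex) 1))) borel norm) {x<..} < \<infinity>" for x
  proof -
    have "emeasure lborel (ball (0::complex) 1 - cball 0 x) \<le> emeasure lborel (ball (0::complex) 1)"
      by (rule emeasure_mono) auto
    then show ?thesis unfolding e using ball[of 1] by (auto simp: le_less_trans)
  qed
  fix x :: real
  have r: "emeasure (density lborel (\<lambda>r. ennreal (indicator {0..<1} r * (2 * pi * r)))) {x<..} =
      (\<integral>\<^sup>+r. ennreal (2 * pi * r) * indicator ({0..<1} \<inter> {x<..}) r \<partial>lborel)"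
    by (subst emeasure_density) (auto intro!: nn_integral_cong simp: indicator_def)
  consider "x < 0" | "0 \<le> x" "x < 1" | "1 \<le> x" by linarith
  then show "emeasure (distr (density lborel (indicator (ball (0::complex) 1))) borel norm) {x<..} =
      emeasure (density lborel (\<lambda>r. ennreal (indicator {0..<1} r * (2 * pi * r)))) {x<..}"
  proof cases
    case 1
    then have "emeasure lborel (ball (0::complex) 1 - cball 0 x) = ennreal pi" using ball[of 1] by simp
    moreover have "(\<integral>\<^sup>+r. ennreal (2 * pi * r) * indicator ({0..<1} \<inter> {x<..}) r \<partial>lborel) = (\<integral>\<^sup>+r. ennreal (2 * pi * r) * indicator {0..1} r \<partial>lborel)"
    proof (rule nn_integral_cong_AE)
      show "AE r in lborel. ennreal (2 * pi * r) * indicator ({0..<1} \<inter> {x<..}) r = ennreal (2 * pi * r) * indicator {0..1} r"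
        using AE_lborel_singleton[of "1::real"] by eventually_elim (use 1 in \<open>auto simp: indicator_def\<close>)
    qed
    ultimately show ?thesis unfolding e r using FTC[of 0] by simp
  next
    case 2
    have "(\<integral>\<^sup>+r. ennreal (2 * pi * r) * indicator ({0..<1} \<inter> {x<..}) r \<partial>lborel) = (\<integral>\<^sup>+r. ennreal (2 * pi * r) * indicator {x..1} r \<partial>lborel)"
    proof (rule nn_integral_cong_AE)
      show "AE r in lborel. ennreal (2 * pi * r) * indicator ({0..<1} \<inter> {x<..}) r = ennreal (2 * pi * r) * indicator {x..1} r"
        using AE_lborel_singleton[of "1::real"] AE_lborel_singleton[of x]
        by eventually_elim (use 2 in \<open>auto simp: indicator_def\<close>)
    qed
    then show ?thesis unfolding e r using FTC[of x] pos 2 by simp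
  next
    case 3
    then have eqs: "ball (0::complex) 1 - cball 0 x = {}" "{0..<1} \<inter> {x<..} = {}" by auto
    show ?thesis unfolding e r eqs by simp
  qed
qed auto

text \<open>By rotation invariance \<open>f\<close> may be replaced by its average over all
  rotations. That average is radial, so its integral depends only on the distribution of the
  modulus.\<close>

lemma nn_integral_polar:
  fixes f :: "complex \<Rightarrow> ennreal"
  assumes [measurable]: "f \<in> borel_measurable borel"
  shows "(\<integral>\<^sup>+z. indicator (ball 0 1) z * f z \<partial>lborel) =
    (\<integral>\<^sup>+r. ennreal (indicator {0..<1} r * (2 * pi * r)) * (\<integral>\<^sup>+t. f (of_real r * cis t) \<partial>circle_measure) \<partial>lborel)"
proof -
  define g where "g = (\<lambda>z. \<integral>\<^sup>+t. f (z * cis t) \<partial>circle_measure)"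
  have [measurable]: "g \<in> borel_measurable borel"
    unfolding g_def by (rule circle.borel_measurable_nn_integral) (simp add: case_prod_beta)
  have g_norm: "g z = g (of_real (norm z))" for z
  proof -
    define a where "a = Arg2pi z"
    have z: "z = of_real (norm z) * cis a" using Arg2pi_eq[of z] by (simp add: a_def cis_conv_exp)
    have "g z = (\<integral>\<^sup>+t. f (of_real (norm z) * cis (a + t)) \<partial>circle_measure)"
      unfolding g_def by (subst z) (simp add: mult.assoc cis_mult)
    also have "\<dots> = g (of_real (norm z))" unfolding g_def
      using Arg2pi_ge_0[of z] Arg2pi_lt_2pi[of z]
      by (intro nn_integral_circle_translate) (auto simp: a_def simp flip: cis_mult)
    finally show ?thesis .
  qed
  have "(\<integral>\<^sup>+z. indicator (ball 0 1) z * f z \<partial>lborel) =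
      (\<integral>\<^sup>+t. (\<integral>\<^sup>+z. indicator (ball 0 1) z * f z \<partial>lborel) \<partial>circle_measure)"
    by (simp add: emeasure_circle)
  also have "\<dots> = (\<integral>\<^sup>+t. (\<integral>\<^sup>+z. indicator (ball 0 1) z * f (z * cis t) \<partial>lborel) \<partial>circle_measure)"
  proof (rule nn_integral_cong)
    fix t
    have "(\<integral>\<^sup>+z. indicator (ball 0 1) (cis t * z) * f (cis t * z) \<partial>lborel) = (\<integral>\<^sup>+z. indicator (ball 0 1) z * f z \<partial>lborel)"
      by (rule nn_integral_rotate) (intro borel_measurable_times_ennreal borel_measurable_indicator borel_open open_ball assms)
    then show "(\<integral>\<^sup>+z. indicator (ball 0 1) z * f z \<partial>lborel) = (\<integral>\<^sup>+z. indicator (ball 0 1) z * f (z * cis t) \<partial>lborel)"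
      by (simp add: indicator_def norm_mult mult.commute[of "cis t"] cong: if_cong)
  qed
  also have "\<dots> = (\<integral>\<^sup>+z. (\<integral>\<^sup>+t. indicator (ball 0 1) z * f (z * cis t) \<partial>circle_measure) \<partial>lborel)"
  proof -
    interpret pair_sigma_finite circle_measure "lborel :: complex measure" ..
    show ?thesis proof (rule Fubini'[symmetric])
      have [measurable]: "indicator (ball (0::complex) 1) \<in> borel_measurable borel"
        by (intro borel_measurable_indicator) simp
      show "(\<lambda>(x, y). indicator (ball 0 1) y * f (y * cis x)) \<in> borel_measurable (circle_measure \<Otimes>\<^sub>M lborel)"
        unfolding case_prod_beta
        by (intro borel_measurable_times_ennreal measurable_compose[OF measurable_snd]
          measurable_compose[OF _ assms] borel_measurable_times measurable_compose[OF measurable_fst]) simp_all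
    qed
  qed
  also have "\<dots> = (\<integral>\<^sup>+z. indicator (ball 0 1) z * g z \<partial>lborel)"
    unfolding g_def by (intro nn_integral_cong nn_integral_cmult) auto
  also have "\<dots> = (\<integral>\<^sup>+z. indicator (ball 0 1) z * g (of_real (norm (z::complex))) \<partial>lborel)"
  proof (rule nn_integral_cong)
    fix z
    show "indicator (ball 0 1) z * g z = indicator (ball 0 1) z * g (of_real (norm z))"
      by (simp only: g_norm[of z])
  qed
  also have "\<dots> = (\<integral>\<^sup>+z. g (of_real (norm (z::complex))) \<partial>density lborel (indicator (ball 0 1)))"
    by (rule nn_integral_density[symmetric]) (auto intro!: borel_measurable_indicator)
  also have "\<dots> = (\<integral>\<^sup>+r. g (of_real r) \<partial>distr (density lborel (indicator (ball (0::complex) 1))) borel norm)"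
    by (rule nn_integral_distr[symmetric]) auto
  also have "\<dots> = (\<integral>\<^sup>+r. ennreal (indicator {0..<1} r * (2 * pi * r)) * g (of_real r) \<partial>lborel)"
    unfolding distr_norm_disk by (rule nn_integral_density) auto
  finally show ?thesis by (simp add: g_def)
qed

section \<open>The disk with a radial Borel weight\<close>

text \<open>The normal form of a radial weight: Borel measurable, and zero off
  \<open>{0..<1}\<close> so that the disk need not be carried along as a restricted space. The last
  section reduces an arbitrary radial weight to this form.\<close>

locale disk_weight =
  fixes w :: "real \<Rightarrow> real"
  assumes w_meas [measurable]: "w \<in> borel_measurable borel"
    and w_nonneg: "0 \<le> w r"
    and w_zero: "r \<notin> {0..<1} \<Longrightarrow> w r = 0"
    and w_int: "integrable lborel w"
    and w_pos: "0 \<le> r \<Longrightarrow> r < 1 \<Longrightarrow> 0 < (LINT s|lborel. indicator {r..<1} s * w s)"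
begin

text \<open>The Jacobian \<open>2 * pi * r\<close> divided by the \<open>pi\<close> of normalized
  area; the angle then carries total mass 1.\<close>

definition rad :: "real measure" where
  "rad = density lborel (\<lambda>r. ennreal (2 * r * w r))"

definition area :: "complex measure" where
  "area = density lborel (\<lambda>z. ennreal (w (norm z) / pi))"

lemma space_rad [simp]: "space rad = UNIV"
  and sets_rad [measurable_cong, simp]: "sets rad = sets borel"
  and space_area [simp]: "space area = UNIV"
  and sets_area [measurable_cong, simp]: "sets area = sets borel"
  by (simp_all add: rad_def area_def)

lemma integrable_lborel_weight:
  assumes [measurable]: "f \<in> borel_measurable borel" and "\<And>r. r \<in> {0..<1} \<Longrightarrow> \<bar>f r\<bar> \<le> B"
  shows "integrable lborel (\<lambda>r. f r * w r)"
proof (rule Bochner_Integration.integrable_bound)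
  show "integrable lborel (\<lambda>r. B * w r)" using w_int by simp
  have "norm (f r * w r) \<le> norm (B * w r)" for r
  proof (cases "r \<in> {0..<1}")
    case True
    then have "\<bar>f r\<bar> \<le> \<bar>B\<bar>" using assms(2)[of r] by linarith
    then show ?thesis using w_nonneg[of r] by (simp add: abs_mult mult_right_mono)
  qed (simp add: w_zero)
  then show "AE r in lborel. norm (f r * w r) \<le> norm (B * w r)" by simp
qed measurable

sublocale rad: finite_measure rad
proof
  have "emeasure rad (space rad) = (\<integral>\<^sup>+r. ennreal (2 * r * w r) \<partial>lborel)"
    unfolding rad_def by (subst emeasure_density) (auto intro!: nn_integral_cong)
  also have "\<dots> = ennreal (LINT r|lborel. 2 * r * w r)"
  proof (rule nn_integral_eq_integral)
    show "integrable lborel (\<lambda>r. 2 * r * w r)"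
      by (rule integrable_lborel_weight[where B = 2]) auto
    have "0 \<le> 2 * r * w r" for r
      using w_nonneg[of r] w_zero[of r] by (cases "r \<in> {0..<1}") auto
    then show "AE r in lborel. 0 \<le> 2 * r * w r" by simp
  qed
  finally show "emeasure rad (space rad) \<noteq> \<infinity>" by simp
qed

text \<open>Makes Fubini's theorem for radius and angle available on the disk.\<close>

lemma area_eq_distr: "area = distr (rad \<Otimes>\<^sub>M circle_measure) borel (\<lambda>p. of_real (fst p) * cis (snd p))"
proof (rule measure_eqI)
  fix A assume "A \<in> sets area"
  then have A [measurable]: "A \<in> sets borel" by simp
  have pm: "(\<lambda>p. of_real (fst p) * cis (snd p)) \<in> borel_measurable (rad \<Otimes>\<^sub>M circle_measure)"
    by measurable
  have "emeasure area A = (\<integral>\<^sup>+z. ennreal (w (norm z) / pi) * indicator A z \<partial>lborel)"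
    unfolding area_def by (rule emeasure_density) auto
  also have "\<dots> = (\<integral>\<^sup>+z. indicator (ball 0 1) z * (ennreal (w (norm z) / pi) * indicator A z) \<partial>lborel)"
    by (intro nn_integral_cong) (auto simp: indicator_def w_zero)
  also have "\<dots> = (\<integral>\<^sup>+r. ennreal (indicator {0..<1} r * (2 * pi * r)) * 
      (\<integral>\<^sup>+t. ennreal (w (norm (complex_of_real r * cis t)) / pi) * indicator A (of_real r * cis t) \<partial>circle_measure) \<partial>lborel)"
    by (rule nn_integral_polar) measurable
  also have "\<dots> = (\<integral>\<^sup>+r. ennreal (2 * r * w r) * (\<integral>\<^sup>+t. indicator A (of_real r * cis t) \<partial>circle_measure) \<partial>lborel)"
  proof (rule nn_integral_cong)
    fix r :: real
    show "ennreal (indicator {0..<1} r * (2 * pi * r)) * 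
      (\<integral>\<^sup>+t. ennreal (w (norm (complex_of_real r * cis t)) / pi) * indicator A (of_real r * cis t) \<partial>circle_measure) =
      ennreal (2 * r * w r) * (\<integral>\<^sup>+t. indicator A (of_real r * cis t) \<partial>circle_measure)"
    proof (cases "r \<in> {0..<1}")
      case True
      have "(\<integral>\<^sup>+t. ennreal (w (norm (complex_of_real r * cis t)) / pi) * indicator A (of_real r * cis t) \<partial>circle_measure)
        = ennreal (w r / pi) * (\<integral>\<^sup>+t. indicator A (of_real r * cis t) \<partial>circle_measure)"
        using True by (subst nn_integral_cmult[symmetric]) (auto simp: norm_mult)
      then show ?thesis using True w_nonneg[of r]
        by (simp add: mult.assoc[symmetric] ennreal_mult[symmetric])
    qed (simp add: w_zero)
  qed
  also have "\<dots> = (\<integral>\<^sup>+r. (\<integral>\<^sup>+t. indicator A (of_real r * cis t) \<partial>circle_measure) \<partial>rad)"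
    unfolding rad_def by (rule nn_integral_density[symmetric]) measurable
  also have "\<dots> = (\<integral>\<^sup>+p. indicator A (of_real (fst p) * cis (snd p)) \<partial>(rad \<Otimes>\<^sub>M circle_measure))"
    by (subst circle.nn_integral_fst[symmetric]) auto
  also have "\<dots> = (\<integral>\<^sup>+z. indicator A z \<partial>distr (rad \<Otimes>\<^sub>M circle_measure) borel (\<lambda>p. of_real (fst p) * cis (snd p)))"
    by (rule nn_integral_distr[symmetric, OF pm]) auto
  finally show "emeasure area A = emeasure (distr (rad \<Otimes>\<^sub>M circle_measure) borel (\<lambda>p. of_real (fst p) * cis (snd p))) A"
    by simp
qed simp

sublocale rc: pair_sigma_finite rad circle_measure ..

sublocale rc: finite_measure "rad \<Otimes>\<^sub>M circle_measure"
  by (intro finite_measure_pair_measure rad.finite_measure_axioms circle.finite_measure_axioms)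

sublocale area: finite_measure area
  unfolding area_eq_distr by (rule rc.finite_measure_distr) measurable

lemma area_integral:
  fixes h :: "complex \<Rightarrow> 'b::{banach,second_countable_topology}"
  assumes h: "integrable area h"
  shows "integrable (rad \<Otimes>\<^sub>M circle_measure) (\<lambda>(r, t). h (of_real r * cis t))"
    and "AE r in rad. integrable circle_measure (\<lambda>t. h (of_real r * cis t))"
    and "integrable rad (\<lambda>r. LINT t|circle_measure. h (of_real r * cis t))"
    and "(LINT z|area. h z) = (LINT r|rad. LINT t|circle_measure. h (of_real r * cis t))"
proof -
  have [measurable]: "h \<in> borel_measurable borel" using borel_measurable_integrable[OF h] by simp
  show 1: "integrable (rad \<Otimes>\<^sub>M circle_measure) (\<lambda>(r, t). h (of_real r * cis t))"
    using h unfolding area_eq_distr by (subst (asm) integrable_distr_eq) (simp_all add: case_prod_unfold)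
  show "AE r in rad. integrable circle_measure (\<lambda>t. h (of_real r * cis t))"
    using rc.AE_integrable_fst[OF 1] by simp
  show "integrable rad (\<lambda>r. LINT t|circle_measure. h (of_real r * cis t))"
    using rc.integrable_fst[OF 1] by simp
  have "(LINT z|area. h z) = (LINT p|(rad \<Otimes>\<^sub>M circle_measure). h (of_real (fst p) * cis (snd p)))"
    unfolding area_eq_distr by (rule integral_distr) auto
  also have "\<dots> = (LINT r|rad. LINT t|circle_measure. h (of_real r * cis t))"
    using rc.integral_fst[OF 1] by (simp add: case_prod_unfold)
  finally show "(LINT z|area. h z) = (LINT r|rad. LINT t|circle_measure. h (of_real r * cis t))" .
qed

lemma AE_rad: "AE r in rad. 0 < r \<and> r < 1"
proof -
  have "AE r in lborel. 0 < ennreal (2 * r * w r) \<longrightarrow> 0 < r \<and> r < 1"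
  proof (rule AE_I2, rule impI)
    fix r assume "0 < ennreal (2 * r * w r)"
    then have "0 < 2 * r * w r" by simp
    then have "r \<noteq> 0" "w r \<noteq> 0" by auto
    then show "0 < r \<and> r < 1" using w_zero[of r] by force
  qed
  then show ?thesis unfolding rad_def by (subst AE_density) auto
qed

lemma AE_area: "AE z in area. norm z < 1"
  unfolding area_def by (subst AE_density) (auto simp: w_zero intro!: AE_I2 intro: ccontr)

text \<open>Because \<open>rad\<close> carries the factor \<open>2 * r\<close>, this is twice the
  moment of the weight of order \<open>x + 1\<close>; the kernel denominators are its values at even
  integers.\<close>

definition moment :: "real \<Rightarrow> real" where
  "moment x = (LINT r|rad. r powr x)"

lemma integrable_rad_powr: "0 \<le> x \<Longrightarrow> integrable rad (\<lambda>r. r powr x)"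
  by (rule rad.integrable_const_bound[of _ 1])
     (use AE_rad in \<open>auto intro!: powr_le1\<close>)

lemma moment_nat: "(LINT r|rad. r ^ n) = moment (real n)"
  unfolding moment_def
  by (rule integral_cong_AE) (use AE_rad in \<open>auto simp: powr_realpow\<close>)

lemma moment_antimono: "0 \<le> x \<Longrightarrow> x \<le> y \<Longrightarrow> moment y \<le> moment x"
  unfolding moment_def
  by (rule integral_mono_AE) (use AE_rad in \<open>auto intro!: integrable_rad_powr powr_mono'\<close>)

lemma rad_pos:
  assumes "0 \<le> r" "r < 1"
  shows "0 < measure rad {r..<1}"
proof -
  have *: "0 < measure rad {r..<1}" if r: "0 < r" "r < 1" for r
  proof -
    have nn: "0 \<le> 2 * s * w s" for s
      using w_nonneg[of s] w_zero[of s] by (cases "s \<in> {0..<1}") auto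
    have "ennreal (measure rad {r..<1}) = (\<integral>\<^sup>+s. ennreal (2 * s * w s) * indicator {r..<1} s \<partial>lborel)"
      using rad.emeasure_eq_measure[of "{r..<1}"]
      unfolding rad_def by (subst (asm) emeasure_density) auto
    also have "\<dots> = (\<integral>\<^sup>+s. ennreal (indicator {r..<1} s * 2 * s * w s) \<partial>lborel)"
      by (intro nn_integral_cong) (auto simp: indicator_def)
    also have "\<dots> \<ge> (\<integral>\<^sup>+s. ennreal (2 * r * (indicator {r..<1} s * w s)) \<partial>lborel)"
      using w_nonneg r by (intro nn_integral_mono ennreal_leI) (auto simp: indicator_def intro!: mult_right_mono)
    also (xtrans) have "(\<integral>\<^sup>+s. ennreal (2 * r * (indicator {r..<1} s * w s)) \<partial>lborel) = ennreal (LINT s|lborel. 2 * r * (indicator {r..<1} s * w s))"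
    proof (rule nn_integral_eq_integral)
      have "integrable lborel (\<lambda>s. indicator {r..<1} s * w s)"
        by (rule integrable_lborel_weight[where B = 1]) (auto simp: indicator_def)
      then show "integrable lborel (\<lambda>s. 2 * r * (indicator {r..<1} s * w s))" by simp
    qed (use w_nonneg r in \<open>auto simp: indicator_def\<close>)
    finally have "(LINT s|lborel. 2 * r * (indicator {r..<1} s * w s)) \<le> measure rad {r..<1}"
      by (simp add: ennreal_le_iff)
    moreover have "0 < (LINT s|lborel. 2 * r * (indicator {r..<1} s * w s))"
      using w_pos[of r] r by (simp only: integral_mult_right_zero) simp
    ultimately show ?thesis by linarith
  qed
  show ?thesis
  \<comment> \<open>At \<open>r = 0\<close> the lower bound \<open>2 * r\<close> for the density is
    void, so the mass of \<open>{1/2..<1}\<close> is used.\<close>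
  proof (cases "r = 0")
    case True
    have "measure rad {1/2..<1} \<le> measure rad {r..<1}"
      by (rule rad.finite_measure_mono) (use True in auto)
    then show ?thesis using *[of "1/2"] by simp
  qed (use * assms in auto)
qed

text \<open>The source of slow decay: \<open>r\<close> may be taken arbitrarily close to 1. This
  gives both the convergence of the kernel in the disk and the sublinear growth of
  \<open>- ln (moment x)\<close>.\<close>

lemma moment_ge:
  assumes "0 < r" "r < 1" "0 \<le> x"
  shows "r powr x * measure rad {r..<1} \<le> moment x"
proof -
  have "r powr x * measure rad {r..<1} = (LINT s|rad. r powr x * indicator {r..<1} s)"
    by simp
  also have "\<dots> \<le> moment x" unfolding moment_def
  proof (rule integral_mono)
    show "r powr x * indicator {r..<1} s \<le> s powr x" for s
      using assms by (auto simp: indicator_def intro!: powr_mono2)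
  qed (use assms in \<open>auto intro!: integrable_rad_powr rad.integrable_const_bound[of _ 1]\<close>)
  finally show ?thesis .
qed

lemma moment_pos:
  assumes "0 \<le> x"
  shows "0 < moment x"
proof -
  have "0 < (1/2) powr x * measure rad {1/2..<1}" using rad_pos[of "1/2"] by simp
  then show ?thesis using moment_ge[of "1/2" x] assms by simp
qed

lemma summable_moment:
  assumes "0 \<le> x" "x < 1"
  shows "summable (\<lambda>j. x ^ j / moment (2 * real j))"
proof -
  \<comment> \<open>Chosen so that \<open>r^2\<close> lies strictly between \<open>x\<close> and 1:
    the moments are then at least a constant times the powers of \<open>r^2\<close>, which dominate
    those of \<open>x\<close>.\<close>
  define r where "r = sqrt ((x + 1) / 2)"
  have r: "0 < r" "r < 1" "r\<^sup>2 = (x + 1) / 2" using assms by (auto simp: r_def real_sqrt_lt_1_iff)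
  define m where "m = measure rad {r..<1}"
  have m: "m > 0" using rad_pos[of r] r by (simp add: m_def)
  show ?thesis
  proof (rule summable_comparison_test'[where N = 0])
    show "summable (\<lambda>j. (1 / m) * (x / ((x + 1) / 2)) ^ j)"
      using assms by (intro summable_mult summable_geometric) (auto simp: divide_less_eq)
    fix j :: nat
    have "r powr (2 * real j) = ((x + 1) / 2) ^ j"
      using powr_realpow[of r "2 * j"] r by (simp add: power_mult)
    then have "((x + 1) / 2) ^ j * m \<le> moment (2 * real j)"
      using moment_ge[of r "2 * real j"] r by (simp add: m_def)
    then have "x ^ j / moment (2 * real j) \<le> x ^ j / (((x + 1) / 2) ^ j * m)"
      using assms m by (intro divide_left_mono) (auto intro!: mult_pos_pos moment_pos)
    also have "\<dots> = (1 / m) * (x / ((x + 1) / 2)) ^ j" by (simp add: power_divide)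
    finally show "norm (x ^ j / moment (2 * real j)) \<le> (1 / m) * (x / ((x + 1) / 2)) ^ j"
      using assms moment_pos[of "2 * real j"] by simp
  qed
qed

section \<open>The projection as a coefficient multiplier, duality, and the exponent 2\<close>

definition coeff :: "(complex \<Rightarrow> complex) \<Rightarrow> nat \<Rightarrow> complex" where
  "coeff f j = (LINT z|area. cnj z ^ j * f z)"

text \<open>As a series it is Borel measurable on the whole plane. Inside the disk it is the kernel
  integral, by \<open>bergman_projection_eq_proj\<close>; the values outside do not matter because
  \<open>area\<close> gives them no mass.\<close>

definition proj :: "(complex \<Rightarrow> complex) \<Rightarrow> complex \<Rightarrow> complex" where
  "proj f z = (\<Sum>j. coeff f j / of_real (moment (2 * real j)) * z ^ j)"

lemma measurable_proj [measurable]: "proj f \<in> borel_measurable borel"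
  unfolding proj_def by measurable

lemma integrable_monomial_mult:
  assumes "integrable area f"
  shows "integrable area (\<lambda>z. cnj z ^ j * f z)"
proof (rule Bochner_Integration.integrable_bound[OF assms])
  have [measurable]: "f \<in> borel_measurable borel" using borel_measurable_integrable[OF assms] by simp
  show "(\<lambda>z. cnj z ^ j * f z) \<in> borel_measurable area" by measurable
  show "AE z in area. norm (cnj z ^ j * f z) \<le> norm (f z)"
    using AE_area by eventually_elim (auto simp: norm_mult norm_power intro!: mult_left_le_one_le power_le_one)
qed

lemma norm_coeff_le:
  assumes "integrable area f"
  shows "norm (coeff f j) \<le> (LINT z|area. norm (f z))"
proof -
  have "norm (coeff f j) \<le> (LINT z|area. norm (cnj z ^ j * f z))"
    unfolding coeff_def by (rule integral_norm_bound)
  also have "\<dots> \<le> (LINT z|area. norm (f z))"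
  proof (rule integral_mono_AE)
    show "AE z in area. norm (cnj z ^ j * f z) \<le> norm (f z)"
      using AE_area by eventually_elim (auto simp: norm_mult norm_power intro!: mult_left_le_one_le power_le_one)
  qed (use assms integrable_monomial_mult in auto)
  finally show ?thesis .
qed

lemma summable_proj:
  assumes f: "integrable area f" and x: "0 \<le> x" "x < 1"
  shows "summable (\<lambda>j. norm (coeff f j / of_real (moment (2 * real j)) * of_real x ^ j))"
proof (rule summable_comparison_test'[where N = 0])
  show "summable (\<lambda>j. (LINT z|area. norm (f z)) * (x ^ j / moment (2 * real j)))"
    by (intro summable_mult summable_moment x)
  fix j
  show "norm (norm (coeff f j / of_real (moment (2 * real j)) * of_real x ^ j)) \<le> (LINT z|area. norm (f z)) * (x ^ j / moment (2 * real j))"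
    using mult_right_mono[OF norm_coeff_le[OF f, of j], of "x ^ j / moment (2 * real j)"] x moment_pos[of "2 * real j"]
    by (simp add: norm_mult norm_divide norm_power)
qed

text \<open>The series of \<open>proj f\<close> converges uniformly on the disk of radius
  \<open>x\<close> that carries \<open>g\<close>. This is what allows termwise pairing, although
  \<open>proj f\<close> itself may a priori fail to be integrable.\<close>

lemma pairing_sums:
  assumes f: "integrable area f" and [measurable]: "g \<in> borel_measurable borel"
    and x: "0 < x" "x < 1" and g: "integrable area g" and supp: "\<And>z. norm z > x \<Longrightarrow> g z = 0"
  shows "(\<lambda>j. coeff f j * cnj (coeff g j) / of_real (moment (2 * real j))) sums (LINT z|area. proj f z * cnj (g z))"
    and "summable (\<lambda>j. norm (coeff f j * cnj (coeff g j) / of_real (moment (2 * real j))))"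
proof -
  \<comment> \<open>Dividing by \<open>x\<close> makes \<open>e\<close> bounded by 1; the factors
    \<open>x ^ j\<close> go into the coefficients, which stay summable because
    \<open>x < 1\<close>.\<close>
  define e where "e = (\<lambda>z::complex. if norm z \<le> x then z / of_real x else 0)"
  have [measurable]: "e \<in> borel_measurable borel" unfolding e_def by measurable
  have e1: "norm (e z) \<le> 1" for z using x by (auto simp: e_def norm_divide)
  define a where "a = (\<lambda>j. coeff f j / of_real (moment (2 * real j)) * of_real x ^ j)"
  have sa: "summable (\<lambda>j. norm (a j))" unfolding a_def using summable_proj[OF f, of x] x by simp
  have eg: "of_real x ^ j * (e z ^ j * cnj (g z)) = z ^ j * cnj (g z)" for j z
    using x supp[of z] by (cases "norm z \<le> x") (auto simp: e_def power_divide)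
  have cg: "of_real x ^ j * (LINT z|area. e z ^ j * cnj (g z)) = cnj (coeff g j)" for j
  proof -
    have "of_real x ^ j * (LINT z|area. e z ^ j * cnj (g z)) = (LINT z|area. of_real x ^ j * (e z ^ j * cnj (g z)))"
      by simp
    also have "\<dots> = (LINT z|area. cnj (cnj z ^ j * g z))" unfolding eg by simp
    also have "\<dots> = cnj (coeff g j)" unfolding coeff_def by (rule Bochner_Integration.integral_cnj)
    finally show ?thesis .
  qed
  have pf: "(\<Sum>j. a j * e z ^ j) * cnj (g z) = proj f z * cnj (g z)" for z
  proof (cases "norm z \<le> x")
    case True
    then have "a j * e z ^ j = coeff f j / of_real (moment (2 * real j)) * z ^ j" for j
      using x by (simp add: a_def e_def power_divide)
    then show ?thesis by (simp add: proj_def)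
  qed (use supp in simp)
  have "(\<lambda>j. a j * (LINT z|area. e z ^ j * cnj (g z))) sums (LINT z|area. (\<Sum>j. a j * e z ^ j) * cnj (g z))"
    by (rule power_series_integral[OF _ _ _ _ sa]) (use e1 g in auto)
  moreover have "a j * (LINT z|area. e z ^ j * cnj (g z)) = coeff f j * cnj (coeff g j) / of_real (moment (2 * real j))" for j
    unfolding a_def cg[symmetric] by simp
  ultimately show "(\<lambda>j. coeff f j * cnj (coeff g j) / of_real (moment (2 * real j))) sums (LINT z|area. proj f z * cnj (g z))"
    unfolding pf by simp
  show "summable (\<lambda>j. norm (coeff f j * cnj (coeff g j) / of_real (moment (2 * real j))))"
  proof (rule summable_comparison_test'[where N = 0])
    show "summable (\<lambda>j. norm (a j) * (LINT z|area. norm (e z ^ 0 * cnj (g z))))"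
      by (intro summable_mult2 sa)
    fix j
    have int: "integrable area (\<lambda>z. e z ^ j * cnj (g z))"
      by (rule Bochner_Integration.integrable_bound[OF g])
         (use e1 in \<open>auto simp: norm_mult norm_power intro!: AE_I2 mult_left_le_one_le power_le_one\<close>)
    have "norm (LINT z|area. e z ^ j * cnj (g z)) \<le> (LINT z|area. norm (e z ^ j * cnj (g z)))"
      by (rule integral_norm_bound)
    also have "\<dots> \<le> (LINT z|area. norm (e z ^ 0 * cnj (g z)))"
    proof (rule integral_mono[OF integrable_norm[OF int]])
      show "integrable area (\<lambda>z. norm (e z ^ 0 * cnj (g z)))" using g by simp
    qed (use e1 in \<open>auto simp: norm_mult norm_power intro!: mult_left_le_one_le power_le_one\<close>)
    finally have "norm (a j * (LINT z|area. e z ^ j * cnj (g z))) \<le> norm (a j) * (LINT z|area. norm (e z ^ 0 * cnj (g z)))"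
      unfolding norm_mult by (rule mult_left_mono) simp
    then show "norm (norm (coeff f j * cnj (coeff g j) / of_real (moment (2 * real j)))) \<le> norm (a j) * (LINT z|area. norm (e z ^ 0 * cnj (g z)))"
      unfolding a_def cg[symmetric] by (simp add: mult_ac)
  qed
qed


text \<open>The converse of Hoelder's inequality, tested only on bounded \<open>g\<close> supported
  in smaller disks. On such a disk the integral \<open>Y\<close> of the \<open>p\<close>-th power is
  finite, so \<open>Y \<le> K * Y powr (1/q)\<close> can be divided; monotone convergence then
  exhausts the disk.\<close>

lemma dual_criterion:
  assumes p: "p > 1" and pq: "1/p + 1/q = 1" and f: "integrable area f" and K: "K \<ge> 0"
    and bound: "\<And>g x. \<lbrakk>0 < x; x < 1; g \<in> borel_measurable borel; \<exists>B. \<forall>z. norm (g z) \<le> B;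
        \<And>z. norm z > x \<Longrightarrow> g z = 0\<rbrakk> \<Longrightarrow>
      norm (\<Sum>j. coeff f j * cnj (coeff g j) / of_real (moment (2 * real j))) \<le> K * Lnorm area q g"
  shows "integrable area (\<lambda>z. norm (proj f z) powr p)"
    and "(LINT z|area. norm (proj f z) powr p) \<le> K powr p"
proof -
  note q = conjugate_exponentD[OF p pq]
  define F where "F = (\<lambda>z. norm (proj f z) powr p)"
  have [measurable]: "cball (0::complex) x \<in> sets borel" for x by simp
  have Fm [measurable]: "F \<in> borel_measurable borel" unfolding F_def by measurable
  have disk: "integrable area (\<lambda>z. indicator (cball 0 x) z * F z)"
      "(LINT z|area. indicator (cball 0 x) z * F z) \<le> K powr p" if x: "0 < x" "x < 1" for x
  proof -
    define B where "B = (\<Sum>j. norm (coeff f j / of_real (moment (2 * real j)) * of_real x ^ j))"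
    have B: "norm (proj f z) \<le> B" if "norm z \<le> x" for z
    proof -
      have le: "norm (coeff f j / of_real (moment (2 * real j)) * z ^ j) \<le> norm (coeff f j / of_real (moment (2 * real j)) * of_real x ^ j)" for j
        unfolding norm_mult norm_power using that x by (intro mult_left_mono power_mono) auto
      have s: "summable (\<lambda>j. norm (coeff f j / of_real (moment (2 * real j)) * of_real x ^ j))"
        using summable_proj[OF f, of x] x by simp
      have "summable (\<lambda>j. norm (coeff f j / of_real (moment (2 * real j)) * z ^ j))"
        by (rule summable_comparison_test'[OF s]) (use le in simp)
      then show ?thesis unfolding proj_def B_def
        by (intro order_trans[OF summable_norm] suminf_le le s) auto
    qed
    have B0: "B \<ge> 0" using B[of 0] x by (smt (verit) norm_ge_zero norm_zero)
    \<comment> \<open>The extremal dual function of \<open>proj f\<close>, truncated so that everything is a priori finite.\<close>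
    define g where "g = (\<lambda>z. indicator (cball 0 x) z * (of_real (norm (proj f z) powr (p - 2)) * proj f z))"
    have gm [measurable]: "g \<in> borel_measurable borel" unfolding g_def by measurable
    have gn: "norm (g z) = indicator (cball 0 x) z * norm (proj f z) powr (p - 1)" for z
      using powr_mult_base[of "norm (proj f z)" "p - 2"]
      by (auto simp: g_def norm_mult indicator_def mult.commute)
    have gB: "norm (g z) \<le> B powr (p - 1)" for z
      unfolding gn using B[of z] p by (auto simp: indicator_def intro!: powr_mono2)
    have g: "integrable area g"
      by (rule area.integrable_const_bound[of _ "B powr (p - 1)"]) (use gB in auto)
    have gq: "norm (g z) powr q = indicator (cball 0 x) z * F z" for z
      unfolding gn F_def using q by (auto simp: indicator_def powr_powr)
    have pg: "proj f z * cnj (g z) = of_real (indicator (cball 0 x) z * F z)" for z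
    proof -
      have "proj f z * cnj (g z) = of_real (indicator (cball 0 x) z * (norm (proj f z) powr (p - 2) * (norm (proj f z))\<^sup>2))"
        by (simp add: g_def complex_norm_square indicator_def del: of_real_power)
      also have "norm (proj f z) powr (p - 2) * (norm (proj f z))\<^sup>2 = F z"
        using p by (cases "proj f z = 0") (auto simp: F_def powr_diff)
      finally show ?thesis .
    qed
    define Y where "Y = (LINT z|area. indicator (cball 0 x) z * F z)"
    have nn: "0 \<le> indicator (cball 0 x) z * F z" for z :: complex by (simp add: F_def)
    have Y0: "Y \<ge> 0" unfolding Y_def using nn by (intro integral_nonneg_AE) auto
    show "integrable area (\<lambda>z. indicator (cball 0 x) z * F z)"
      by (rule area.integrable_const_bound[of _ "B powr p"])
         (use B p in \<open>auto simp: indicator_def F_def intro!: AE_I2 powr_mono2\<close>)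
    have supp: "g z = 0" if "norm z > x" for z using that by (simp add: g_def)
    have "of_real Y = (LINT z|area. proj f z * cnj (g z))" unfolding pg Y_def by (rule integral_complex_of_real[symmetric])
    also have "\<dots> = (\<Sum>j. coeff f j * cnj (coeff g j) / of_real (moment (2 * real j)))"
      using pairing_sums(1)[OF f gm x g supp] by (simp add: sums_iff)
    finally have "norm (complex_of_real Y) \<le> K * Lnorm area q g"
      using bound[OF x gm _ supp] gB by auto
    also have "Lnorm area q g = Y powr (1/q)" unfolding Lnorm_def gq Y_def ..
    finally have *: "Y \<le> K * Y powr (1/q)" using Y0 by simp
    show "(LINT z|area. indicator (cball 0 x) z * F z) \<le> K powr p"
    proof (cases "Y = 0")
      case False
      then have Yp: "Y > 0" using Y0 by simp
      have "Y powr (1/p) * Y powr (1/q) = Y" using Yp pq by (simp flip: powr_add)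
      then have "Y powr (1/p) * Y powr (1/q) \<le> K * Y powr (1/q)" using * by simp
      then have "Y powr (1/p) \<le> K" using Yp by simp
      then have "(Y powr (1/p)) powr p \<le> K powr p" using p by (intro powr_mono2) auto
      then show ?thesis using p Yp by (simp add: powr_powr Y_def)
    qed (simp add: Y_def)
  qed
  define r where "r = (\<lambda>n. 1 - inverse (real (Suc (Suc n))))"
  have r: "0 < r n" "r n < 1" for n by (auto simp: r_def field_simps)
  have mono: "incseq (\<lambda>n z. ennreal (indicator (cball (0::complex) (r n)) z * F z))"
  proof (intro incseq_SucI le_funI ennreal_leI mult_right_mono)
    fix n and z :: complex
    have "r n \<le> r (Suc n)" by (auto simp: r_def intro!: le_imp_inverse_le)
    then show "indicator (cball 0 (r n)) z \<le> (indicator (cball 0 (r (Suc n))) z :: real)"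
      by (auto simp: indicator_def)
  qed (simp add: F_def)
  have lim: "(\<lambda>n. ennreal (indicator (cball 0 (r n)) z * F z)) \<longlonglongrightarrow> ennreal (F z)" if "norm z < 1" for z :: complex
  proof (rule tendsto_eventually)
    have "r \<longlonglongrightarrow> 1 - 0"
      unfolding r_def by (intro tendsto_diff tendsto_const LIMSEQ_Suc[OF LIMSEQ_inverse_real_of_nat])
    then have "r \<longlonglongrightarrow> 1" by simp
    then have "eventually (\<lambda>n. norm z < r n) sequentially" using that by (rule order_tendstoD)
    then show "eventually (\<lambda>n. ennreal (indicator (cball 0 (r n)) z * F z) = ennreal (F z)) sequentially"
      by eventually_elim auto
  qed
  have "(\<integral>\<^sup>+z. ennreal (F z) \<partial>area) = (\<integral>\<^sup>+z. (SUP n. ennreal (indicator (cball 0 (r n)) z * F z)) \<partial>area)"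
  proof (rule nn_integral_cong_AE)
    show "AE z in area. ennreal (F z) = (SUP n. ennreal (indicator (cball 0 (r n)) z * F z))"
      using AE_area
    proof eventually_elim
      case (elim z)
      have "incseq (\<lambda>n. ennreal (indicator (cball 0 (r n)) z * F z))"
        using mono by (auto simp: incseq_def le_fun_def)
      then show ?case using LIMSEQ_unique[OF LIMSEQ_SUP lim[OF elim]] by auto
    qed
  qed
  also have "\<dots> = (SUP n. (\<integral>\<^sup>+z. ennreal (indicator (cball 0 (r n)) z * F z) \<partial>area))"
    by (rule nn_integral_monotone_convergence_SUP[OF mono]) measurable
  also have "\<dots> \<le> ennreal (K powr p)"
  proof (rule SUP_least)
    fix n
    have "(\<integral>\<^sup>+z. ennreal (indicator (cball 0 (r n)) z * F z) \<partial>area) = ennreal (LINT z|area. indicator (cball 0 (r n)) z * F z)"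
      by (rule nn_integral_eq_integral[OF disk(1)[OF r]]) (simp add: F_def)
    then show "(\<integral>\<^sup>+z. ennreal (indicator (cball 0 (r n)) z * F z) \<partial>area) \<le> ennreal (K powr p)"
      using disk(2)[OF r, of n] by (simp add: ennreal_leI)
  qed
  finally have fin: "(\<integral>\<^sup>+z. ennreal (F z) \<partial>area) \<le> ennreal (K powr p)" .
  show i: "integrable area (\<lambda>z. norm (proj f z) powr p)"
    unfolding F_def[symmetric]
    by (rule integrableI_nonneg) (use fin in \<open>auto simp: F_def intro: le_less_trans\<close>)
  have eq: "ennreal (LINT z|area. F z) = (\<integral>\<^sup>+z. ennreal (F z) \<partial>area)"
    by (rule nn_integral_eq_integral[symmetric]) (use i in \<open>auto simp: F_def\<close>)
  have "ennreal (LINT z|area. F z) \<le> ennreal (K powr p)" unfolding eq by (rule fin)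
  then show "(LINT z|area. norm (proj f z) powr p) \<le> K powr p"
    unfolding F_def[symmetric] by (simp add: ennreal_le_iff)
qed

lemma monomial_orthogonal:
  "(LINT z|area. cnj z ^ j * z ^ k) = (if j = k then of_real (moment (2 * real j)) else 0)"
proof -
  have i: "integrable area (\<lambda>z. cnj z ^ j * z ^ k)"
  proof (rule area.integrable_const_bound[of _ 1])
    show "AE z in area. norm (cnj z ^ j * z ^ k) \<le> 1"
      using AE_area by eventually_elim (auto simp: norm_mult norm_power intro!: mult_le_one power_le_one)
  qed measurable
  have e: "cnj (of_real r * cis t) ^ j * (of_real r * cis t) ^ k = of_real (r ^ (j + k)) * cis (of_int (int k - int j) * t)" for r t
    by (simp add: power_mult_distrib cis_cnj Complex.DeMoivre power_add cis_mult algebra_simps)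
  have "(LINT z|area. cnj z ^ j * z ^ k) = (LINT r|rad. LINT t|circle_measure. of_real (r ^ (j + k)) * cis (of_int (int k - int j) * t))"
    unfolding area_integral(4)[OF i] e ..
  also have "\<dots> = (LINT r|rad. of_real (r ^ (j + k)) * (if int k - int j = 0 then 1 else 0))"
    by (simp only: integral_mult_right_zero circle_character)
  also have "\<dots> = (if j = k then of_real (moment (2 * real j)) else 0)"
  proof (cases "j = k")
    case True
    have "(LINT r|rad. complex_of_real (r ^ (j + j))) = of_real (moment (real (j + j)))"
      unfolding moment_nat[symmetric] by (rule integral_complex_of_real)
    moreover have "real (j + j) = 2 * real j" by simp
    ultimately show ?thesis using True by (simp only: diff_self simp_thms if_True mult_1_right)
  qed simp
  finally show ?thesis .
qed

text \<open>\<open>h\<close> is the orthogonal projection of \<open>f\<close> to the polynomials of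
  degree below \<open>N\<close>; the claim is the nonnegativity of the integral of
  \<open>(norm (f z - h z))^2\<close>.\<close>

lemma bessel:
  assumes [measurable]: "f \<in> borel_measurable borel" and f2: "integrable area (\<lambda>z. (norm (f z))\<^sup>2)"
  shows "(\<Sum>j<N. (norm (coeff f j))\<^sup>2 / moment (2 * real j)) \<le> (LINT z|area. (norm (f z))\<^sup>2)"
proof -
  have f: "integrable area f"
    using integrable_of_powr_integrable[OF area.finite_measure_axioms, of 2 f] f2 by simp
  define c where "c = (\<lambda>j. coeff f j / of_real (moment (2 * real j)))"
  define h where "h = (\<lambda>z. \<Sum>j<N. c j * z ^ j)"
  have [measurable]: "h \<in> borel_measurable borel" unfolding h_def by measurable
  have im: "integrable area (\<lambda>z. cnj z ^ j * z ^ k)" for j k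
  proof (rule area.integrable_const_bound[of _ 1])
    show "AE z in area. norm (cnj z ^ j * z ^ k) \<le> 1"
      using AE_area by eventually_elim (auto simp: norm_mult norm_power intro!: mult_le_one power_le_one)
  qed measurable
  have if': "integrable area (\<lambda>z. cnj z ^ j * f z)" for j by (rule integrable_monomial_mult[OF f])
  have ifh: "integrable area (\<lambda>z. cnj (h z) * f z)"
    "(LINT z|area. cnj (h z) * f z) = (\<Sum>j<N. cnj (c j) * coeff f j)"
  proof -
    have e: "cnj (h z) * f z = (\<Sum>j<N. cnj (c j) * (cnj z ^ j * f z))" for z
      by (simp add: h_def sum_distrib_right mult.assoc)
    show "integrable area (\<lambda>z. cnj (h z) * f z)" unfolding e using if' by auto
    show "(LINT z|area. cnj (h z) * f z) = (\<Sum>j<N. cnj (c j) * coeff f j)"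
      unfolding e coeff_def using if' by (subst Bochner_Integration.integral_sum) auto
  qed
  have ihh: "integrable area (\<lambda>z. cnj (h z) * h z)"
    "(LINT z|area. cnj (h z) * h z) = (\<Sum>j<N. cnj (c j) * c j * of_real (moment (2 * real j)))"
  proof -
    have e: "cnj (h z) * h z = (\<Sum>j<N. \<Sum>k<N. cnj (c j) * c k * (cnj z ^ j * z ^ k))" for z
    proof -
      have "cnj (h z) = (\<Sum>j<N. cnj (c j) * cnj z ^ j)" by (simp add: h_def)
      then show ?thesis unfolding h_def sum_product
        by (simp only: sum_product) (intro sum.cong refl, simp add: mult_ac)
    qed
    show "integrable area (\<lambda>z. cnj (h z) * h z)" unfolding e using im by auto
    have "(LINT z|area. cnj (h z) * h z) = (\<Sum>j<N. \<Sum>k<N. cnj (c j) * c k * (LINT z|area. cnj z ^ j * z ^ k))"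
      unfolding e using im by (subst Bochner_Integration.integral_sum, auto)+
    also have "\<dots> = (\<Sum>j<N. \<Sum>k<N. if j = k then cnj (c j) * c k * of_real (moment (2 * real j)) else 0)"
      unfolding monomial_orthogonal by (intro sum.cong) auto
    also have "\<dots> = (\<Sum>j<N. cnj (c j) * c j * of_real (moment (2 * real j)))" by simp
    finally show "(LINT z|area. cnj (h z) * h z) = (\<Sum>j<N. cnj (c j) * c j * of_real (moment (2 * real j)))" .
  qed
  have nz: "moment (2 * real j) > 0" for j by (rule moment_pos) simp
  define S where "S = (\<Sum>j<N. (norm (coeff f j))\<^sup>2 / moment (2 * real j))"
  have S1: "(\<Sum>j<N. cnj (c j) * coeff f j) = of_real S"
    unfolding S_def of_real_sum
    by (intro sum.cong refl) (simp add: c_def complex_norm_square mult.commute del: of_real_power)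
  have S2: "(\<Sum>j<N. cnj (c j) * c j * of_real (moment (2 * real j))) = of_real S"
    unfolding S_def of_real_sum using nz
    by (intro sum.cong refl) (simp add: c_def complex_norm_square mult.commute less_imp_neq[symmetric] del: of_real_power)
  have "(norm (f z - h z))\<^sup>2 = (norm (f z))\<^sup>2 - 2 * Re (cnj (h z) * f z) + Re (cnj (h z) * h z)" for z
    unfolding cmod_power2 by (simp add: algebra_simps power2_eq_square)
  then have "0 \<le> (norm (f z))\<^sup>2 - 2 * Re (cnj (h z) * f z) + Re (cnj (h z) * h z)" for z
    by (metis zero_le_power2)
  then have "0 \<le> (LINT z|area. (norm (f z))\<^sup>2 - 2 * Re (cnj (h z) * f z) + Re (cnj (h z) * h z))"
    by (intro integral_nonneg_AE) auto
  also have "\<dots> = (LINT z|area. (norm (f z))\<^sup>2) - 2 * Re (LINT z|area. cnj (h z) * f z) + Re (LINT z|area. cnj (h z) * h z)"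
    using f2 integrable_Re[OF ifh(1)] integrable_Re[OF ihh(1)]
    by (simp only: Bochner_Integration.integral_add Bochner_Integration.integral_diff Bochner_Integration.integrable_diff
        integrable_mult_right integral_mult_right_zero integral_Re[OF ifh(1)] integral_Re[OF ihh(1)])
  also have "\<dots> = (LINT z|area. (norm (f z))\<^sup>2) - S" unfolding ifh ihh S1 S2 by simp
  finally show ?thesis by (simp add: S_def)
qed

text \<open>Bessel's inequality for both functions and Cauchy-Schwarz for the coefficients feed the
  dual criterion with \<open>K = Lnorm area 2 f\<close>, hence the constant 1.\<close>

lemma proj_bounded_2:
  assumes [measurable]: "f \<in> borel_measurable borel" and f2: "integrable area (\<lambda>z. norm (f z) powr 2)"
  shows "integrable area (\<lambda>z. norm (proj f z) powr 2)"
    and "(LINT z|area. norm (proj f z) powr 2) \<le> (LINT z|area. norm (f z) powr 2)"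
proof -
  have f: "integrable area f"
    using integrable_of_powr_integrable[OF area.finite_measure_axioms, of 2 f] f2 by simp
  have nz: "moment (2 * real j) > 0" for j by (rule moment_pos) simp
  have L: "Lnorm area 2 g = sqrt (LINT z|area. (norm (g z))\<^sup>2)" for g :: "complex \<Rightarrow> complex"
    unfolding Lnorm_def by (simp add: powr_half_sqrt integral_nonneg_AE)
  have *: "norm (\<Sum>j. coeff f j * cnj (coeff g j) / of_real (moment (2 * real j))) \<le> Lnorm area 2 f * Lnorm area 2 g"
    if x: "0 < x" "x < 1" and [measurable]: "g \<in> borel_measurable borel" and B: "\<exists>B. \<forall>z. norm (g z) \<le> B"
      and supp: "\<And>z. norm z > x \<Longrightarrow> g z = 0" for g x
  proof -
    obtain B where B: "\<And>z. norm (g z) \<le> B" using B by blast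
    have g: "integrable area g" by (rule area.integrable_const_bound[of _ B]) (use B in auto)
    have g2: "integrable area (\<lambda>z. (norm (g z))\<^sup>2)"
      by (rule area.integrable_const_bound[of _ "B\<^sup>2"]) (use B in \<open>auto intro!: AE_I2 power_mono\<close>)
    have s: "(\<lambda>N. \<Sum>j<N. coeff f j * cnj (coeff g j) / of_real (moment (2 * real j))) \<longlonglongrightarrow> (\<Sum>j. coeff f j * cnj (coeff g j) / of_real (moment (2 * real j)))"
      using summable_LIMSEQ[OF summable_norm_cancel[OF pairing_sums(2)[OF f that(3) x g supp]]] .
    have "norm (\<Sum>j<N. coeff f j * cnj (coeff g j) / of_real (moment (2 * real j))) \<le> Lnorm area 2 f * Lnorm area 2 g" for N
    proof -
      define a b where "a = (\<lambda>j. norm (coeff f j) / sqrt (moment (2 * real j)))"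
        and "b = (\<lambda>j. norm (coeff g j) / sqrt (moment (2 * real j)))"
      have "norm (\<Sum>j<N. coeff f j * cnj (coeff g j) / of_real (moment (2 * real j))) \<le> (\<Sum>j<N. norm (coeff f j * cnj (coeff g j) / of_real (moment (2 * real j))))"
        by (rule norm_sum)
      also have "\<dots> = (\<Sum>j<N. \<bar>a j\<bar> * \<bar>b j\<bar>)"
        using nz by (intro sum.cong refl) (simp add: a_def b_def norm_mult norm_divide less_imp_le)
      also have "\<dots> \<le> L2_set a {..<N} * L2_set b {..<N}" by (rule L2_set_mult_ineq)
      also have "\<dots> \<le> Lnorm area 2 f * Lnorm area 2 g"
      proof (rule mult_mono)
        show "L2_set a {..<N} \<le> Lnorm area 2 f"
          unfolding L2_set_def L using bessel[of f N] f2 nz by (simp add: a_def power_divide less_imp_le)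
        show "L2_set b {..<N} \<le> Lnorm area 2 g"
          unfolding L2_set_def L using bessel[of g N] g2 nz by (simp add: b_def power_divide less_imp_le)
      qed (auto simp: L2_set_nonneg)
      finally show ?thesis .
    qed
    then show ?thesis by (intro LIMSEQ_le_const2[OF tendsto_norm[OF s]]) auto
  qed
  have K: "Lnorm area 2 f powr 2 = (LINT z|area. norm (f z) powr 2)" by (rule Lnorm_powr) simp
  show "integrable area (\<lambda>z. norm (proj f z) powr 2)"
    by (rule dual_criterion(1)[where q = 2 and K = "Lnorm area 2 f", OF _ _ f _ *]) auto
  show "(LINT z|area. norm (proj f z) powr 2) \<le> (LINT z|area. norm (f z) powr 2)"
    unfolding K[symmetric]
    by (rule dual_criterion(2)[where q = 2 and K = "Lnorm area 2 f", OF _ _ f _ *]) auto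
qed

end

section \<open>Boundedness forces doubling moments\<close>

text \<open>One endpoint is moved at a time, through the chord over \<open>[x, y']\<close>. Slopes
  are taken with reversed sign because the functions in view decrease.\<close>

lemma chord_slope_antimono:
  fixes \<phi> :: "real \<Rightarrow> real"
  assumes c: "convex_on {0..} \<phi>" and "0 \<le> x" "x < y" "x' < y'" "x \<le> x'" "y \<le> y'"
  shows "(\<phi> x' - \<phi> y') / (y' - x') \<le> (\<phi> x - \<phi> y) / (y - x)"
proof -
  have neg: "(\<phi> a - \<phi> b) / (b - a) = - ((\<phi> a - \<phi> b) / (a - b))" for a b
    by (metis minus_diff_eq minus_divide_right)
  have "(\<phi> x - \<phi> y) / (x - y) \<le> (\<phi> x - \<phi> y') / (x - y')"
    using convex_on_slope_le(1)[OF c, of x y' y] assms by (cases "y = y'") auto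
  moreover have "(\<phi> x - \<phi> y') / (x - y') \<le> (\<phi> x' - \<phi> y') / (x' - y')"
    using convex_on_slope_le(2)[OF c, of x y' x'] assms by (cases "x = x'") auto
  ultimately show ?thesis unfolding neg by linarith
qed

text \<open>The gap between the slopes of the chords over \<open>[nq, 2n]\<close> and \<open>[2n, np]\<close> is \<open>O(1/n)\<close>, and the right chord at \<open>n\<close> is flatter
  than the left chord at some \<open>m \<ge> \<theta>' n\<close> with \<open>\<theta>' > 1\<close>; summing the geometric series shows that the left chord
  slope itself is \<open>O(1/n)\<close>.\<close>

lemma convex_three_point_bound:
  fixes \<phi> :: "real \<Rightarrow> real" and p q c :: real
  assumes conv: "convex_on {0..} \<phi>" and anti: "\<And>x y. 0 \<le> x \<Longrightarrow> x \<le> y \<Longrightarrow> \<phi> y \<le> \<phi> x"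
    and sublin: "\<And>\<epsilon>. \<epsilon> > 0 \<Longrightarrow> \<exists>c. \<forall>x\<ge>0. - \<epsilon> * x - c \<le> \<phi> x"
    and pq: "p > 2" "1 < q" "q < 2" "1/p + 1/q = 1"
    and three: "\<And>n::nat. \<phi> (n * q) / q + \<phi> (n * p) / p - \<phi> (2 * n) \<le> c"
  obtains D and N :: nat where "\<And>n::nat. n \<ge> N \<Longrightarrow> \<phi> (n * q) - \<phi> (2 * n) \<le> D"
proof -
  define s1 where "s1 = (\<lambda>n::nat. (\<phi> (n * q) - \<phi> (2 * n)) / (2 * n - n * q))"
  define s2 where "s2 = (\<lambda>n::nat. (\<phi> (2 * n) - \<phi> (n * p)) / (n * p - 2 * n))"
  \<comment> \<open>Conjugacy gives \<open>(2 - q) / q = (p - 2) / p\<close>: the chords have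
    lengths \<open>\<kappa> * n * q\<close> and \<open>\<kappa> * n * p\<close>, so the hypothesis
    reads \<open>\<kappa> * n * (s1 n - s2 n) \<le> c\<close>.\<close>
  define \<kappa> where "\<kappa> = (2 - q) / q"
  have \<kappa>: "\<kappa> > 0" "\<kappa> = (p - 2) / p" using pq by (auto simp: \<kappa>_def field_simps)
  define c1 where "c1 = max c 0 / \<kappa>"
  have c1: "c1 \<ge> 0" unfolding c1_def using \<kappa>(1) by (intro divide_nonneg_nonneg) auto
  have gap: "s1 n \<le> s2 n + c1 / n" if "n > 0" for n :: nat
  proof -
    have n: "real n > 0" using that by simp
    have "\<kappa> * n * s1 n = (\<phi> (n * q) - \<phi> (2 * n)) / q"
      using n pq by (simp add: s1_def \<kappa>_def field_simps)
    moreover have "\<kappa> * n * s2 n = (\<phi> (2 * n) - \<phi> (n * p)) / p"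
      unfolding \<kappa>(2) using n pq by (simp add: s2_def field_simps)
    moreover have "\<phi> (2 * n) = \<phi> (2 * n) / p + \<phi> (2 * n) / q"
      using pq(4) by (metis distrib_left mult.right_neutral times_divide_eq_right)
    ultimately have "\<kappa> * n * s1 n - \<kappa> * n * s2 n \<le> max c 0"
      using three[of n] by (simp add: diff_divide_distrib)
    then have "\<kappa> * n * (s1 n - s2 n) \<le> max c 0" by (simp add: algebra_simps)
    then have "s1 n - s2 n \<le> max c 0 / (\<kappa> * n)"
      using mult_pos_pos[OF \<kappa>(1) n] by (simp only: pos_le_divide_eq mult.commute)
    then show ?thesis by (simp add: c1_def)
  qed
  have s1_small: "\<exists>M. \<forall>m\<ge>M. s1 m \<le> \<epsilon>" if e: "\<epsilon> > 0" for \<epsilon>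
  proof -
    \<comment> \<open>With this slope the sublinear bound costs \<open>\<delta> * (2 * m)\<close>,
      half of the allowance \<open>\<epsilon> * (2 * m - m * q)\<close>; the other half absorbs the
      constants for large \<open>m\<close>.\<close>
    define \<delta> where "\<delta> = \<epsilon> * (2 - q) / 4"
    have "\<delta> > 0" using e pq by (simp add: \<delta>_def)
    then obtain d where d: "\<And>x. x \<ge> 0 \<Longrightarrow> - \<delta> * x - d \<le> \<phi> x" using sublin by blast
    obtain M :: nat where M: "M > 0" "2 * (\<phi> 0 + d) / (\<epsilon> * (2 - q)) \<le> M"
      by (metis (no_types, opaque_lifting) gr0I le_cases linorder_not_less of_nat_0 of_nat_1 order_trans real_arch_simple zero_le_one zero_less_one)
    have "s1 m \<le> \<epsilon>" if m: "m \<ge> M" for m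
    proof -
      have m0: "real m > 0" using m M by simp
      have "2 * (\<phi> 0 + d) / (\<epsilon> * (2 - q)) \<le> m" using M m by linarith
      then have 1: "2 * (\<phi> 0 + d) \<le> m * (\<epsilon> * (2 - q))" using e pq by (simp add: divide_le_eq)
      have "\<phi> (m * q) - \<phi> (2 * m) \<le> \<phi> 0 + \<delta> * (2 * m) + d"
        using anti[of 0 "m * q"] d[of "2 * m"] m0 pq by simp
      also have "\<dots> \<le> \<epsilon> * (2 * m - m * q)"
      proof -
        have half: "a + y / 2 + b \<le> y" if "2 * (a + b) \<le> y" for a b y :: real using that by simp
        have "\<delta> * (2 * m) = m * (\<epsilon> * (2 - q)) / 2" by (simp add: \<delta>_def)
        moreover have "\<epsilon> * (2 * m - m * q) = m * (\<epsilon> * (2 - q))" by (simp add: algebra_simps)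
        ultimately show ?thesis using half[OF 1] by (simp only:)
      qed
      finally show ?thesis using m0 pq unfolding s1_def by (subst divide_le_eq) auto
    qed
    then show ?thesis by blast
  qed
  \<comment> \<open>These bounds turn \<open>m \<le> \<theta> * n\<close> into
    \<open>m * q \<le> 2 * n\<close> and \<open>2 * m \<le> n * p\<close>, so the left chord at
    \<open>m\<close> starts and ends no later than the right chord at \<open>n\<close>.\<close>
  define \<theta> where "\<theta> = min (2 / q) (p / 2)"
  have \<theta>: "\<theta> > 1" "\<theta> \<le> 2 / q" "\<theta> \<le> p / 2" using pq by (auto simp: \<theta>_def)
  \<comment> \<open>Halfway between 1 and \<open>\<theta>\<close>; what is given up pays for
    rounding \<open>\<theta> * n\<close> down to an integer once \<open>n \<ge> N\<close>.\<close>
  define \<theta>' where "\<theta>' = (1 + \<theta>) / 2"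
  have \<theta>': "\<theta>' > 1" using \<theta> by (simp add: \<theta>'_def)
  define D where "D = c1 * \<theta>' / (\<theta>' - 1)"
  have D: "D \<ge> 0" "c1 + D / \<theta>' = D"
  proof -
    show "D \<ge> 0" using c1 \<theta>' by (simp add: D_def)
    have "D * (\<theta>' - 1) = c1 * \<theta>'" using \<theta>' by (simp add: D_def)
    then show "c1 + D / \<theta>' = D" using \<theta>' by (simp add: field_simps)
  qed
  obtain N :: nat where N: "N > 0" "2 / (\<theta> - 1) \<le> N"
    by (metis (no_types, opaque_lifting) gr0I le_cases linorder_not_less of_nat_0 of_nat_1 order_trans real_arch_simple zero_le_one zero_less_one)
  \<comment> \<open>\<open>D\<close> solves \<open>c1 + D / \<theta>' = D\<close>, which sums the
    geometric series implicitly: subtracting \<open>D / n\<close> turns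
    \<open>s1 n \<le> s1 m + c1 / n\<close> into \<open>E n \<le> E m\<close>.\<close>
  define E where "E = (\<lambda>n. s1 n - D / real n)"
  have step: "\<exists>m>n. E n \<le> E m" if n: "n \<ge> N" for n
  proof -
    have n0: "real n > 0" using N n by simp
    define m where "m = nat \<lfloor>\<theta> * n\<rfloor>"
    have fl: "real m \<le> \<theta> * n" "\<theta> * n - 1 < real m"
      using n0 \<theta> by (auto simp: m_def)
    have "2 / (\<theta> - 1) \<le> n" using N n by linarith
    then have "2 \<le> n * (\<theta> - 1)" using \<theta> by (simp add: divide_le_eq)
    then have "real n + 2 \<le> \<theta> * n" by (simp add: algebra_simps)
    moreover have "\<theta>' * n = (n + \<theta> * n) / 2" by (simp add: \<theta>'_def algebra_simps)
    moreover have "(a + b) / 2 \<le> b - 1" if "a + 2 \<le> b" for a b :: real using that by simp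
    ultimately have "\<theta>' * n \<le> \<theta> * n - 1" by metis
    then have mt: "\<theta>' * n \<le> m" using fl by linarith
    moreover have "n < \<theta>' * n" using \<theta>' n0 by simp
    ultimately have mn: "n < m" by linarith
    have "m \<le> 2 / q * n" using fl(1) mult_right_mono[OF \<theta>(2), of n] by linarith
    then have a: "m * q \<le> 2 * n" using pq by (simp add: field_simps)
    have "m \<le> p / 2 * n" using fl(1) mult_right_mono[OF \<theta>(3), of n] by linarith
    then have b: "2 * m \<le> n * p" by (simp add: field_simps)
    have "s2 n \<le> s1 m" unfolding s1_def s2_def
      by (rule chord_slope_antimono[OF conv]) (use a b mn n0 pq in auto)
    then have "s1 n \<le> s1 m + c1 / n" using gap[of n] n0 by simp
    moreover have "D / m \<le> (D / \<theta>') / n"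
    proof -
      have "D / m \<le> D / (\<theta>' * n)" using D mt \<theta>' n0 mn by (intro divide_left_mono) (auto intro!: mult_pos_pos)
      then show ?thesis by simp
    qed
    moreover have "D / n = c1 / n + (D / \<theta>') / n" using D(2) by (metis add_divide_distrib)
    ultimately have "E n \<le> E m" unfolding E_def by linarith
    then show ?thesis using mn by blast
  qed
  have E0: "E n \<le> 0" if n: "n \<ge> N" for n
  proof (rule ccontr)
    assume "\<not> E n \<le> 0"
    then have En: "E n > 0" by simp
    then obtain M where M: "\<And>m. m \<ge> M \<Longrightarrow> s1 m \<le> E n / 2" using s1_small[of "E n / 2"] by auto
    \<comment> \<open>\<open>E k \<le> s1 k\<close> and \<open>s1\<close> is eventually below any
      positive number, so a positive value is reached again only finitely often; \<open>step\<close>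
      contradicts the last such index.\<close>
    define A where "A = {k. k \<ge> N \<and> E n \<le> E k}"
    have "A \<subseteq> {..<M}"
    proof
      fix k assume "k \<in> A"
      then have "E n \<le> E k" by (simp add: A_def)
      moreover have "E k \<le> s1 k" using D(1) by (simp add: E_def)
      ultimately have "E n \<le> s1 k" by simp
      then show "k \<in> {..<M}" using M[of k] En by (cases "k < M") auto
    qed
    then have fin: "finite A" by (rule finite_subset) simp
    have "n \<in> A" using n by (simp add: A_def)
    then have "Max A \<in> A" using fin by (intro Max_in) auto
    then obtain m where "m > Max A" "E (Max A) \<le> E m" using step by (auto simp: A_def)
    with \<open>Max A \<in> A\<close> have "m \<in> A" by (auto simp: A_def)
    then show False using Max_ge[OF fin, of m] \<open>m > Max A\<close> by simp
  qed
  show ?thesis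
  proof (rule that[of N "D * (2 - q)"])
    fix n :: nat assume n: "n \<ge> N"
    then have n0: "real n > 0" using N by simp
    have d: "2 * n - n * q > 0" using n0 pq by simp
    have "s1 n \<le> D / n" using E0[OF n] by (simp add: E_def)
    then have "\<phi> (n * q) - \<phi> (2 * n) \<le> D / n * (2 * n - n * q)"
      using d unfolding s1_def by (simp add: divide_le_eq)
    also have "\<dots> = D * (2 - q)" using n0 by (simp add: field_simps)
    finally show "\<phi> (n * q) - \<phi> (2 * n) \<le> D * (2 - q)" .
  qed
qed

text \<open>The hypothesis has ratio \<open>2 / q\<close> at integers, the conclusion ratio 2 at all
  reals. Half of the excess of \<open>2 / q\<close> over 1 is spent on rounding, and the remaining
  factor \<open>\<theta>\<close> is iterated until it exceeds 2. Below \<open>x0\<close>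
  monotonicity bounds \<open>V\<close> from both sides.\<close>

lemma doubling_from_ratio:
  fixes V :: "real \<Rightarrow> real" and N :: nat and q A :: real
  assumes anti: "\<And>x y. 0 \<le> x \<Longrightarrow> x \<le> y \<Longrightarrow> V y \<le> V x" and pos: "\<And>x. 0 \<le> x \<Longrightarrow> 0 < V x"
    and q: "1 < q" "q < 2" and A: "A \<ge> 0" and ratio: "\<And>n::nat. n \<ge> N \<Longrightarrow> V (n * q) \<le> A * V (2 * n)"
  obtains D where "D > 0" "\<And>x. 0 \<le> x \<Longrightarrow> V x \<le> D * V (2 * x)"
proof -
  define \<theta> where "\<theta> = (1 + 2 / q) / 2"
  have \<theta>: "1 < \<theta>" "\<theta> < 2 / q" using q by (auto simp: \<theta>_def field_simps)
  \<comment> \<open>The first bound makes the rounding of \<open>x / q\<close> harmless, the second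
    makes the rounded index at least \<open>N\<close>.\<close>
  define x0 where "x0 = max (2 / (2 / q - \<theta>)) (q * (real N + 1))"
  have x0: "x0 > 0"
  proof -
    have "q * (real N + 1) > 0" using q by simp
    then show ?thesis by (simp add: x0_def less_max_iff_disj)
  qed
  have step: "V x \<le> A * V (\<theta> * x)" if x: "x \<ge> x0" for x
  proof -
    have xp: "x > 0" using x x0 by simp
    define n where "n = nat \<lfloor>x / q\<rfloor>"
    have fl: "real n \<le> x / q" "x / q - 1 < real n" using xp q by (auto simp: n_def)
    have "q * (real N + 1) \<le> x" using x by (simp add: x0_def)
    then have "real N + 1 \<le> x / q" using q by (simp add: field_simps)
    then have N: "n \<ge> N" using fl by linarith
    have nq: "n * q \<le> x" using fl(1) q by (simp add: field_simps)
    have "2 / (2 / q - \<theta>) \<le> x" using x by (simp add: x0_def)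
    then have "2 \<le> x * (2 / q - \<theta>)" using \<theta> by (simp add: divide_le_eq)
    then have "\<theta> * x \<le> 2 * (x / q - 1)" by (simp add: algebra_simps)
    moreover have "a \<le> 2 * c" if "a \<le> 2 * b" "b < c" for a b c :: real using that by simp
    ultimately have n2: "\<theta> * x \<le> 2 * n" using fl(2) by (metis of_nat_mult of_nat_numeral)
    have "V x \<le> V (n * q)" using nq q by (intro anti) auto
    also have "\<dots> \<le> A * V (2 * n)" by (rule ratio[OF N])
    also have "\<dots> \<le> A * V (\<theta> * x)" using A n2 xp \<theta> by (intro mult_left_mono anti) auto
    finally show ?thesis .
  qed
  have iter: "V x \<le> A ^ k * V (\<theta> ^ k * x)" if x: "x \<ge> x0" for x k
  proof (induction k)
    case (Suc k)
    have "1 * x \<le> \<theta> ^ k * x" using \<theta> x x0 by (intro mult_right_mono one_le_power) auto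
    then have "V (\<theta> ^ k * x) \<le> A * V (\<theta> * (\<theta> ^ k * x))" using x by (intro step) simp
    then have "A ^ k * V (\<theta> ^ k * x) \<le> A ^ k * (A * V (\<theta> * (\<theta> ^ k * x)))"
      using A by (intro mult_left_mono) auto
    then show ?case using Suc by (simp add: mult_ac)
  qed simp
  obtain k where k: "2 < \<theta> ^ k" using real_arch_pow[OF \<theta>(1), of 2] by blast
  have big: "V x \<le> A ^ k * V (2 * x)" if "x \<ge> x0" for x
  proof -
    have "V x \<le> A ^ k * V (\<theta> ^ k * x)" by (rule iter[OF that])
    also have "\<dots> \<le> A ^ k * V (2 * x)" using k A x0 that by (intro mult_left_mono anti) auto
    finally show ?thesis .
  qed
  define B where "B = V 0 / V (2 * x0)"
  have B: "B > 0" unfolding B_def using pos[of 0] pos[of "2 * x0"] x0 by simp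
  have small: "V x \<le> B * V (2 * x)" if "0 \<le> x" "x \<le> x0" for x
  proof -
    have "V x \<le> V 0" by (rule anti) (use that in auto)
    also have "\<dots> = B * V (2 * x0)" using pos[of "2 * x0"] x0 by (simp add: B_def)
    also have "\<dots> \<le> B * V (2 * x)" using B that by (intro mult_left_mono anti) auto
    finally show ?thesis .
  qed
  show ?thesis
  proof (rule that[of "A ^ k + B"])
    show "A ^ k + B > 0" using A B by (simp add: add_nonneg_pos)
    fix x :: real assume x: "0 \<le> x"
    have "0 < V (2 * x)" using x by (intro pos) simp
    then have "A ^ k * V (2 * x) \<le> (A ^ k + B) * V (2 * x)" "B * V (2 * x) \<le> (A ^ k + B) * V (2 * x)"
      using A B by (auto intro!: mult_right_mono)
    then show "V x \<le> (A ^ k + B) * V (2 * x)"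
      using big[of x] small[of x] x by (cases "x \<ge> x0") (auto intro: order_trans)
  qed
qed

section \<open>Log-convexity of the moments and the test functions\<close>

context disk_weight
begin

lemma area_norm_powr:
  assumes "0 \<le> x"
  shows "integrable area (\<lambda>z. norm z powr x)" "(LINT z|area. norm z powr x) = moment x"
proof -
  show i: "integrable area (\<lambda>z. norm z powr x)"
    by (rule area.integrable_const_bound[of _ 1])
       (use AE_area assms in \<open>auto intro!: powr_le1\<close>)
  have "(LINT z|area. norm z powr x) = (LINT r|rad. \<bar>r\<bar> powr x)"
    unfolding area_integral(4)[OF i] by (simp add: norm_mult)
  also have "\<dots> = moment x" unfolding moment_def
    by (rule integral_cong_AE) (use AE_rad in auto)
  finally show "(LINT z|area. norm z powr x) = moment x" .
qed

text \<open>Hoelder's inequality with the exponents \<open>1 / (1 - u)\<close> and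
  \<open>1 / u\<close>.\<close>

lemma moment_log_convex: "convex_on {0..} (\<lambda>x. ln (moment x))"
proof (rule convex_onI)
  fix u x y :: real assume u: "0 < u" "u < 1" and xy: "x \<in> {0..}" "y \<in> {0..}"
  define p q where "p = 1 / (1 - u)" and "q = 1 / u"
  have pq: "p > 1" "1/p + 1/q = 1" using u by (auto simp: p_def q_def)
  have pos: "0 < moment x" "0 < moment y" using xy by (auto intro: moment_pos)
  have e1: "norm (r powr ((1 - u) * x)) powr p = r powr x" for r :: real
    using u by (simp add: p_def powr_powr)
  have e2: "norm (r powr (u * y)) powr q = r powr y" for r :: real
    using u by (simp add: q_def powr_powr)
  have e3: "norm (r powr ((1 - u) * x)) * norm (r powr (u * y)) = r powr ((1 - u) * x + u * y)" for r :: real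
    by (simp add: powr_add)
  have "(LINT r|rad. norm (r powr ((1 - u) * x)) * norm (r powr (u * y))) \<le>
      Lnorm rad p (\<lambda>r. r powr ((1 - u) * x)) * Lnorm rad q (\<lambda>r. r powr (u * y))"
    by (rule Holder_ineq[OF pq]) (simp_all only: e1 e2, use xy in \<open>auto intro: integrable_rad_powr\<close>)
  then have "moment ((1 - u) * x + u * y) \<le> moment x powr (1 - u) * moment y powr u"
    unfolding e3 Lnorm_def e1 e2 moment_def[symmetric] by (simp add: p_def q_def)
  then have "ln (moment ((1 - u) * x + u * y)) \<le> ln (moment x powr (1 - u) * moment y powr u)"
    using xy u pos by (subst ln_le_cancel_iff) (auto intro!: moment_pos)
  also have "\<dots> = (1 - u) * ln (moment x) + u * ln (moment y)"
    using pos by (simp add: ln_mult ln_powr)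
  finally show "ln (moment ((1 - u) *\<^sub>R x + u *\<^sub>R y)) \<le> (1 - u) * ln (moment x) + u * ln (moment y)" by simp
qed simp

lemma ln_moment_sublinear:
  assumes "\<epsilon> > 0"
  shows "\<exists>c. \<forall>x\<ge>0. - \<epsilon> * x - c \<le> ln (moment x)"
proof -
  \<comment> \<open>Then \<open>ln (r powr x) = - \<epsilon> * x\<close>, and the mass of
    \<open>{r..<1}\<close> supplies the constant.\<close>
  define r where "r = exp (- \<epsilon>)"
  have r: "0 < r" "r < 1" using assms by (auto simp: r_def)
  have m: "measure rad {r..<1} > 0" using rad_pos[of r] r by simp
  have "- \<epsilon> * x - (- ln (measure rad {r..<1})) \<le> ln (moment x)" if "x \<ge> 0" for x
  proof -
    have "ln (r powr x * measure rad {r..<1}) \<le> ln (moment x)"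
      using moment_ge[OF r that] r m moment_pos[OF that] by (subst ln_le_cancel_iff) auto
    then show ?thesis using r m by (simp add: ln_mult ln_powr) (simp add: r_def mult.commute)
  qed
  then show ?thesis by blast
qed

text \<open>Tests boundedness on \<open>r e\<^sup>i\<^sup>\<theta> \<mapsto> r\<^bsup>n(q-1)\<^esup> e\<^sup>i\<^sup>n\<^sup>\<theta>\<close>, the extremal of Hoelder's inequality for the pairing with \<open>z\<^sup>n\<close>.\<close>

lemma moment_three_point:
  assumes p: "p > 1" and pq: "1/p + 1/q = 1"
    and bdd: "\<And>f. \<lbrakk>f \<in> borel_measurable borel; integrable area (\<lambda>z. norm (f z) powr p)\<rbrakk> \<Longrightarrow>
      Lnorm area p (proj f) \<le> C * Lnorm area p f"
  shows "moment (n * q) powr (1/q) * moment (n * p) powr (1/p) \<le> C * moment (2 * real n)"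
proof -
  note q = conjugate_exponentD[OF p pq]
  \<comment> \<open>Makes \<open>norm (f z) powr p\<close> and the integrand
    \<open>r ^ n * r powr s\<close> of the \<open>n\<close>-th coefficient the same power, of
    exponent \<open>n * q\<close>.\<close>
  define s where "s = real n * (q - 1)"
  have s: "s \<ge> 0" using q(1) by (simp add: s_def)
  define f where "f = (\<lambda>z::complex. if z = 0 then 0 else (z / of_real (norm z)) ^ n * of_real (norm z powr s))"
  have [measurable]: "f \<in> borel_measurable borel" unfolding f_def by measurable
  have nf: "norm (f z) = norm z powr s" for z
    by (simp add: f_def norm_mult norm_power norm_divide)
  have nfp: "norm (f z) powr p = norm z powr (n * q)" for z
    unfolding nf powr_powr s_def using q(4) by (simp add: mult.assoc)
  have fp: "integrable area (\<lambda>z. norm (f z) powr p)"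
    unfolding nfp using q(1) by (intro area_norm_powr) simp
  have f: "integrable area f"
    using integrable_of_powr_integrable[OF area.finite_measure_axioms, of p f] p fp by simp
  have co: "coeff f j = (if j = n then of_real (moment (n * q)) else 0)" for j
  proof -
    have fe: "cnj (of_real r * cis t) ^ j * f (of_real r * cis t) = of_real (r ^ j * r powr s) * cis (of_int (int n - int j) * t)"
      if "r > 0" for r t
      using that by (simp add: f_def norm_mult power_mult_distrib cis_cnj Complex.DeMoivre cis_mult algebra_simps)
    have "coeff f j = (LINT r|rad. LINT t|circle_measure. cnj (of_real r * cis t) ^ j * f (of_real r * cis t))"
      unfolding coeff_def by (rule area_integral(4)[OF integrable_monomial_mult[OF f]])
    also have "\<dots> = (LINT r|rad. of_real (r ^ j * r powr s) * (if int n - int j = 0 then 1 else 0))"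
    proof (rule integral_cong_AE)
      show "AE r in rad. (LINT t|circle_measure. cnj (of_real r * cis t) ^ j * f (of_real r * cis t)) =
         of_real (r ^ j * r powr s) * (if int n - int j = 0 then 1 else 0)"
        using AE_rad
      proof eventually_elim
        case (elim r)
        show ?case unfolding fe[OF conjunct1[OF elim]]
          by (simp only: integral_mult_right_zero circle_character)
      qed
      show "(\<lambda>r. LINT t|circle_measure. cnj (of_real r * cis t) ^ j * f (of_real r * cis t)) \<in> borel_measurable rad"
        using borel_measurable_integrable[OF area_integral(3)[OF integrable_monomial_mult[OF f, of j]]] .
    qed measurable
    also have "\<dots> = (if j = n then of_real (moment (n * q)) else 0)"
    proof (cases "j = n")
      case True
      have "(LINT r|rad. complex_of_real (r ^ n * r powr s)) = of_real (LINT r|rad. r ^ n * r powr s)"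
        by (rule integral_complex_of_real)
      also have "(LINT r|rad. r ^ n * r powr s) = moment (n * q)"
        unfolding moment_def
      proof (rule integral_cong_AE)
        have "real n + s = n * q" by (simp add: s_def algebra_simps)
        then have "r ^ n * r powr s = r powr (n * q)" if "r > 0" for r :: real
          using that by (metis powr_add powr_realpow)
        then show "AE r in rad. r ^ n * r powr s = r powr (n * q)" using AE_rad by auto
      qed measurable
      finally show ?thesis using True by simp
    qed simp
    finally show ?thesis .
  qed
  have pr: "proj f z = of_real (moment (n * q) / moment (2 * real n)) * z ^ n" for z
  proof -
    have "(\<lambda>j. coeff f j / of_real (moment (2 * real j)) * z ^ j) =
        (\<lambda>j. if j = n then of_real (moment (n * q) / moment (2 * real n)) * z ^ n else 0)"
      by (auto simp: co)
    then show ?thesis unfolding proj_def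
      using sums_single[of n "\<lambda>_. of_real (moment (n * q) / moment (2 * real n)) * z ^ n"] by (simp add: sums_iff)
  qed
  have mp: "moment (n * q) > 0" "moment (2 * real n) > 0" "moment (n * p) > 0"
    using q(1) p by (auto intro!: moment_pos)
  define a where "a = moment (n * q) / moment (2 * real n)"
  have a: "a > 0" using mp by (simp add: a_def)
  have "(LINT z|area. norm (proj f z) powr p) = (LINT z|area. a powr p * norm z powr (n * p))"
  proof (rule integral_cong_AE)
    have ee: "norm (proj f z) powr p = a powr p * norm z powr (n * p)" if "z \<noteq> 0" for z
      unfolding pr a_def[symmetric] norm_mult norm_power using a that
      by (simp add: powr_mult powr_powr powr_realpow[symmetric])
    \<comment> \<open>For \<open>n = 0\<close> the two sides differ at the origin, since
      \<open>0 ^ 0 = 1\<close> but \<open>0 powr 0 = 0\<close>.\<close>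
    have "AE z in area. z \<noteq> 0"
    proof -
      have "AE z in lborel. z \<noteq> (0::complex)" by (rule AE_lborel_singleton)
      then show ?thesis unfolding area_def by (subst AE_density) auto
    qed
    then show "AE z in area. norm (proj f z) powr p = a powr p * norm z powr (n * p)"
      by eventually_elim (rule ee)
  qed measurable
  also have "\<dots> = a powr p * moment (n * p)"
    using area_norm_powr(2)[of "n * p"] p by simp
  finally have "Lnorm area p (proj f) = (a powr p * moment (n * p)) powr (1/p)"
    unfolding Lnorm_def by simp
  also have "\<dots> = a * moment (n * p) powr (1/p)"
    using a mp p by (simp add: powr_mult powr_powr)
  finally have "a * moment (n * p) powr (1/p) \<le> C * Lnorm area p f"
    using bdd[OF _ fp] by simp
  also have "Lnorm area p f = moment (n * q) powr (1/p)"
    unfolding Lnorm_def nfp using area_norm_powr(2)[of "n * q"] q(1) by simp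
  finally have "moment (n * q) * moment (n * p) powr (1/p) \<le> (C * moment (2 * real n)) * moment (n * q) powr (1/p)"
    using mp by (simp add: a_def field_simps)
  moreover have eq: "moment (n * q) powr (1/q) * moment (n * q) powr (1/p) = moment (n * q)"
    using mp pq by (simp add: add.commute flip: powr_add)
  have "(moment (n * q) powr (1/q) * moment (n * p) powr (1/p)) * moment (n * q) powr (1/p)
      = (moment (n * q) powr (1/q) * moment (n * q) powr (1/p)) * moment (n * p) powr (1/p)"
    by (simp only: mult_ac)
  then have "(moment (n * q) powr (1/q) * moment (n * p) powr (1/p)) * moment (n * q) powr (1/p)
      = moment (n * q) * moment (n * p) powr (1/p)"
    by (simp only: eq)
  ultimately have "(moment (n * q) powr (1/q) * moment (n * p) powr (1/p)) * moment (n * q) powr (1/p)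
      \<le> (C * moment (2 * real n)) * moment (n * q) powr (1/p)"
    by (simp only:)
  then show ?thesis using mp by simp
qed

lemma doubling_from_three_point:
  fixes p q C :: real
  assumes p: "p > 2" and pq: "1/p + 1/q = 1"
    and three: "\<And>n::nat. moment (n * q) powr (1/q) * moment (n * p) powr (1/p) \<le> C * moment (2 * real n)"
  obtains D where "D > 0" "\<And>x. 0 \<le> x \<Longrightarrow> moment x \<le> D * moment (2 * x)"
proof -
  have p1: "p > 1" using p by simp
  note q = conjugate_exponentD[OF p1 pq]
  have q2: "q < 2" unfolding q(2) using p by (simp add: divide_less_eq)
  have mp: "moment (real n * q) > 0" "moment (2 * real n) > 0" "moment (real n * p) > 0" for n :: nat
    using q(1) p by (auto intro!: moment_pos)
  \<comment> \<open>The instance \<open>n = 0\<close> forces a positive constant, so its logarithm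
    can be used.\<close>
  have C: "C > 0"
  proof -
    have "0 < C * moment (2 * real 0)"
      using three[of 0] mp[of 0] by (intro less_le_trans[OF _ three[of 0]] mult_pos_pos) auto
    then show ?thesis using mp(2)[of 0] by (simp add: zero_less_mult_iff)
  qed
  obtain D and N :: nat where DN: "\<And>n::nat. n \<ge> N \<Longrightarrow> ln (moment (n * q)) - ln (moment (2 * n)) \<le> D"
  proof (rule convex_three_point_bound[OF moment_log_convex _ ln_moment_sublinear p q(1) q2 pq, where c = "ln C"])
    show "ln (moment y) \<le> ln (moment x)" if "0 \<le> x" "x \<le> y" for x y
      using that by (subst ln_le_cancel_iff) (auto intro!: moment_pos moment_antimono)
    fix n :: nat
    have "ln (moment (n * q) powr (1/q) * moment (n * p) powr (1/p)) \<le> ln (C * moment (2 * real n))"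
      using three[of n] mp[of n] C by (subst ln_le_cancel_iff) auto
    then show "ln (moment (real n * q)) / q + ln (moment (real n * p)) / p - ln (moment (real (2 * n))) \<le> ln C"
      using mp[of n] C by (simp add: ln_mult ln_powr)
  qed (auto intro: that)
  have ratio: "moment (n * q) \<le> exp D * moment (2 * n)" if "n \<ge> N" for n :: nat
  proof -
    have "ln (moment (n * q)) \<le> D + ln (moment (2 * n))" using DN[OF that] by simp
    then have "exp (ln (moment (n * q))) \<le> exp (D + ln (moment (2 * n)))" by simp
    then show ?thesis using mp[of n] by (simp add: exp_add)
  qed
  show ?thesis
    by (rule doubling_from_ratio[OF moment_antimono moment_pos q(1) q2 _ ratio that]) auto
qed

text \<open>The three-point inequality is symmetric in the conjugate exponents, one of which exceeds
  2 unless both equal 2; in that case its two sides are multiples of the same moment and it says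
  nothing about doubling.\<close>

lemma doubling_of_bounded:
  fixes p C :: real
  assumes p: "p > 1" "p \<noteq> 2"
    and bdd: "\<And>f. \<lbrakk>f \<in> borel_measurable borel; integrable area (\<lambda>z. norm (f z) powr p)\<rbrakk> \<Longrightarrow>
      Lnorm area p (proj f) \<le> C * Lnorm area p f"
  obtains D where "D > 0" "\<And>x. 0 \<le> x \<Longrightarrow> moment x \<le> D * moment (2 * x)"
proof -
  define q where "q = p / (p - 1)"
  have pq: "1/p + 1/q = 1" using p by (simp add: q_def field_simps)
  note q = conjugate_exponentD[OF p(1) pq]
  have three: "moment (real n * q) powr (1/q) * moment (real n * p) powr (1/p) \<le> C * moment (2 * real n)" for n
    by (rule moment_three_point[OF p(1) pq]) (rule bdd)
  show ?thesis
  proof (cases "p > 2")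
    case True
    show ?thesis by (rule doubling_from_three_point[OF True pq three that])
  next
    case False
    then have q2: "q > 2" using p unfolding q(2) by (simp add: less_divide_eq)
    have qp: "1/q + 1/p = 1" using pq by simp
    have "moment (real n * p) powr (1/p) * moment (real n * q) powr (1/q) \<le> C * moment (2 * real n)" for n
      using three[of n] by (simp add: mult.commute)
    from doubling_from_three_point[OF q2 qp this that] show ?thesis .
  qed
qed

end

section \<open>Doubling moments imply boundedness\<close>

text \<open>The tangent of the convex power at \<open>a + x\<close>. With
  \<open>t = a / (a + x)\<close> it reads \<open>s * t \<le> t powr s + s - 1\<close>, which is
  Young's inequality with second factor 1.\<close>

lemma powr_increment_le:
  fixes a x s :: real
  assumes "0 \<le> a" "0 \<le> x" "s > 1"
  shows "(a + x) powr s - a powr s \<le> s * x * (a + x) powr (s - 1)"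
proof (cases "a + x = 0")
  case False
  then have y: "a + x > 0" using assms by simp
  define t where "t = a / (a + x)"
  have t: "t \<ge> 0" using assms y by (simp add: t_def)
  define s' where "s' = s / (s - 1)"
  have ss: "1/s + 1/s' = 1" using assms by (simp add: s'_def field_simps)
  have "t * 1 \<le> t powr s / s + 1 powr s' / s'"
    by (rule Youngs_inequality[OF assms(3) conjugate_exponentD(1)[OF assms(3) ss] ss t]) simp
  then have "t \<le> t powr s / s + (1 - 1/s)" using ss by simp
  then have "s * t \<le> s * (t powr s / s + (1 - 1/s))" using assms by (intro mult_left_mono) auto
  also have "\<dots> = t powr s + (s - 1)" using assms by (simp add: field_simps)
  finally have "s * t \<le> t powr s + (s - 1)" .
  then have "(a + x) powr s * (1 - t powr s) \<le> (a + x) powr s * (s * (1 - t))"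
    by (intro mult_left_mono) (auto simp: algebra_simps)
  moreover have "(a + x) powr s * t powr s = a powr s"
    using y assms by (simp add: t_def powr_divide)
  moreover have "(a + x) powr s * (s * (1 - t)) = s * x * (a + x) powr (s - 1)"
  proof -
    have "(a + x) powr s = (a + x) * (a + x) powr (s - 1)"
      using powr_mult_base[of "a + x" "s - 1"] y by simp
    moreover have "(a + x) * (1 - t) = x" using y by (simp add: t_def field_simps)
    ultimately show ?thesis by (metis mult.assoc mult.commute)
  qed
  ultimately show ?thesis by (simp add: algebra_simps)
qed (use assms in auto)

text \<open>Telescopes the increments of the \<open>s\<close>-th power of the partial sums. It
  replaces a full expansion of the power by terms in which index \<open>n\<close> meets only indices
  up to \<open>n\<close>.\<close>

lemma sum_powr_le:
  fixes x :: "nat \<Rightarrow> real"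
  assumes "\<And>n. 0 \<le> x n" "s > 1"
  shows "(\<Sum>n<N. x n) powr s \<le> s * (\<Sum>n<N. x n * (\<Sum>k<Suc n. x k) powr (s - 1))"
proof (induction N)
  case (Suc N)
  have "(\<Sum>n<Suc N. x n) powr s \<le> (\<Sum>n<N. x n) powr s + s * x N * (\<Sum>n<Suc N. x n) powr (s - 1)"
    using powr_increment_le[of "\<Sum>n<N. x n" "x N" s] assms by (simp add: sum_nonneg)
  then show ?case using Suc by (simp add: algebra_simps)
qed (use assms in simp)

text \<open>Splitting the last summand off each partial sum reproduces the left side, shifted by one
  index and hence divided by \<open>K\<close>. As \<open>2 powr s / K \<le> 1 / 2\<close>, the
  shifted copy is absorbed and only the factor 2 remains.\<close>

lemma geometric_Hardy:
  fixes b :: "nat \<Rightarrow> real"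
  assumes b: "\<And>n. 0 \<le> b n" and s: "s > 0" and K: "K \<ge> 2 * 2 powr s"
  shows "(\<Sum>n<N. (\<Sum>k<Suc n. b k) powr s / K ^ n) \<le> 2 * 2 powr s * (\<Sum>n<N. b n powr s / K ^ n)"
proof -
  have K0: "K > 0" using K powr_gt_zero[of 2 s] by linarith
  define B where "B = (\<lambda>n. \<Sum>k<n. b k)"
  have B0: "B n \<ge> 0" for n using b by (simp add: B_def sum_nonneg)
  define T where "T = (\<Sum>n<N. B (Suc n) powr s / K ^ n)"
  have "T \<le> (\<Sum>n<N. 2 powr s * (B n powr s + b n powr s) / K ^ n)"
    unfolding T_def
  proof (intro sum_mono divide_right_mono)
    fix n
    show "B (Suc n) powr s \<le> 2 powr s * (B n powr s + b n powr s)"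
      using norm_add_powr_le[OF s, of "B n" "b n"] B0[of n] b[of n] B0[of "Suc n"] by (simp add: B_def)
  qed (use K0 in simp)
  also have "\<dots> = 2 powr s * (\<Sum>n<N. B n powr s / K ^ n) + 2 powr s * (\<Sum>n<N. b n powr s / K ^ n)"
    by (simp add: sum_distrib_left sum.distrib[symmetric] algebra_simps add_divide_distrib)
  also have "(\<Sum>n<N. B n powr s / K ^ n) \<le> T / K"
  proof (cases N)
    case (Suc m)
    have "(\<Sum>n<N. B n powr s / K ^ n) = (\<Sum>n<m. B (Suc n) powr s / K ^ n) / K"
      unfolding Suc sum.lessThan_Suc_shift
      by (simp add: B_def sum_divide_distrib mult.commute)
    also have "\<dots> \<le> T / K"
      unfolding T_def Suc using K0 by (intro divide_right_mono) auto
    finally show ?thesis .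
  qed (simp add: T_def)
  also have "2 powr s * (T / K) \<le> T / 2"
  proof -
    have T0: "T \<ge> 0" unfolding T_def using K0 by (intro sum_nonneg) auto
    have "2 powr s / K \<le> 1 / 2" using K K0 by (simp add: divide_le_eq)
    then have "(2 powr s / K) * T \<le> (1 / 2) * T" using T0 by (rule mult_right_mono)
    then show ?thesis by simp
  qed
  finally have "T \<le> 2 * 2 powr s * (\<Sum>n<N. b n powr s / K ^ n)" by simp
  then show ?thesis by (simp add: T_def B_def)
qed

lemma Holder_sum:
  fixes a b c :: "nat \<Rightarrow> real"
  assumes pq: "p > 1" "1/p + 1/q = 1" and nn: "\<And>n. 0 \<le> a n" "\<And>n. 0 \<le> b n" "\<And>n. 0 \<le> c n"
  shows "(\<Sum>n<N. c n * (a n * b n)) \<le> (\<Sum>n<N. c n * a n powr p) powr (1/p) * (\<Sum>n<N. c n * b n powr q) powr (1/q)"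
proof -
  define M where "M = point_measure {..<N} c"
  have I: "(LINT n|M. f n) = (\<Sum>n<N. c n * f n)" for f :: "nat \<Rightarrow> real"
    unfolding M_def using lebesgue_integral_point_measure_finite[of "{..<N}" c f] nn(3) by simp
  have i: "integrable M f" for f :: "nat \<Rightarrow> real"
    unfolding M_def by (rule integrable_point_measure_finite) simp
  have m: "f \<in> borel_measurable M" for f :: "nat \<Rightarrow> real"
    by (rule borel_measurable_integrable[OF i])
  show ?thesis
    using Holder_ineq[OF pq m m i i, of a b] nn unfolding Lnorm_def I by simp
qed

text \<open>Abel summation against the partial sums of \<open>x\<close>.\<close>

lemma norm_sum_mult_le:
  fixes x :: "nat \<Rightarrow> complex" and d :: "nat \<Rightarrow> real"
  assumes P: "\<And>c. norm (\<Sum>n\<in>{a..<c}. x n) \<le> L" and "a \<le> b"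
  shows "norm (\<Sum>n\<in>{a..<Suc b}. of_real (d n) * x n) \<le> L * (\<bar>d b\<bar> + (\<Sum>n\<in>{a..<b}. \<bar>d (Suc n) - d n\<bar>))"
proof -
  define S where "S = (\<lambda>c. \<Sum>n\<in>{a..<c}. x n)"
  have PS: "norm (S c) \<le> L" for c unfolding S_def by (rule P)
  have "(\<Sum>n\<in>{a..<Suc b}. of_real (d n) * x n) = of_real (d b) * S (Suc b) - (\<Sum>n\<in>{a..<b}. of_real (d (Suc n) - d n) * S (Suc n))"
    using \<open>a \<le> b\<close>
  proof (induction b rule: dec_induct)
    case base
    then show ?case by (simp add: S_def)
  next
    case (step b)
    have "S (Suc (Suc b)) = S (Suc b) + x (Suc b)" using step by (simp add: S_def)
    then show ?case using step by (simp add: algebra_simps)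
  qed
  also have "norm \<dots> \<le> norm (of_real (d b) * S (Suc b)) + (\<Sum>n\<in>{a..<b}. norm (of_real (d (Suc n) - d n) * S (Suc n)))"
    by (rule order_trans[OF norm_triangle_ineq4 add_left_mono[OF norm_sum]])
  also have "\<dots> \<le> \<bar>d b\<bar> * L + (\<Sum>n\<in>{a..<b}. \<bar>d (Suc n) - d n\<bar> * L)"
    unfolding norm_mult norm_of_real by (intro add_mono sum_mono mult_left_mono PS) auto
  finally show ?thesis by (simp add: sum_distrib_left algebra_simps)
qed

text \<open>The last product is at most \<open>u a * v b\<close>, and the variation of the product
  of a decreasing and an increasing sequence is at most twice that; together they give the 3. The
  application has \<open>u\<close> the powers of a product of radii and \<open>v\<close> the
  reciprocal moments.\<close>

lemma norm_sum_monotone_mult_le: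
  fixes x :: "nat \<Rightarrow> complex" and u v :: "nat \<Rightarrow> real"
  assumes P: "\<And>c. norm (\<Sum>n\<in>{a..<c}. x n) \<le> L" and ab: "a \<le> b"
    and u: "\<And>n. u (Suc n) \<le> u n" "\<And>n. 0 \<le> u n" and v: "\<And>n. v n \<le> v (Suc n)" "\<And>n. 0 \<le> v n"
  shows "norm (\<Sum>n\<in>{a..<Suc b}. of_real (u n * v n) * x n) \<le> 3 * (u a * v b) * L"
proof -
  have L: "L \<ge> 0" using P[of a] by simp
  have ua: "u n \<le> u a" if "a \<le> n" for n using lift_Suc_antimono_le[of u, OF u(1) that] .
  have vb: "v n \<le> v b" if "n \<le> b" for n using lift_Suc_mono_le[of v, OF v(1) that] .
  have tele: "\<bar>u (Suc n) * v (Suc n) - u n * v n\<bar> \<le> v b * (u n - u (Suc n)) + u a * (v (Suc n) - v n)"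
    if n: "n \<in> {a..<b}" for n
  proof -
    have "\<bar>u (Suc n) * v (Suc n) - u n * v n\<bar> = \<bar>u (Suc n) * (v (Suc n) - v n) - v n * (u n - u (Suc n))\<bar>"
      by (simp add: algebra_simps)
    also have "\<dots> \<le> u (Suc n) * (v (Suc n) - v n) + v n * (u n - u (Suc n))"
      using u v by (intro order_trans[OF abs_triangle_ineq4]) (simp add: abs_mult)
    also have "\<dots> \<le> u a * (v (Suc n) - v n) + v b * (u n - u (Suc n))"
      using u(1) v(1) ua[of "Suc n"] vb[of n] n by (intro add_mono mult_right_mono) auto
    finally show ?thesis by simp
  qed
  have "(\<Sum>n\<in>{a..<b}. \<bar>u (Suc n) * v (Suc n) - u n * v n\<bar>) \<le>
      (\<Sum>n\<in>{a..<b}. v b * (u n - u (Suc n)) + u a * (v (Suc n) - v n))"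
    by (intro sum_mono tele)
  also have "\<dots> = v b * (u a - u b) + u a * (v b - v a)"
    using ab sum_Suc_diff'[of a b u] sum_Suc_diff'[of a b v]
    by (simp add: sum.distrib sum_distrib_left[symmetric] sum_subtractf)
  also have "\<dots> \<le> 2 * (u a * v b)"
    using mult_nonneg_nonneg[OF v(2)[of b] u(2)[of b]] mult_nonneg_nonneg[OF u(2)[of a] v(2)[of a]]
    by (simp add: algebra_simps)
  finally have 1: "(\<Sum>n\<in>{a..<b}. \<bar>u (Suc n) * v (Suc n) - u n * v n\<bar>) \<le> 2 * (u a * v b)" .
  have 2: "\<bar>u b * v b\<bar> \<le> u a * v b"
    using u(2)[of b] v(2)[of b] ua[OF ab] by (simp add: abs_mult mult_right_mono)
  have "norm (\<Sum>n\<in>{a..<Suc b}. of_real (u n * v n) * x n) \<le>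
      L * (\<bar>u b * v b\<bar> + (\<Sum>n\<in>{a..<b}. \<bar>u (Suc n) * v (Suc n) - u n * v n\<bar>))"
    by (rule norm_sum_mult_le[OF P ab])
  also have "\<dots> \<le> L * (u a * v b + 2 * (u a * v b))"
    using 1 2 L by (intro mult_left_mono add_mono) auto
  finally show ?thesis by (simp add: algebra_simps)
qed

section \<open>Lacunary series in the radius\<close>

context disk_weight
begin

lemma moment_tendsto_0: "(\<lambda>j. moment (2 * real j)) \<longlonglongrightarrow> 0"
proof -
  have "(\<lambda>j. LINT r|rad. r powr (2 * real j)) \<longlonglongrightarrow> (LINT r|rad. 0)"
  proof (rule integral_dominated_convergence[where w = "\<lambda>_. 1"])
    show "AE r in rad. (\<lambda>j. r powr (2 * real j)) \<longlonglongrightarrow> 0"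
      using AE_rad
    proof eventually_elim
      case (elim r)
      have "r powr (2 * real j) = (r\<^sup>2) ^ j" for j
        using elim powr_realpow[of r "2 * j"] by (simp add: power_mult)
      moreover have "r\<^sup>2 < 1" using elim by (simp add: power_less_one_iff abs_square_less_1)
      ultimately show ?case by (simp add: LIMSEQ_power_zero)
    qed
    show "AE r in rad. norm (r powr (2 * real j)) \<le> 1" for j
      using AE_rad by eventually_elim (auto intro!: powr_le1)
  qed auto
  then show ?thesis by (simp add: moment_def)
qed

text \<open>In the bound of \<open>sum_powr_le\<close> the powers of \<open>r\<close> with earlier
  indices are estimated by 1, leaving one factor \<open>r ^ M n\<close> in each term. Its integral
  is a moment of size \<open>A / K ^ n\<close>, and Hardy's inequality sums the rest.\<close>

lemma lacunary_synthesis: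
  fixes b :: "nat \<Rightarrow> real" and M :: "nat \<Rightarrow> nat"
  assumes b: "\<And>n. 0 \<le> b n" and s: "s > 1" and K: "K \<ge> 2 * 2 powr s" and A: "A \<ge> 0"
    and M: "\<And>n. moment (real (M n)) \<le> A / K ^ n"
  shows "integrable rad (\<lambda>r. (\<Sum>n<N. b n * r ^ M n) powr s)"
    and "(LINT r|rad. (\<Sum>n<N. b n * r ^ M n) powr s) \<le> s * A * (2 * 2 powr s) * (\<Sum>n<N. b n powr s / K ^ n)"
proof -
  define B where "B = (\<lambda>n. \<Sum>k<n. b k)"
  have B0: "B n \<ge> 0" for n using b by (simp add: B_def sum_nonneg)
  have K0: "K > 0" using K powr_gt_zero[of 2 s] by linarith
  have ir: "integrable rad (\<lambda>r. r ^ k)" for k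
    by (rule rad.integrable_const_bound[of _ 1]) (use AE_rad in \<open>auto intro!: power_le_one simp: power_abs\<close>)
  have le: "(\<Sum>n<N. b n * r ^ M n) powr s \<le> s * (\<Sum>n<N. B (Suc n) powr s * r ^ M n)" if r: "0 < r" "r < 1" for r
  proof -
    have xn: "0 \<le> b n * r ^ M n" for n using b r by simp
    have "(\<Sum>n<N. b n * r ^ M n) powr s \<le> s * (\<Sum>n<N. b n * r ^ M n * (\<Sum>k<Suc n. b k * r ^ M k) powr (s - 1))"
      by (rule sum_powr_le[OF xn s])
    also have "\<dots> \<le> s * (\<Sum>n<N. B (Suc n) powr s * r ^ M n)"
    proof (intro mult_left_mono sum_mono)
      fix n
      have "(\<Sum>k<Suc n. b k * r ^ M k) \<le> B (Suc n)"
        unfolding B_def using b r by (intro sum_mono mult_right_le_one_le) (auto intro!: power_le_one)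
      moreover have "b n \<le> B (Suc n)" using b B0[of n] by (simp add: B_def)
      moreover have "0 \<le> (\<Sum>k<Suc n. b k * r ^ M k)" using xn by (intro sum_nonneg) auto
      ultimately have "b n * (\<Sum>k<Suc n. b k * r ^ M k) powr (s - 1) \<le> B (Suc n) * B (Suc n) powr (s - 1)"
        using s b B0 by (intro mult_mono powr_mono2) auto
      also have "\<dots> = B (Suc n) powr s" using powr_mult_base[OF B0, of "Suc n" "s - 1"] by simp
      finally have "b n * (\<Sum>k<Suc n. b k * r ^ M k) powr (s - 1) * r ^ M n \<le> B (Suc n) powr s * r ^ M n"
        using r by (intro mult_right_mono) auto
      then show "b n * r ^ M n * (\<Sum>k<Suc n. b k * r ^ M k) powr (s - 1) \<le> B (Suc n) powr s * r ^ M n"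
        by (simp only: mult_ac)
    qed (use s in simp)
    finally show ?thesis .
  qed
  have i2: "integrable rad (\<lambda>r. s * (\<Sum>n<N. B (Suc n) powr s * r ^ M n))"
    using ir by auto
  have ae: "AE r in rad. (\<Sum>n<N. b n * r ^ M n) powr s \<le> s * (\<Sum>n<N. B (Suc n) powr s * r ^ M n)"
    using AE_rad by eventually_elim (use le in blast)
  show i1: "integrable rad (\<lambda>r. (\<Sum>n<N. b n * r ^ M n) powr s)"
    by (rule Bochner_Integration.integrable_bound[OF i2])
       (use ae in \<open>auto elim!: eventually_mono intro: order_trans[OF _ abs_ge_self]\<close>)
  have "(LINT r|rad. (\<Sum>n<N. b n * r ^ M n) powr s) \<le> (LINT r|rad. s * (\<Sum>n<N. B (Suc n) powr s * r ^ M n))"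
    by (rule integral_mono_AE[OF i1 i2 ae])
  also have "\<dots> = s * (\<Sum>n<N. B (Suc n) powr s * moment (real (M n)))"
    using ir by (simp add: moment_nat)
  also have "\<dots> \<le> s * (\<Sum>n<N. B (Suc n) powr s * (A / K ^ n))"
    using s by (intro mult_left_mono sum_mono M) auto
  also have "\<dots> = s * A * (\<Sum>n<N. B (Suc n) powr s / K ^ n)"
    by (simp add: sum_distrib_left mult_ac)
  also have "\<dots> \<le> s * A * (2 * 2 powr s * (\<Sum>n<N. b n powr s / K ^ n))"
    unfolding B_def using s A by (intro mult_left_mono geometric_Hardy b K) auto
  finally show "(LINT r|rad. (\<Sum>n<N. b n * r ^ M n) powr s) \<le> s * A * (2 * 2 powr s) * (\<Sum>n<N. b n powr s / K ^ n)"
    by (simp add: mult_ac)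
qed

text \<open>The adjoint of \<open>lacunary_synthesis\<close> in the conjugate exponent: the sequence
  is paired with its own extremal, which synthesizes to \<open>G\<close>. The sum \<open>X\<close>
  is finite, so it can be divided out.\<close>

lemma lacunary_analysis:
  fixes M :: "nat \<Rightarrow> nat" and \<phi> :: "real \<Rightarrow> real"
  assumes s: "s > 1" and st: "1/s + 1/t = 1" and K: "K \<ge> 2 * 2 powr s" and A: "A \<ge> 0"
    and M: "\<And>n. moment (real (M n)) \<le> A / K ^ n"
    and [measurable]: "\<phi> \<in> borel_measurable borel" and \<phi>: "\<And>r. 0 \<le> \<phi> r" "integrable rad (\<lambda>r. \<phi> r powr t)"
  shows "(\<Sum>n<N. (1 / K ^ n) * (K ^ n * (LINT r|rad. r ^ M n * \<phi> r)) powr t) powr (1/t) \<le>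
    (s * A * (2 * 2 powr s)) powr (1/s) * Lnorm rad t \<phi>"
proof -
  note t = conjugate_exponentD[OF s st]
  have ts: "1/t + 1/s = 1" using st by simp
  have K0: "K > 0" using K powr_gt_zero[of 2 s] by linarith
  have i1: "integrable rad \<phi>"
    using integrable_of_powr_integrable[OF rad.finite_measure_axioms, of t \<phi>] t(1) \<phi> by simp
  have iM: "integrable rad (\<lambda>r. r ^ k * \<phi> r)" for k
  proof (rule Bochner_Integration.integrable_bound[OF i1])
    show "AE r in rad. norm (r ^ k * \<phi> r) \<le> norm (\<phi> r)"
      using AE_rad by eventually_elim (auto simp: abs_mult power_abs intro!: mult_left_le_one_le power_le_one)
  qed measurable
  define a where "a = (\<lambda>n. K ^ n * (LINT r|rad. r ^ M n * \<phi> r))"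
  have a0: "a n \<ge> 0" for n
    unfolding a_def using K0 AE_rad \<phi>(1)
    by (intro mult_nonneg_nonneg integral_nonneg_AE) (auto elim!: eventually_mono)
  \<comment> \<open>The equality case of Hoelder's inequality for the sequence
    \<open>a\<close>.\<close>
  define b where "b = (\<lambda>n. a n powr (t - 1))"
  have bs: "b n powr s = a n powr t" for n unfolding b_def powr_powr using t(4) by simp
  define X where "X = (\<Sum>n<N. (1 / K ^ n) * a n powr t)"
  have X0: "X \<ge> 0" unfolding X_def using K0 by (intro sum_nonneg) auto
  define G where "G = (\<lambda>r. \<Sum>n<N. b n * r ^ M n)"
  have [measurable]: "G \<in> borel_measurable borel" unfolding G_def by measurable
  have b0: "b n \<ge> 0" for n by (simp add: b_def)
  note syn = lacunary_synthesis[where N = N, OF b0 s K A M]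
  have G0: "AE r in rad. 0 \<le> G r"
    using AE_rad by eventually_elim (auto simp: G_def b0 intro!: sum_nonneg)
  have Gs: "integrable rad (\<lambda>r. norm (G r) powr s)"
    "(LINT r|rad. norm (G r) powr s) \<le> s * A * (2 * 2 powr s) * X"
  proof -
    have ae: "AE r in rad. norm (G r) powr s = (\<Sum>n<N. b n * r ^ M n) powr s"
      using G0 by eventually_elim (simp add: G_def)
    show "integrable rad (\<lambda>r. norm (G r) powr s)"
      using syn(1) by (subst integrable_cong_AE[OF _ _ ae]) auto
    have "(LINT r|rad. norm (G r) powr s) = (LINT r|rad. (\<Sum>n<N. b n * r ^ M n) powr s)"
      by (rule integral_cong_AE[OF _ _ ae]) auto
    then show "(LINT r|rad. norm (G r) powr s) \<le> s * A * (2 * 2 powr s) * X"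
      using syn(2) unfolding bs X_def by simp
  qed
  have "X = (\<Sum>n<N. b n * (LINT r|rad. r ^ M n * \<phi> r))"
    unfolding X_def
  proof (intro sum.cong refl)
    fix n
    have "a n powr t = a n * b n" using powr_mult_base[OF a0, of n "t - 1"] by (simp add: b_def)
    then show "1 / K ^ n * a n powr t = b n * (LINT r|rad. r ^ M n * \<phi> r)" using K0 by (simp add: a_def)
  qed
  also have "\<dots> = (LINT r|rad. G r * \<phi> r)"
    unfolding G_def sum_distrib_right using iM by (simp add: mult.assoc)
  also have "\<dots> \<le> (LINT r|rad. norm (\<phi> r) * norm (G r))"
  proof (rule integral_mono_AE)
    show ii: "integrable rad (\<lambda>r. norm (\<phi> r) * norm (G r))"
      by (rule integrable_Holder[OF t(1) ts _ _ _ Gs(1)]) (use \<phi> in auto)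
    show "integrable rad (\<lambda>r. G r * \<phi> r)"
      by (rule Bochner_Integration.integrable_bound[OF ii]) (auto simp: abs_mult)
    show "AE r in rad. G r * \<phi> r \<le> norm (\<phi> r) * norm (G r)"
      by (auto intro!: AE_I2 simp: mult.commute abs_mult[symmetric])
  qed
  also have "\<dots> \<le> Lnorm rad t \<phi> * Lnorm rad s G"
    by (rule Holder_ineq[OF t(1) ts _ _ _ Gs(1)]) (use \<phi> in auto)
  also have "Lnorm rad s G \<le> (s * A * (2 * 2 powr s) * X) powr (1/s)"
    unfolding Lnorm_def using s Gs(2) by (intro powr_mono2) (auto intro!: integral_nonneg_AE)
  also have "\<dots> = (s * A * (2 * 2 powr s)) powr (1/s) * X powr (1/s)"
    using s A X0 by (simp add: powr_mult)
  finally have *: "X \<le> Lnorm rad t \<phi> * ((s * A * (2 * 2 powr s)) powr (1/s) * X powr (1/s))"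
    by (simp add: mult_left_mono)
  have "X powr (1/t) \<le> (s * A * (2 * 2 powr s)) powr (1/s) * Lnorm rad t \<phi>"
  proof (cases "X = 0")
    case False
    then have Xp: "X > 0" using X0 by simp
    have "X powr (1/t) * X powr (1/s) = X" using Xp ts by (simp flip: powr_add)
    then have "X powr (1/t) * X powr (1/s) \<le> ((s * A * (2 * 2 powr s)) powr (1/s) * Lnorm rad t \<phi>) * X powr (1/s)"
      using * by (simp add: mult_ac)
    then show ?thesis using Xp by simp
  qed simp
  then show ?thesis by (simp add: X_def a_def)
qed


section \<open>Circle slices and blocks of frequencies\<close>

definition slice_norm :: "real \<Rightarrow> (complex \<Rightarrow> complex) \<Rightarrow> real \<Rightarrow> real" where
  "slice_norm p f r = Lnorm circle_measure p (\<lambda>t. f (of_real r * cis t))"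

lemma slice_norm:
  assumes p: "p > 1" and [measurable]: "f \<in> borel_measurable borel"
    and f: "integrable area (\<lambda>z. norm (f z) powr p)"
  shows "slice_norm p f \<in> borel_measurable borel" and "0 \<le> slice_norm p f r"
    and "integrable rad (\<lambda>r. slice_norm p f r powr p)"
    and "Lnorm rad p (slice_norm p f) = Lnorm area p f"
    and "integrable rad (slice_norm p f)"
proof -
  have e: "slice_norm p f r powr p = (LINT t|circle_measure. norm (f (of_real r * cis t)) powr p)" for r
    unfolding slice_norm_def using p by (intro Lnorm_powr) simp
  note ai = area_integral[OF f]
  show i: "integrable rad (\<lambda>r. slice_norm p f r powr p)" unfolding e by (rule ai(3))
  have "(\<lambda>r. LINT t|circle_measure. norm (f (of_real r * cis t)) powr p) \<in> borel_measurable borel"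
    using borel_measurable_integrable[OF ai(3)] by simp
  then show m [measurable]: "slice_norm p f \<in> borel_measurable borel"
    unfolding slice_norm_def Lnorm_def by measurable
  show nn: "0 \<le> slice_norm p f r" for r by (simp add: slice_norm_def)
  show "Lnorm rad p (slice_norm p f) = Lnorm area p f"
    unfolding Lnorm_def[of rad] Lnorm_def[of area] ai(4) using nn by (simp add: e)
  show "integrable rad (slice_norm p f)"
    using integrable_of_powr_integrable[OF rad.finite_measure_axioms, of p "slice_norm p f"] p i nn by simp
qed

lemma coeff_fourier:
  assumes "integrable area f"
  shows "integrable rad (\<lambda>r. of_real (r ^ j) * fourier_coeff (\<lambda>t. f (of_real r * cis t)) j)"
    and "coeff f j = (LINT r|rad. of_real (r ^ j) * fourier_coeff (\<lambda>t. f (of_real r * cis t)) j)"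
proof -
  note ai = area_integral[OF integrable_monomial_mult[OF assms, of j]]
  have e: "(LINT t|circle_measure. cnj (of_real r * cis t) ^ j * f (of_real r * cis t)) =
      of_real (r ^ j) * fourier_coeff (\<lambda>t. f (of_real r * cis t)) j" for r
    unfolding fourier_coeff_def
    by (simp add: power_mult_distrib cis_cnj Complex.DeMoivre mult.assoc)
  show "integrable rad (\<lambda>r. of_real (r ^ j) * fourier_coeff (\<lambda>t. f (of_real r * cis t)) j)"
    using ai(3) unfolding e .
  show "coeff f j = (LINT r|rad. of_real (r ^ j) * fourier_coeff (\<lambda>t. f (of_real r * cis t)) j)"
    using ai(4) unfolding e coeff_def .
qed

text \<open>In polar coordinates each product of coefficients is an integral over two independent
  radii, \<open>s\<close> for \<open>f\<close> and \<open>r\<close> for \<open>g\<close>. For fixed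
  radii the Riesz bound holds on every window; Abel summation inserts \<open>(s * r) ^ n\<close>,
  which decreases, and the reciprocal moments, which increase. The largest power
  \<open>(s * r) ^ a\<close> splits into one factor for each radial integral.\<close>

lemma block_bound:
  assumes p: "p > 1" and pq: "1/p + 1/q = 1" and R0: "R \<ge> 0"
    and R: "\<And>f g a b. \<lbrakk>f \<in> borel_measurable borel; integrable circle_measure (\<lambda>t. norm (f t) powr p);
       g \<in> borel_measurable borel; integrable circle_measure (\<lambda>t. norm (g t) powr q)\<rbrakk> \<Longrightarrow>
       norm (\<Sum>n\<in>{a..<b}. fourier_coeff f n * cnj (fourier_coeff g n)) \<le>
         R * Lnorm circle_measure p f * Lnorm circle_measure q g"
    and fm [measurable]: "f \<in> borel_measurable borel" and f: "integrable area (\<lambda>z. norm (f z) powr p)"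
    and gm [measurable]: "g \<in> borel_measurable borel" and g: "integrable area (\<lambda>z. norm (g z) powr q)"
    and ab: "a \<le> b"
  shows "norm (\<Sum>j\<in>{a..<Suc b}. coeff f j * cnj (coeff g j) / of_real (moment (2 * real j))) \<le>
    3 * R / moment (2 * real b) * (LINT r|rad. r ^ a * slice_norm p f r) * (LINT r|rad. r ^ a * slice_norm q g r)"
proof -
  note q = conjugate_exponentD[OF p pq]
  have f1: "integrable area f"
    using integrable_of_powr_integrable[OF area.finite_measure_axioms, of p f] p f by simp
  have g1: "integrable area g"
    using integrable_of_powr_integrable[OF area.finite_measure_axioms, of q g] q(1) g by simp
  note sf = slice_norm[OF p fm f] and sg = slice_norm[OF q(1) gm g]
  note [measurable] = sf(1) sg(1)
  have iM: "integrable rad (\<lambda>r. r ^ k * h r)" if h: "integrable rad h" for k and h :: "real \<Rightarrow> real"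
  proof (rule Bochner_Integration.integrable_bound[OF h])
    have [measurable]: "h \<in> borel_measurable borel" using borel_measurable_integrable[OF h] by simp
    show "(\<lambda>r. r ^ k * h r) \<in> borel_measurable rad" by measurable
    show "AE r in rad. norm (r ^ k * h r) \<le> norm (h r)"
      using AE_rad by eventually_elim (auto simp: abs_mult power_abs intro!: mult_left_le_one_le power_le_one)
  qed
  define v where "v = (\<lambda>j. 1 / moment (2 * real j))"
  have v: "v n \<le> v (Suc n)" "0 \<le> v n" for n
    unfolding v_def using moment_pos[of "2 * real n"] moment_pos[of "2 * real (Suc n)"]
    by (auto intro!: divide_left_mono moment_antimono simp: less_imp_le)
  define F where "F = (\<lambda>j s. complex_of_real (s ^ j) * fourier_coeff (\<lambda>t. f (of_real s * cis t)) j)"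
  define G where "G = (\<lambda>j r. complex_of_real (r ^ j) * fourier_coeff (\<lambda>t. g (of_real r * cis t)) j)"
  have iF: "integrable rad (F j)" "coeff f j = (LINT s|rad. F j s)" for j
    unfolding F_def by (rule coeff_fourier[OF f1])+
  have iG: "integrable rad (\<lambda>r. cnj (G j r))" "cnj (coeff g j) = (LINT r|rad. cnj (G j r))" for j
  proof -
    have G: "integrable rad (G j)" "coeff g j = (LINT r|rad. G j r)"
      unfolding G_def by (rule coeff_fourier[OF g1])+
    show "integrable rad (\<lambda>r. cnj (G j r))" using G(1) by simp
    show "cnj (coeff g j) = (LINT r|rad. cnj (G j r))" by (simp add: G(2))
  qed
  define I where "I = {a..<Suc b}"
  define cg where "cg = (\<lambda>j. cnj (coeff g j))"
  have pf: "AE s in rad. integrable circle_measure (\<lambda>t. norm (f (of_real s * cis t)) powr p)"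
    by (rule area_integral(2)[OF f])
  have pg: "AE r in rad. integrable circle_measure (\<lambda>t. norm (g (of_real r * cis t)) powr q)"
    by (rule area_integral(2)[OF g])
  have point: "norm (\<Sum>j\<in>I. of_real (v j) * (F j s * cnj (G j r))) \<le>
      3 * R * v b * (s ^ a * slice_norm p f s) * (r ^ a * slice_norm q g r)"
    if s: "0 < s" "s < 1" and r: "0 < r" "r < 1"
      and fs: "integrable circle_measure (\<lambda>t. norm (f (of_real s * cis t)) powr p)"
      and gr: "integrable circle_measure (\<lambda>t. norm (g (of_real r * cis t)) powr q)" for s r
  proof -
    define x where "x = (\<lambda>j. fourier_coeff (\<lambda>t. f (of_real s * cis t)) j * cnj (fourier_coeff (\<lambda>t. g (of_real r * cis t)) j))"
    have P: "norm (\<Sum>n\<in>{a..<c}. x n) \<le> R * slice_norm p f s * slice_norm q g r" for c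
      unfolding x_def slice_norm_def by (rule R[OF _ fs _ gr]) measurable
    have "norm (\<Sum>n\<in>{a..<Suc b}. of_real ((s * r) ^ n * v n) * x n) \<le> 3 * ((s * r) ^ a * v b) * (R * slice_norm p f s * slice_norm q g r)"
    proof (rule norm_sum_monotone_mult_le[where u = "\<lambda>n. (s * r) ^ n" and v = v, OF P ab])
      show "(s * r) ^ Suc n \<le> (s * r) ^ n" for n
        using s r by (intro power_decreasing) (auto intro: mult_le_one)
      show "0 \<le> (s * r) ^ n" for n using s r by simp
    qed (rule v)+
    moreover have "(\<Sum>n\<in>{a..<Suc b}. of_real ((s * r) ^ n * v n) * x n) = (\<Sum>j\<in>I. of_real (v j) * (F j s * cnj (G j r)))"
      unfolding I_def by (intro sum.cong refl) (simp add: x_def F_def G_def power_mult_distrib)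
    moreover have "3 * ((s * r) ^ a * v b) * (R * slice_norm p f s * slice_norm q g r) =
        3 * R * v b * (s ^ a * slice_norm p f s) * (r ^ a * slice_norm q g r)"
      by (simp only: power_mult_distrib mult_ac)
    ultimately show ?thesis by (simp only:)
  qed
  \<comment> \<open>The radial integrals are taken off one at a time: first that of \<open>g\<close>
    with \<open>s\<close> frozen, then that of \<open>f\<close>.\<close>
  define \<Psi> where "\<Psi> = (LINT r|rad. r ^ a * slice_norm q g r)"
  have inner: "norm (\<Sum>j\<in>I. of_real (v j) * (F j s * cg j)) \<le> 3 * R * v b * (s ^ a * slice_norm p f s) * \<Psi>"
    if s: "0 < s" "s < 1" and fs: "integrable circle_measure (\<lambda>t. norm (f (of_real s * cis t)) powr p)" for s
  proof -
    have ii: "integrable rad (\<lambda>r. \<Sum>j\<in>I. of_real (v j) * (F j s * cnj (G j r)))"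
      using iG by (intro Bochner_Integration.integrable_sum integrable_mult_right) auto
    have "(\<Sum>j\<in>I. of_real (v j) * (F j s * cg j)) = (LINT r|rad. (\<Sum>j\<in>I. of_real (v j) * (F j s * cnj (G j r))))"
      unfolding cg_def iG(2) using iG(1)
      by (subst Bochner_Integration.integral_sum) auto
    also have "norm \<dots> \<le> (LINT r|rad. norm (\<Sum>j\<in>I. of_real (v j) * (F j s * cnj (G j r))))"
      by (rule integral_norm_bound)
    also have "\<dots> \<le> (LINT r|rad. 3 * R * v b * (s ^ a * slice_norm p f s) * (r ^ a * slice_norm q g r))"
    proof (rule integral_mono_AE)
      show "integrable rad (\<lambda>r. norm (\<Sum>j\<in>I. of_real (v j) * (F j s * cnj (G j r))))"
        by (rule integrable_norm[OF ii])
      show "integrable rad (\<lambda>r. 3 * R * v b * (s ^ a * slice_norm p f s) * (r ^ a * slice_norm q g r))"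
        by (rule integrable_mult_right[OF iM[OF sg(5)]])
      show "AE r in rad. norm (\<Sum>j\<in>I. of_real (v j) * (F j s * cnj (G j r))) \<le> 3 * R * v b * (s ^ a * slice_norm p f s) * (r ^ a * slice_norm q g r)"
        using AE_rad pg by eventually_elim (use point s fs in blast)
    qed
    also have "\<dots> = 3 * R * v b * (s ^ a * slice_norm p f s) * \<Psi>" unfolding \<Psi>_def by simp
    finally show ?thesis .
  qed
  have ii: "integrable rad (\<lambda>s. \<Sum>j\<in>I. of_real (v j) * (F j s * cg j))"
    using iF by (intro Bochner_Integration.integrable_sum integrable_mult_right integrable_mult_left) auto
  have "(\<Sum>j\<in>{a..<Suc b}. coeff f j * cnj (coeff g j) / of_real (moment (2 * real j))) =
      (\<Sum>j\<in>I. of_real (v j) * ((LINT s|rad. F j s) * cg j))"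
    unfolding I_def by (intro sum.cong refl) (simp add: iF(2) cg_def v_def)
  also have "\<dots> = (LINT s|rad. (\<Sum>j\<in>I. of_real (v j) * (F j s * cg j)))"
    using iF(1) by (subst Bochner_Integration.integral_sum) auto
  also have "norm \<dots> \<le> (LINT s|rad. norm (\<Sum>j\<in>I. of_real (v j) * (F j s * cg j)))"
    by (rule integral_norm_bound)
  also have "\<dots> \<le> (LINT s|rad. 3 * R * v b * (s ^ a * slice_norm p f s) * \<Psi>)"
  proof (rule integral_mono_AE)
    show "integrable rad (\<lambda>s. norm (\<Sum>j\<in>I. of_real (v j) * (F j s * cg j)))" by (rule integrable_norm[OF ii])
    show "integrable rad (\<lambda>s. 3 * R * v b * (s ^ a * slice_norm p f s) * \<Psi>)"
      by (intro integrable_mult_left integrable_mult_right iM sf(5))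
    show "AE s in rad. norm (\<Sum>j\<in>I. of_real (v j) * (F j s * cg j)) \<le> 3 * R * v b * (s ^ a * slice_norm p f s) * \<Psi>"
      using AE_rad pf by eventually_elim (use inner in blast)
  qed
  also have "\<dots> = 3 * R / moment (2 * real b) * (LINT r|rad. r ^ a * slice_norm p f r) * \<Psi>"
    by (simp add: v_def)
  finally show ?thesis unfolding \<Psi>_def .
qed

lemma proj_bounded_of_doubling:
  assumes p: "p > 1" and D: "D > 0" "\<And>x. 0 \<le> x \<Longrightarrow> moment x \<le> D * moment (2 * x)"
  obtains C where "C \<ge> 0" "\<And>f. \<lbrakk>f \<in> borel_measurable borel; integrable area (\<lambda>z. norm (f z) powr p)\<rbrakk> \<Longrightarrow>
    integrable area (\<lambda>z. norm (proj f z) powr p) \<and>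
    (LINT z|area. norm (proj f z) powr p) \<le> (C * Lnorm area p f) powr p"
proof -
  define q where "q = p / (p - 1)"
  have pq: "1/p + 1/q = 1" using p by (simp add: q_def field_simps)
  note q = conjugate_exponentD[OF p pq]
  have qp: "1/q + 1/p = 1" using pq by simp
  obtain R where R: "R \<ge> 0"
    "\<And>f g a b. \<lbrakk>f \<in> borel_measurable borel; integrable circle_measure (\<lambda>t. norm (f t) powr p);
       g \<in> borel_measurable borel; integrable circle_measure (\<lambda>t. norm (g t) powr q)\<rbrakk> \<Longrightarrow>
       norm (\<Sum>n\<in>{a..<b}. fourier_coeff f n * cnj (fourier_coeff g n)) \<le>
         R * Lnorm circle_measure p f * Lnorm circle_measure q g"
    using riesz_partial_sums[OF p pq] by blast
  \<comment> \<open>Large enough for Hardy's inequality with exponent \<open>p\<close> and with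
    exponent \<open>q\<close>.\<close>
  define K where "K = 2 * (2 powr p + 2 powr q)"
  have K: "K \<ge> 2 * 2 powr p" "K \<ge> 2 * 2 powr q" "K > 1"
  proof -
    have "2 powr 0 < (2 powr p :: real)" using p by (intro powr_less_mono) auto
    then have "1 < (2 powr p :: real)" by (simp only: powr_zero_eq_one) simp
    moreover have "0 < (2 powr q :: real)" by simp
    moreover have "1 < 2 * (x + y)" if "1 < x" "0 < y" for x y :: real using that by simp
    ultimately show "K > 1" unfolding K_def by blast
  qed (auto simp: K_def)
  define V where "V = moment 0"
  have V: "V > 0" by (simp add: V_def moment_pos)
  \<comment> \<open>Minimality gives both sides of the comparison: the moment at \<open>M n\<close>
    is at most \<open>V / K ^ n\<close>, and every index before \<open>M (Suc n)\<close> still has a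
    moment above \<open>V / K ^ Suc n\<close>. Some blocks may be empty.\<close>
  define M where "M = (\<lambda>n. LEAST j. moment (2 * real j) \<le> V / K ^ n)"
  have ex: "\<exists>j. moment (2 * real j) \<le> V / K ^ n" for n
  proof -
    have "eventually (\<lambda>j. moment (2 * real j) < V / K ^ n) sequentially"
      by (rule order_tendstoD(2)[OF moment_tendsto_0]) (use V K(3) in simp)
    then obtain j where "moment (2 * real j) < V / K ^ n"
      unfolding eventually_sequentially by blast
    then show ?thesis by (intro exI[of _ j]) simp
  qed
  have M1: "moment (2 * real (M n)) \<le> V / K ^ n" for n
    unfolding M_def by (rule LeastI_ex[OF ex])
  have M2: "V / K ^ n < moment (2 * real j)" if "j < M n" for j n
    using not_less_Least[of j "\<lambda>j. moment (2 * real j) \<le> V / K ^ n"] that unfolding M_def by simp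
  have M0: "M 0 = 0" unfolding M_def by (rule Least_equality) (auto simp: V_def)
  have Mmono: "M n \<le> M (Suc n)" for n
    unfolding M_def[of ] 
  proof (rule Least_le)
    have "V / K ^ Suc n \<le> V / K ^ n" using V K(3) by (intro divide_left_mono power_increasing) auto
    then show "moment (2 * real (LEAST j. moment (2 * real j) \<le> V / K ^ Suc n)) \<le> V / K ^ n"
      using M1[of "Suc n"] unfolding M_def by linarith
  qed
  have Munb: "\<exists>n. j < M n" for j
  proof -
    have "(\<lambda>n. V * (1 / K) ^ n) \<longlonglongrightarrow> V * 0" using K(3) by (intro tendsto_mult tendsto_const LIMSEQ_realpow_zero) auto
    then have "eventually (\<lambda>n. V * (1 / K) ^ n < moment (2 * real j)) sequentially"
      using moment_pos[of "2 * real j"] by (intro order_tendstoD(2)) auto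
    then obtain n where n: "V / K ^ n < moment (2 * real j)"
      by (auto simp: power_divide eventually_sequentially)
    have "j < M n"
    proof (rule ccontr)
      assume "\<not> j < M n"
      then have "moment (2 * real j) \<le> moment (2 * real (M n))" by (intro moment_antimono) auto
      then show False using n M1[of n] by linarith
    qed
    then show ?thesis ..
  qed
  have Minf: "filterlim M at_top sequentially"
    unfolding filterlim_at_top
  proof
    fix Z
    obtain n where "Z < M n" using Munb by blast
    moreover have "M n \<le> M m" if "n \<le> m" for m using lift_Suc_mono_le[of M, OF Mmono that] .
    ultimately have "Z \<le> M m" if "n \<le> m" for m using that by (meson le_trans less_imp_le)
    then show "eventually (\<lambda>m. Z \<le> M m) sequentially" by (rule eventually_sequentiallyI)
  qed
  \<comment> \<open>Here doubling enters. The threshold concerns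
    \<open>moment (2 * real (M n))\<close>, but each slice integral carries only one factor
    \<open>r ^ M n\<close>, so the bound is needed at half the exponent.\<close>
  have MV: "moment (real (M n)) \<le> (D * V) / K ^ n" for n
  proof -
    have "moment (real (M n)) \<le> D * moment (2 * real (M n))" by (rule D(2)) simp
    also have "\<dots> \<le> D * (V / K ^ n)" using D(1) M1 by (intro mult_left_mono) auto
    finally show ?thesis by simp
  qed
  have A: "D * V \<ge> 0" using D V by simp
  \<comment> \<open>\<open>lacunary_analysis\<close> relies on synthesis in the conjugate exponent,
    so \<open>Cp\<close> will belong to \<open>g\<close> and \<open>Cq\<close> to
    \<open>f\<close>.\<close>
  define Cp where "Cp = (p * (D * V) * (2 * 2 powr p)) powr (1/p)"
  define Cq where "Cq = (q * (D * V) * (2 * 2 powr q)) powr (1/q)"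
  define C where "C = 3 * R * K / V * (Cq * Cp)"
  have C: "C \<ge> 0" using R(1) K(3) V by (simp add: C_def Cp_def Cq_def)
  show ?thesis
  proof (rule that[OF C])
    fix f :: "complex \<Rightarrow> complex"
    assume fm [measurable]: "f \<in> borel_measurable borel" and f: "integrable area (\<lambda>z. norm (f z) powr p)"
    have f1: "integrable area f"
      using integrable_of_powr_integrable[OF area.finite_measure_axioms, of p f] p f by simp
    note sf = slice_norm[OF p fm f]
    have bound: "norm (\<Sum>j. coeff f j * cnj (coeff g j) / of_real (moment (2 * real j))) \<le> (C * Lnorm area p f) * Lnorm area q g"
      if x: "0 < x" "x < 1" and gm [measurable]: "g \<in> borel_measurable borel" and gB: "\<exists>B. \<forall>z. norm (g z) \<le> B"
        and supp: "\<And>z. norm z > x \<Longrightarrow> g z = 0" for g x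
    proof -
      obtain B where B: "\<And>z. norm (g z) \<le> B" using gB by blast
      have g1: "integrable area g" by (rule area.integrable_const_bound[of _ B]) (use B in auto)
      have g: "integrable area (\<lambda>z. norm (g z) powr q)"
        by (rule area.integrable_const_bound[of _ "B powr q"]) (use B q(1) in \<open>auto intro!: AE_I2 powr_mono2\<close>)
      note sg = slice_norm[OF q(1) gm g]
      define y where "y = (\<lambda>j. coeff f j * cnj (coeff g j) / complex_of_real (moment (2 * real j)))"
      define a where "a = (\<lambda>n. LINT r|rad. r ^ M n * slice_norm p f r)"
      define b where "b = (\<lambda>n. LINT r|rad. r ^ M n * slice_norm q g r)"
      have a0: "a n \<ge> 0" for n unfolding a_def using AE_rad sf(2)
        by (intro integral_nonneg_AE) (auto elim!: eventually_mono)
      have b0: "b n \<ge> 0" for n unfolding b_def using AE_rad sg(2)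
        by (intro integral_nonneg_AE) (auto elim!: eventually_mono)
      \<comment> \<open>The factor \<open>K ^ n * a n * b n\<close> is written with weight
        \<open>1 / K ^ n\<close> and entries \<open>K ^ n * a n\<close>, \<open>K ^ n * b n\<close>
        to fit \<open>Holder_sum\<close> and \<open>lacunary_analysis\<close>. The extra
        \<open>K / V\<close> comes from the threshold at the last index of the block.\<close>
      have block: "norm (\<Sum>j\<in>{M n..<M (Suc n)}. y j) \<le> 3 * R * K / V * ((1 / K ^ n) * ((K ^ n * a n) * (K ^ n * b n)))" for n
      proof (cases "M n < M (Suc n)")
        case True
        define m where "m = M (Suc n) - 1"
        have m: "M (Suc n) = Suc m" "M n \<le> m" using True by (auto simp: m_def)
        have "V / K ^ Suc n < moment (2 * real m)" by (rule M2) (simp add: m)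
        then have "1 / moment (2 * real m) \<le> 1 / (V / K ^ Suc n)"
          using V K(3) moment_pos[of "2 * real m"] by (intro divide_left_mono mult_pos_pos divide_pos_pos zero_less_power) auto
        then have inv: "1 / moment (2 * real m) \<le> K ^ Suc n / V" by simp
        have "norm (\<Sum>j\<in>{M n..<M (Suc n)}. y j) \<le> 3 * R / moment (2 * real m) * a n * b n"
          unfolding m(1) y_def a_def b_def by (rule block_bound[OF p pq R fm f gm g m(2)])
        also have "\<dots> = (1 / moment (2 * real m)) * (3 * R * a n * b n)" by simp
        also have "\<dots> \<le> (K ^ Suc n / V) * (3 * R * a n * b n)"
          using inv R(1) a0 b0 by (intro mult_right_mono) auto
        also have "\<dots> = 3 * R * K / V * ((1 / K ^ n) * ((K ^ n * a n) * (K ^ n * b n)))"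
          using K(3) by (simp add: field_simps)
        finally show ?thesis .
      next
        case False
        have "0 \<le> 3 * R * K / V * ((1 / K ^ n) * ((K ^ n * a n) * (K ^ n * b n)))"
          using R(1) K(3) V a0 b0 by (intro mult_nonneg_nonneg divide_nonneg_nonneg) auto
        then show ?thesis using False by simp
      qed
      have partial: "norm (\<Sum>j<M N. y j) \<le> (C * Lnorm area p f) * Lnorm area q g" for N
      proof -
        have "(\<Sum>j<M N. y j) = (\<Sum>n<N. \<Sum>j\<in>{M n..<M (Suc n)}. y j)"
        proof (induction N)
          case (Suc N)
          have "{..<M (Suc N)} = {..<M N} \<union> {M N..<M (Suc N)}" using Mmono[of N] by auto
          then have "(\<Sum>j<M (Suc N). y j) = (\<Sum>j<M N. y j) + (\<Sum>j\<in>{M N..<M (Suc N)}. y j)"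
            by (simp add: sum.union_disjoint ivl_disj_int)
          then show ?case using Suc by simp
        qed (simp add: M0)
        then have "norm (\<Sum>j<M N. y j) \<le> (\<Sum>n<N. norm (\<Sum>j\<in>{M n..<M (Suc n)}. y j))"
          by (simp only: norm_sum)
        also have "\<dots> \<le> (\<Sum>n<N. 3 * R * K / V * ((1 / K ^ n) * ((K ^ n * a n) * (K ^ n * b n))))"
          by (intro sum_mono block)
        also have "\<dots> = 3 * R * K / V * (\<Sum>n<N. (1 / K ^ n) * ((K ^ n * a n) * (K ^ n * b n)))"
          by (simp only: sum_distrib_left)
        also have "\<dots> \<le> 3 * R * K / V * ((Cq * Lnorm area p f) * (Cp * Lnorm area q g))"
        proof (intro mult_left_mono)
          have "(\<Sum>n<N. (1 / K ^ n) * ((K ^ n * a n) * (K ^ n * b n))) \<le>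
              (\<Sum>n<N. (1 / K ^ n) * (K ^ n * a n) powr p) powr (1/p) * (\<Sum>n<N. (1 / K ^ n) * (K ^ n * b n) powr q) powr (1/q)"
            by (rule Holder_sum[OF p pq]) (use a0 b0 K(3) in auto)
          also have "\<dots> \<le> (Cq * Lnorm rad p (slice_norm p f)) * (Cp * Lnorm rad q (slice_norm q g))"
          proof (rule mult_mono)
            show "(\<Sum>n<N. (1 / K ^ n) * (K ^ n * a n) powr p) powr (1/p) \<le> Cq * Lnorm rad p (slice_norm p f)"
              unfolding a_def Cq_def by (rule lacunary_analysis[OF q(1) qp K(2) A MV sf(1,2,3)])
            show "(\<Sum>n<N. (1 / K ^ n) * (K ^ n * b n) powr q) powr (1/q) \<le> Cp * Lnorm rad q (slice_norm q g)"
              unfolding b_def Cp_def by (rule lacunary_analysis[OF p pq K(1) A MV sg(1,2,3)])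
          qed (auto simp: Cq_def)
          finally show "(\<Sum>n<N. (1 / K ^ n) * ((K ^ n * a n) * (K ^ n * b n))) \<le> (Cq * Lnorm area p f) * (Cp * Lnorm area q g)"
            by (simp only: sf(4) sg(4))
        qed (use R(1) K(3) V in auto)
        finally show ?thesis by (simp add: C_def mult_ac)
      qed
      \<comment> \<open>The series is already known to converge, so its sum may be taken along the
        block ends \<open>M N\<close>.\<close>
      have "(\<lambda>N. \<Sum>j<N. y j) \<longlonglongrightarrow> (\<Sum>j. y j)"
        unfolding y_def using summable_LIMSEQ[OF summable_norm_cancel[OF pairing_sums(2)[OF f1 gm x g1 supp]]] .
      then have "(\<lambda>N. \<Sum>j<M N. y j) \<longlonglongrightarrow> (\<Sum>j. y j)"
        by (rule filterlim_compose[OF _ Minf])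
      then have "norm (\<Sum>j. y j) \<le> (C * Lnorm area p f) * Lnorm area q g"
        by (intro LIMSEQ_le_const2[OF tendsto_norm]) (use partial in auto)
      then show ?thesis by (simp only: y_def)
    qed
    have CK: "C * Lnorm area p f \<ge> 0" using C by simp
    show "integrable area (\<lambda>z. norm (proj f z) powr p) \<and>
      (LINT z|area. norm (proj f z) powr p) \<le> (C * Lnorm area p f) powr p"
    proof
      show "integrable area (\<lambda>z. norm (proj f z) powr p)"
        by (rule dual_criterion(1)[OF p pq f1 CK]) (rule bound)
      show "(LINT z|area. norm (proj f z) powr p) \<le> (C * Lnorm area p f) powr p"
        by (rule dual_criterion(2)[OF p pq f1 CK]) (rule bound)
    qed
  qed
qed

end

section \<open>Passing to a Borel representative of the weight\<close>

text \<open>The modulus of a point of the disk is distributed with a density, so a null set of radii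
  gives a null set of points.\<close>

lemma AE_norm_disk:
  assumes "AE r in lborel. P (r::real)"
  shows "AE z in lborel. norm (z::complex) < 1 \<longrightarrow> P (norm z)"
proof -
  have "AE r in density lborel (\<lambda>r. ennreal (indicator {0..<1} r * (2 * pi * r))). P r"
    using assms by (subst AE_density) auto
  then have "AE r in distr (density lborel (indicator (ball (0::complex) 1))) borel norm. P r"
    by (simp only: distr_norm_disk)
  then have "AE z in density lborel (indicator (ball (0::complex) 1)). P (norm z)"
    by (rule AE_distrD[rotated]) simp
  then show ?thesis
    by (subst (asm) AE_density) (auto intro!: borel_measurable_indicator elim!: eventually_mono simp: indicator_def split: if_splits)
qed

text \<open>Completeness: every subset of the exceptional set is measurable. Through it, images
  under the projection acquire the measurability that \<open>Lp_weighted\<close> demands.\<close>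

lemma measurable_lebesgue_AE_eq:
  fixes F G :: "'a::euclidean_space \<Rightarrow> 'b::topological_space"
  assumes G: "G \<in> borel_measurable lborel" and eq: "AE x in lborel. F x = G x"
  shows "F \<in> borel_measurable lebesgue"
proof (rule measurableI)
  fix A :: "'b set" assume A: "A \<in> sets borel"
  have G': "G -` A \<in> sets lebesgue"
    using measurable_sets[OF G A] by (simp add: sets_completionI_sets)
  have 1: "{x. F x \<noteq> G x \<and> Q x} \<in> sets lebesgue" for Q
  proof -
    have "AE x in lborel. \<not> (F x \<noteq> G x \<and> Q x)" using eq by eventually_elim simp
    then have "Measurable.pred lebesgue (\<lambda>x. F x \<noteq> G x \<and> Q x)" by (rule sets_completion_AE)
    then show ?thesis by (simp add: pred_def)
  qed
  have "F -` A \<inter> space lebesgue = (G -` A - {x. F x \<noteq> G x \<and> True}) \<union> {x. F x \<noteq> G x \<and> F x \<in> A}"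
    by auto
  then show "F -` A \<inter> space lebesgue \<in> sets lebesgue"
    using 1[of "\<lambda>_. True"] 1[of "\<lambda>x. F x \<in> A"] G' by auto
qed simp

lemma space_disk_area [simp]: "space disk_area = ball 0 1"
  by (simp add: disk_area_def space_restrict_space)

lemma sets_disk_area: "sets disk_area = sets (lebesgue_on (ball 0 1))"
  by (simp add: disk_area_def)

lemma borel_measurable_disk_area_AE_eq:
  fixes F G :: "complex \<Rightarrow> 'b::euclidean_space"
  assumes G: "G \<in> borel_measurable borel" and eq: "AE z in lborel. norm z < 1 \<longrightarrow> F z = G z"
  shows "F \<in> borel_measurable disk_area"
proof -
  have [measurable]: "ball (0::complex) 1 \<in> sets borel" by simp
  have "(\<lambda>z. if z \<in> ball 0 1 then F z else 0) \<in> borel_measurable lebesgue"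
  proof (rule measurable_lebesgue_AE_eq)
    show "(\<lambda>z. if z \<in> ball 0 1 then G z else 0) \<in> borel_measurable lborel"
      using G by (auto intro!: measurable_If_set)
    show "AE z in lborel. (if z \<in> ball 0 1 then F z else 0) = (if z \<in> ball 0 1 then G z else 0)"
      using eq by eventually_elim simp
  qed
  then have "F \<in> borel_measurable (lebesgue_on (ball 0 1))"
    by (subst (asm) borel_measurable_if) auto
  then show ?thesis using measurable_cong_sets[OF sets_disk_area refl] by blast
qed

lemma borel_representative_disk_area:
  fixes f :: "complex \<Rightarrow> complex"
  assumes "f \<in> borel_measurable disk_area"
  obtains f' where "f' \<in> borel_measurable borel" "AE z in lborel. norm z < 1 \<longrightarrow> f z = f' z"
proof -
  have "f \<in> borel_measurable (lebesgue_on (ball 0 1))"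
    using assms measurable_cong_sets[OF sets_disk_area refl] by blast
  then have F: "(\<lambda>z. if z \<in> ball 0 1 then f z else 0) \<in> borel_measurable lebesgue"
    by (subst borel_measurable_if) auto
  obtain u where u: "u \<in> borel_measurable lborel" "AE z in lborel. Re (if z \<in> ball 0 1 then f z else 0) = u z"
    using completion_ex_borel_measurable_real[OF measurable_compose[OF F borel_measurable_Re]] by blast
  obtain v where v: "v \<in> borel_measurable lborel" "AE z in lborel. Im (if z \<in> ball 0 1 then f z else 0) = v z"
    using completion_ex_borel_measurable_real[OF measurable_compose[OF F borel_measurable_Im]] by blast
  show ?thesis
  proof (rule that[of "\<lambda>z. Complex (u z) (v z)"])
    show "(\<lambda>z. Complex (u z) (v z)) \<in> borel_measurable borel"
      using u(1) v(1) by (intro measurable_Complex) auto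
    show "AE z in lborel. norm z < 1 \<longrightarrow> f z = Complex (u z) (v z)"
      using u(2) v(2) by eventually_elim (auto simp: complex_eq_iff)
  qed
qed

locale weight_representative = disk_weight +
  fixes \<omega> :: "real \<Rightarrow> real"
  assumes rep: "AE r in lborel. r \<in> {0..<1} \<longrightarrow> \<omega> r = w r"
begin

text \<open>Moves the weight from the integrand into the measure and, through null sets, replaces
  Lebesgue measurable integrands by Borel ones.\<close>

lemma disk_area_integral:
  fixes F F' :: "complex \<Rightarrow> 'b::euclidean_space"
  assumes F': "F' \<in> borel_measurable borel" and eq: "AE z in lborel. norm z < 1 \<longrightarrow> F z = w (norm z) *\<^sub>R F' z"
  shows "integrable disk_area F \<longleftrightarrow> integrable area F'"
    and "(LINT z|disk_area. F z) = (LINT z|area. F' z)"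
proof -
  note [measurable] = F'
  have Fd: "F \<in> borel_measurable disk_area"
    by (rule borel_measurable_disk_area_AE_eq[OF _ eq]) measurable
  then have Fm: "F \<in> borel_measurable (restrict_space lebesgue (ball 0 1))"
    using measurable_cong_sets[OF sets_disk_area refl] by blast
  have cm: "(\<lambda>_. ennreal (1/pi)) \<in> borel_measurable (restrict_space lebesgue (ball 0 1))" by simp
  define G where "G = (\<lambda>z. (w (norm z) / pi) *\<^sub>R F' z)"
  have Gm: "G \<in> borel_measurable lborel" unfolding G_def by measurable
  have ae: "AE z in lebesgue. indicat_real (ball 0 1) z *\<^sub>R (1/pi) *\<^sub>R F z = G z"
  proof (rule AE_completion)
    show "AE z in lborel. indicat_real (ball 0 1) z *\<^sub>R (1/pi) *\<^sub>R F z = G z"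
      using eq by eventually_elim (auto simp: G_def indicator_def w_zero)
  qed
  have Gl: "G \<in> borel_measurable lebesgue" using Gm by (rule measurable_completion)
  have Fl: "(\<lambda>z. indicat_real (ball 0 1) z *\<^sub>R (1/pi) *\<^sub>R F z) \<in> borel_measurable lebesgue"
    by (rule measurable_lebesgue_AE_eq[OF Gm]) (use ae AE_completion_iff in blast)
  have "integrable disk_area F \<longleftrightarrow> integrable (restrict_space lebesgue (ball 0 1)) (\<lambda>z. (1/pi) *\<^sub>R F z)"
    unfolding disk_area_def by (rule integrable_density[OF Fm]) auto
  also have "\<dots> \<longleftrightarrow> integrable lebesgue (\<lambda>z. indicat_real (ball 0 1) z *\<^sub>R (1/pi) *\<^sub>R F z)"
    by (rule integrable_restrict_space) simp
  also have "\<dots> \<longleftrightarrow> integrable lebesgue G"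
    by (rule integrable_cong_AE[OF Fl Gl ae])
  also have "\<dots> \<longleftrightarrow> integrable lborel G" by (rule integrable_completion[OF Gm])
  also have "\<dots> \<longleftrightarrow> integrable area F'"
    unfolding area_def G_def by (rule integrable_density[symmetric]) (use w_nonneg in auto)
  finally show "integrable disk_area F \<longleftrightarrow> integrable area F'" .
  have "(LINT z|disk_area. F z) = (LINT z|restrict_space lebesgue (ball 0 1). (1/pi) *\<^sub>R F z)"
    unfolding disk_area_def by (rule integral_density[OF Fm]) auto
  also have "\<dots> = (LINT z|lebesgue. indicat_real (ball 0 1) z *\<^sub>R (1/pi) *\<^sub>R F z)"
    by (rule integral_restrict_space) simp
  also have "\<dots> = (LINT z|lebesgue. G z)" by (rule integral_cong_AE[OF Fl Gl ae])
  also have "\<dots> = (LINT z|lborel. G z)" by (rule integral_completion[OF Gm])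
  also have "\<dots> = (LINT z|area. F' z)"
    unfolding area_def G_def by (rule integral_density[symmetric]) (use w_nonneg in auto)
  finally show "(LINT z|disk_area. F z) = (LINT z|area. F' z)" .
qed

lemma weight_norm_AE: "AE z in lborel. norm (z::complex) < 1 \<longrightarrow> \<omega> (norm z) = w (norm z)"
  using AE_norm_disk[OF rep] by eventually_elim simp

text \<open>The exponent drops by one and the 2 disappears because both are part of the density of
  \<open>rad\<close>.\<close>

lemma weight_moment_eq: "2 * weight_moment \<omega> (2 * real j + 1) = moment (2 * real j)"
proof -
  have m: "(\<lambda>r. r powr (2 * real j + 1) * w r) \<in> borel_measurable lborel" by measurable
  have ae0: "AE r in lborel. indicat_real {0..<1} r *\<^sub>R (r powr (2 * real j + 1) * \<omega> r) = r powr (2 * real j + 1) * w r"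
    using rep by eventually_elim (auto simp: indicator_def w_zero)
  have "weight_moment \<omega> (2 * real j + 1) = (LINT r|lebesgue. r powr (2 * real j + 1) * w r)"
    unfolding weight_moment_def set_lebesgue_integral_def
    by (rule integral_cong_AE[OF measurable_lebesgue_AE_eq[OF m ae0] measurable_completion[OF m] AE_completion[OF ae0]])
  also have "\<dots> = (LINT r|lborel. r powr (2 * real j + 1) * w r)" by (rule integral_completion[OF m])
  finally have wm: "weight_moment \<omega> (2 * real j + 1) = (LINT r|lborel. r powr (2 * real j + 1) * w r)" .
  have "2 * weight_moment \<omega> (2 * real j + 1) = (LINT r|lborel. (2 * r * w r) *\<^sub>R r powr (2 * real j))"
  proof -
    have "2 * (r powr (2 * real j + 1) * w r) = (2 * r * w r) *\<^sub>R r powr (2 * real j)" for r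
    proof (cases "r \<in> {0..<1}")
      case True
      then show ?thesis using powr_mult_base[of r "2 * real j"] by (simp add: add.commute)
    qed (simp add: w_zero)
    moreover have "2 * weight_moment \<omega> (2 * real j + 1) = (LINT r|lborel. 2 * (r powr (2 * real j + 1) * w r))"
      unfolding wm by (rule integral_mult_right_zero[symmetric])
    ultimately show ?thesis by (simp only:)
  qed
  also have "\<dots> = moment (2 * real j)"
    unfolding moment_def rad_def
  proof (rule integral_density[symmetric])
    have "0 \<le> 2 * r * w r" for r
      using w_nonneg[of r] w_zero[of r] by (cases "r \<in> {0..<1}") auto
    then show "AE r in lborel. 0 \<le> 2 * r * w r" by simp
  qed measurable
  finally show ?thesis .
qed

text \<open>For fixed \<open>z\<close> in the disk the kernel series converges uniformly in the
  other variable, so it can be integrated term by term against an integrable function.\<close>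

lemma bergman_projection_eq_proj:
  assumes [measurable]: "f' \<in> borel_measurable borel" and f': "integrable area f'"
    and eq: "AE z in lborel. norm z < 1 \<longrightarrow> f z = f' z" and z: "norm z < 1"
  shows "bergman_projection \<omega> f z = proj f' z"
proof -
  define a where "a = (\<lambda>n. z ^ n / of_real (moment (2 * real n)))"
  have sa: "summable (\<lambda>n. norm (a n))"
    using summable_moment[of "norm z"] z moment_pos
    by (simp add: a_def norm_divide norm_power less_imp_le)
  \<comment> \<open>Cut off outside the closed disk so that the bound by 1 holds at every point, as
    \<open>power_series_integral\<close> demands.\<close>
  define e where "e = (\<lambda>\<zeta>::complex. if norm \<zeta> \<le> 1 then cnj \<zeta> else 0)"
  have [measurable]: "e \<in> borel_measurable borel" unfolding e_def by measurable
  have e1: "norm (e \<zeta>) \<le> 1" for \<zeta> by (simp add: e_def)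
  have [measurable]: "bergman_kernel \<omega> z \<in> borel_measurable borel"
    unfolding bergman_kernel_def by measurable
  have ker: "cnj (bergman_kernel \<omega> z \<zeta>) = (\<Sum>n. a n * e \<zeta> ^ n)" if "norm \<zeta> < 1" for \<zeta>
  proof -
    have "summable (\<lambda>n. norm (a n * e \<zeta> ^ n))"
      by (rule summable_comparison_test'[OF sa])
         (use e1 in \<open>auto simp: norm_mult norm_power intro!: mult_right_le_one_le power_le_one\<close>)
    then have s: "(\<lambda>n. a n * e \<zeta> ^ n) sums (\<Sum>n. a n * e \<zeta> ^ n)"
      by (rule summable_sums[OF summable_norm_cancel])
    have "(\<lambda>n. cnj (a n * e \<zeta> ^ n)) sums cnj (\<Sum>n. a n * e \<zeta> ^ n)"
      using s by (simp only: sums_cnj)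
    moreover have "cnj (a n * e \<zeta> ^ n) = (cnj z * \<zeta>) ^ n / of_real (2 * weight_moment \<omega> (2 * real n + 1))" for n
      unfolding weight_moment_eq using that by (simp add: a_def e_def power_mult_distrib)
    ultimately have "bergman_kernel \<omega> z \<zeta> = cnj (\<Sum>n. a n * e \<zeta> ^ n)"
      unfolding bergman_kernel_def by (simp add: sums_iff)
    then show ?thesis by simp
  qed
  have "bergman_projection \<omega> f z = (LINT \<zeta>|area. f' \<zeta> * cnj (bergman_kernel \<omega> z \<zeta>))"
    unfolding bergman_projection_def
  proof (rule disk_area_integral(2))
    show "AE \<zeta> in lborel. norm \<zeta> < 1 \<longrightarrow> f \<zeta> * cnj (bergman_kernel \<omega> z \<zeta>) * of_real (\<omega> (norm \<zeta>)) =
        w (norm \<zeta>) *\<^sub>R (f' \<zeta> * cnj (bergman_kernel \<omega> z \<zeta>))"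
      using eq weight_norm_AE by eventually_elim (auto simp: scaleR_conv_of_real mult_ac)
  qed measurable
  also have "\<dots> = (LINT \<zeta>|area. (\<Sum>n. a n * e \<zeta> ^ n) * f' \<zeta>)"
  proof (rule integral_cong_AE)
    show "AE \<zeta> in area. f' \<zeta> * cnj (bergman_kernel \<omega> z \<zeta>) = (\<Sum>n. a n * e \<zeta> ^ n) * f' \<zeta>"
      using AE_area by eventually_elim (simp add: ker)
  qed measurable
  also have "\<dots> = (\<Sum>n. a n * (LINT \<zeta>|area. e \<zeta> ^ n * f' \<zeta>))"
    by (rule sums_unique, rule power_series_integral(2)[OF _ _ e1 f' sa]) measurable
  also have "\<dots> = proj f' z"
    unfolding proj_def
  proof (rule suminf_cong)
    fix n
    have "(LINT \<zeta>|area. e \<zeta> ^ n * f' \<zeta>) = coeff f' n"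
      unfolding coeff_def
    proof (rule integral_cong_AE)
      show "AE \<zeta> in area. e \<zeta> ^ n * f' \<zeta> = cnj \<zeta> ^ n * f' \<zeta>"
        using AE_area by eventually_elim (simp add: e_def)
    qed measurable
    then show "a n * (LINT \<zeta>|area. e \<zeta> ^ n * f' \<zeta>) = coeff f' n / of_real (moment (2 * real n)) * z ^ n"
      by (simp add: a_def)
  qed
  finally show ?thesis .
qed

lemma Lp_weighted_iff:
  assumes f': "f' \<in> borel_measurable borel" and eq: "AE z in lborel. norm z < 1 \<longrightarrow> f z = f' z"
  shows "f \<in> Lp_weighted \<omega> p \<longleftrightarrow> integrable area (\<lambda>z. norm (f' z) powr p)"
    and "Lp_weighted_norm \<omega> p f = Lnorm area p f'"
proof -
  note [measurable] = f'
  have m: "(\<lambda>z. norm (f' z) powr p) \<in> borel_measurable borel" by measurable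
  have ae: "AE z in lborel. norm z < 1 \<longrightarrow> norm (f z) powr p * \<omega> (norm z) = w (norm z) *\<^sub>R (norm (f' z) powr p)"
    using eq weight_norm_AE by eventually_elim auto
  show "f \<in> Lp_weighted \<omega> p \<longleftrightarrow> integrable area (\<lambda>z. norm (f' z) powr p)"
    unfolding Lp_weighted_def using borel_measurable_disk_area_AE_eq[OF f' eq] disk_area_integral(1)[OF m ae] by auto
  show "Lp_weighted_norm \<omega> p f = Lnorm area p f'"
    unfolding Lp_weighted_norm_def Lnorm_def disk_area_integral(2)[OF m ae] ..
qed

text \<open>Both norms and the projection inside the disk depend on a function only up to null sets,
  so Borel representatives suffice.\<close>

lemma bounded_on_Lp_iff:
  assumes p: "p > 1"
  shows "bounded_on_Lp (bergman_projection \<omega>) \<omega> p \<longleftrightarrow>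
    (\<exists>C. \<forall>f. f \<in> borel_measurable borel \<and> integrable area (\<lambda>z. norm (f z) powr p) \<longrightarrow>
      integrable area (\<lambda>z. norm (proj f z) powr p) \<and> Lnorm area p (proj f) \<le> C * Lnorm area p f)"
    (is "_ \<longleftrightarrow> (\<exists>C. ?bd C)")
proof -
  have proj: "AE z in lborel. norm z < 1 \<longrightarrow> bergman_projection \<omega> f z = proj f' z"
    if f'm: "f' \<in> borel_measurable borel" and f'p: "integrable area (\<lambda>z. norm (f' z) powr p)"
      and eq: "AE z in lborel. norm z < 1 \<longrightarrow> f z = f' z" for f f'
  proof -
    have "integrable area f'"
      using integrable_of_powr_integrable[OF area.finite_measure_axioms, of p f'] p f'm f'p by simp
    from bergman_projection_eq_proj[OF f'm this eq] show ?thesis by simp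
  qed
  show ?thesis
  proof
    assume "bounded_on_Lp (bergman_projection \<omega>) \<omega> p"
    then obtain C where C: "\<And>f. f \<in> Lp_weighted \<omega> p \<Longrightarrow> bergman_projection \<omega> f \<in> Lp_weighted \<omega> p \<and>
        Lp_weighted_norm \<omega> p (bergman_projection \<omega> f) \<le> C * Lp_weighted_norm \<omega> p f"
      unfolding bounded_on_Lp_def by blast
    have "?bd C"
    proof (intro allI impI)
      fix f :: "complex \<Rightarrow> complex"
      assume f: "f \<in> borel_measurable borel \<and> integrable area (\<lambda>z. norm (f z) powr p)"
      have eq: "AE z in lborel. norm z < 1 \<longrightarrow> f z = f z" by simp
      note L = Lp_weighted_iff[OF conjunct1[OF f] eq]
      note L' = Lp_weighted_iff[OF measurable_proj proj[OF conjunct1[OF f] conjunct2[OF f] eq]]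
      show "integrable area (\<lambda>z. norm (proj f z) powr p) \<and> Lnorm area p (proj f) \<le> C * Lnorm area p f"
        using C[of f] f unfolding L L' by blast
    qed
    then show "\<exists>C. ?bd C" ..
  next
    assume "\<exists>C. ?bd C"
    then obtain C where C: "?bd C" ..
    show "bounded_on_Lp (bergman_projection \<omega>) \<omega> p"
      unfolding bounded_on_Lp_def
    proof (intro exI[of _ C] ballI)
      fix f assume f: "f \<in> Lp_weighted \<omega> p"
      then have "f \<in> borel_measurable disk_area" by (simp add: Lp_weighted_def)
      then obtain f' where f': "f' \<in> borel_measurable borel" "AE z in lborel. norm z < 1 \<longrightarrow> f z = f' z"
        by (rule borel_representative_disk_area)
      note L = Lp_weighted_iff[OF f']
      have f'p: "integrable area (\<lambda>z. norm (f' z) powr p)" using f unfolding L .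
      note L' = Lp_weighted_iff[OF measurable_proj proj[OF f'(1) f'p f'(2)]]
      show "bergman_projection \<omega> f \<in> Lp_weighted \<omega> p \<and>
        Lp_weighted_norm \<omega> p (bergman_projection \<omega> f) \<le> C * Lp_weighted_norm \<omega> p f"
        unfolding L(2) L' using C f'(1) f'p by blast
    qed
  qed
qed

lemma bounded_on_L2: "bounded_on_Lp (bergman_projection \<omega>) \<omega> 2"
proof -
  have "integrable area (\<lambda>z. norm (proj f z) powr 2) \<and> Lnorm area 2 (proj f) \<le> 1 * Lnorm area 2 f"
    if f: "f \<in> borel_measurable borel \<and> integrable area (\<lambda>z. norm (f z) powr 2)" for f
  proof -
    note b = proj_bounded_2[OF conjunct1[OF f] conjunct2[OF f]]
    have "Lnorm area 2 (proj f) \<le> Lnorm area 2 f"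
      unfolding Lnorm_def by (intro powr_mono2 b(2) integral_nonneg_AE) auto
    then show ?thesis using b(1) by simp
  qed
  then show ?thesis by (subst bounded_on_Lp_iff) (auto intro: exI[of _ 1])
qed

lemma bounded_on_Lp_all:
  assumes p: "p > 1" "p \<noteq> 2" and bdd: "bounded_on_Lp (bergman_projection \<omega>) \<omega> p" and s: "s > 1"
  shows "bounded_on_Lp (bergman_projection \<omega>) \<omega> s"
proof -
  obtain C where C: "\<And>f. f \<in> borel_measurable borel \<Longrightarrow> integrable area (\<lambda>z. norm (f z) powr p) \<Longrightarrow>
      Lnorm area p (proj f) \<le> C * Lnorm area p f"
    using bdd unfolding bounded_on_Lp_iff[OF p(1)] by blast
  obtain D where D: "D > 0" "\<And>x. 0 \<le> x \<Longrightarrow> moment x \<le> D * moment (2 * x)"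
    using doubling_of_bounded[OF p C] by blast
  obtain B where B: "B \<ge> 0" "\<And>f. f \<in> borel_measurable borel \<Longrightarrow> integrable area (\<lambda>z. norm (f z) powr s) \<Longrightarrow>
      integrable area (\<lambda>z. norm (proj f z) powr s) \<and> (LINT z|area. norm (proj f z) powr s) \<le> (B * Lnorm area s f) powr s"
    using proj_bounded_of_doubling[OF s D] by blast
  have "integrable area (\<lambda>z. norm (proj f z) powr s) \<and> Lnorm area s (proj f) \<le> B * Lnorm area s f"
    if f: "f \<in> borel_measurable borel \<and> integrable area (\<lambda>z. norm (f z) powr s)" for f
  proof -
    note b = B(2)[OF conjunct1[OF f] conjunct2[OF f]]
    have "Lnorm area s (proj f) \<le> ((B * Lnorm area s f) powr s) powr (1/s)"
      unfolding Lnorm_def[of _ _ "proj f"] using b s by (intro powr_mono2 integral_nonneg_AE) auto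
    also have "\<dots> = B * Lnorm area s f" using B(1) s by (simp add: powr_powr)
    finally show ?thesis using b by simp
  qed
  then show ?thesis unfolding bounded_on_Lp_iff[OF s] by blast
qed

end

lemma radial_weight_representative:
  assumes "radial_weight \<omega>"
  obtains w where "weight_representative w \<omega>"
proof -
  have nn: "\<And>r. r \<in> {0..<1} \<Longrightarrow> 0 \<le> \<omega> r" and int: "integrable lebesgue (\<lambda>r. indicat_real {0..<1} r *\<^sub>R \<omega> r)"
    and pos: "\<And>r. r \<in> {0..<1} \<Longrightarrow> 0 < weight_hat \<omega> r"
    using assms by (auto simp: radial_weight_def set_integrable_def)
  obtain g where g [measurable]: "g \<in> borel_measurable lborel"
    and ae: "AE r in lborel. indicat_real {0..<1} r *\<^sub>R \<omega> r = g r"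
    using completion_ex_borel_measurable_real[OF borel_measurable_integrable[OF int]] by blast
  \<comment> \<open>Completion yields a Borel function that agrees with the weight only almost
    everywhere; the maximum and the indicator restore sign and support at every point.\<close>
  define w where "w = (\<lambda>r. indicat_real {0..<1} r * max 0 (g r))"
  have [measurable]: "w \<in> borel_measurable borel" using g unfolding w_def by measurable
  have rep: "AE r in lborel. r \<in> {0..<1} \<longrightarrow> \<omega> r = w r"
    using ae
  proof eventually_elim
    case (elim r)
    then show ?case using nn[of r] by (auto simp: w_def)
  qed
  have sub: "AE r in lborel. indicat_real {s..<1} r *\<^sub>R \<omega> r = indicat_real {s..<1} r * w r" if "0 \<le> s" for s
    using rep by eventually_elim (use that in \<open>auto simp: indicator_def\<close>)
  have wl: "(\<lambda>r. indicat_real {s..<1} r * w r) \<in> borel_measurable lborel" for s by measurable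
  have w0: "indicat_real {0..<1} r * w r = w r" for r by (simp add: w_def indicator_def)
  have "integrable lebesgue (\<lambda>r. indicat_real {0..<1} r * w r)"
    using int integrable_cong_AE[OF borel_measurable_integrable[OF int] measurable_completion[OF wl]
        AE_completion[OF sub[OF order_refl]]] by blast
  then have w_int: "integrable lborel w" using integrable_completion[OF wl[of 0]] by (simp only: w0)
  have w_pos: "0 < (LINT r|lborel. indicat_real {s..<1} r * w r)" if s: "0 \<le> s" "s < 1" for s
  proof -
    have "weight_hat \<omega> s = (LINT r|lebesgue. indicat_real {s..<1} r * w r)"
      unfolding weight_hat_def set_lebesgue_integral_def
      by (rule integral_cong_AE[OF measurable_lebesgue_AE_eq[OF wl sub[OF s(1)]] measurable_completion[OF wl] AE_completion[OF sub[OF s(1)]]])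
    also have "\<dots> = (LINT r|lborel. indicat_real {s..<1} r * w r)" by (rule integral_completion[OF wl])
    finally show ?thesis using pos[of s] s by simp
  qed
  have "weight_representative w \<omega>"
  proof
    show "0 \<le> w r" "r \<notin> {0..<1} \<Longrightarrow> w r = 0" for r by (auto simp: w_def)
  qed (use w_int w_pos rep in auto)
  then show ?thesis by (rule that)
qed

theorem corollary1p2:
  fixes \<omega> :: "real \<Rightarrow> real"
  assumes "radial_weight \<omega>"
  shows "(\<forall>p>1. bounded_on_Lp (bergman_projection \<omega>) \<omega> p \<longleftrightarrow> p = 2) \<or>
         (\<forall>p>1. bounded_on_Lp (bergman_projection \<omega>) \<omega> p)"
proof -
  obtain w where "weight_representative w \<omega>" using radial_weight_representative[OF assms] .
  then interpret weight_representative w \<omega> .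
  \<comment> \<open>If no exponent other than 2 is bounded the first alternative holds; a single
    further exponent forces the second.\<close>
  show ?thesis using bounded_on_L2 bounded_on_Lp_all by metis
qed

end
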